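(* Let $Y=\mathrm{TV}(\Sigma)$ be a smooth, complete toric surface. Then for all $u\in M$, $$\dim T_Y^1(u)=\#\left\{\rho_i\in\Sigma^{(1)}\ :\ \langle\nu(\rho_i),u\rangle=-1,\ \langle\nu(\rho_{i+1}),u\rangle<0\ \text{and}\ \langle\nu(\rho_{i-1}),u\rangle<0\right\}.$$ Furthermore, $T_Y^2=0$, i.e. $Y$ is unobstructed.
   Context: Everything is over $\mathbb{C}$. $N$ is a lattice of rank $2$ with dual lattice $M$, and $\Sigma$ is a complete smooth fan on $N_\mathbb{Q}$. Its rays $\rho_1,\ldots,\rho_l$ (the elements of $\Sigma^{(1)}$) are numbered in counterclockwise order, with indices read modulo $l$ (so $\rho_{l+1}=\rho_1$, $\rho_0=\rho_l$). $\nu(\rho_i)\in N$ is the minimal lattice generator of $\rho_i$. $\mathcal{T}_Y$ is the tangent sheaf, $T_Y^1=H^1(Y,\mathcal{T}_Y)$ is the space of infinitesimal deformations and $T_Y^2=H^2(Y,\mathcal{T}_Y)$ the obstruction space; $T_Y^1$ carries a natural $M$-grading, and $T_Y^1(u)$ denotes its component of degree $u$. (In this grading, $\chi^u$ times a torus-invariant vector field has degree $u$.) *)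

theory Defs
  imports
    "HOL-Analysis.Abstract_Topology"
    "HOL-Library.Function_Algebras"
    "HOL-Library.FuncSet"
    "HOL-Algebra.Ideal"
    "HOL-Computational_Algebra.Polynomial_Factorial"
begin

section \<open>Fans in a lattice of rank 2\<close>

text \<open>Both N and its dual M are the integer pairs, paired by the dot product;
  the rational vector space of N is the set of rational pairs.\<close>

type_synonym latt = "int \<times> int"

definition lpair :: "latt \<Rightarrow> latt \<Rightarrow> int" where
  "lpair n u = fst n * fst u + snd n * snd u"

definition qpair :: "rat \<times> rat \<Rightarrow> latt \<Rightarrow> rat" where
  "qpair w u = fst w * of_int (fst u) + snd w * of_int (snd u)"

definition latt_pt :: "latt \<Rightarrow> rat \<times> rat" where
  "latt_pt n = (of_int (fst n), of_int (snd n))"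

definition pos_hull :: "latt set \<Rightarrow> (rat \<times> rat) set" where
  "pos_hull S = {w. \<exists>a. (\<forall>v\<in>S. 0 \<le> a v) \<and>
      w = (\<Sum>v\<in>S. a v * of_int (fst v), \<Sum>v\<in>S. a v * of_int (snd v))}"

definition polyhedral_cone :: "(rat \<times> rat) set \<Rightarrow> bool" where
  "polyhedral_cone \<sigma> \<longleftrightarrow> (\<exists>S. finite S \<and> \<sigma> = pos_hull S)"

definition strongly_convex :: "(rat \<times> rat) set \<Rightarrow> bool" where
  "strongly_convex \<sigma> \<longleftrightarrow> (\<forall>x y. (x, y) \<in> \<sigma> \<and> (- x, - y) \<in> \<sigma> \<longrightarrow> x = 0 \<and> y = 0)"

text \<open>The monoid of M-points of the dual cone.\<close>

definition dual_monoid :: "(rat \<times> rat) set \<Rightarrow> latt set" where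
  "dual_monoid \<sigma> = {u. \<forall>w\<in>\<sigma>. 0 \<le> qpair w u}"

definition face_of_cone :: "(rat \<times> rat) set \<Rightarrow> (rat \<times> rat) set \<Rightarrow> bool" where
  "face_of_cone \<tau> \<sigma> \<longleftrightarrow> (\<exists>u\<in>dual_monoid \<sigma>. \<tau> = {w\<in>\<sigma>. qpair w u = 0})"

definition fan :: "(rat \<times> rat) set set \<Rightarrow> bool" where
  "fan \<Sigma> \<longleftrightarrow> finite \<Sigma> \<and> \<Sigma> \<noteq> {} \<and>
     (\<forall>\<sigma>\<in>\<Sigma>. polyhedral_cone \<sigma> \<and> strongly_convex \<sigma>) \<and>
     (\<forall>\<sigma>\<in>\<Sigma>. \<forall>\<tau>. face_of_cone \<tau> \<sigma> \<longrightarrow> \<tau> \<in> \<Sigma>) \<and>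
     (\<forall>\<sigma>\<in>\<Sigma>. \<forall>\<tau>\<in>\<Sigma>. face_of_cone (\<sigma> \<inter> \<tau>) \<sigma> \<and> face_of_cone (\<sigma> \<inter> \<tau>) \<tau>)"

definition complete_fan :: "(rat \<times> rat) set set \<Rightarrow> bool" where
  "complete_fan \<Sigma> \<longleftrightarrow> fan \<Sigma> \<and> \<Union>\<Sigma> = UNIV"

definition lattice_basis :: "latt \<Rightarrow> latt \<Rightarrow> bool" where
  "lattice_basis e f \<longleftrightarrow>
     (\<forall>n. \<exists>!(a, b). n = (a * fst e + b * fst f, a * snd e + b * snd f))"

definition smooth_fan :: "(rat \<times> rat) set set \<Rightarrow> bool" where
  "smooth_fan \<Sigma> \<longleftrightarrow> fan \<Sigma> \<and>
     (\<forall>\<sigma>\<in>\<Sigma>. \<exists>e f S. lattice_basis e f \<and> S \<subseteq> {e, f} \<and> \<sigma> = pos_hull S)"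

definition rays :: "(rat \<times> rat) set set \<Rightarrow> (rat \<times> rat) set set" where
  "rays \<Sigma> = {\<rho>\<in>\<Sigma>. \<exists>v. v \<noteq> (0, 0) \<and> \<rho> = pos_hull {v}}"

text \<open>The generator of the monoid of lattice points of a ray.\<close>

definition ray_gen :: "(rat \<times> rat) set \<Rightarrow> latt" where
  "ray_gen \<rho> = (THE v. {n. latt_pt n \<in> \<rho>} = range (\<lambda>k::nat. (int k * fst v, int k * snd v)))"

definition ccw_numbering :: "(rat \<times> rat) set set \<Rightarrow> nat \<Rightarrow> (nat \<Rightarrow> (rat \<times> rat) set) \<Rightarrow> bool" where
  "ccw_numbering \<Sigma> l \<rho> \<longleftrightarrow> bij_betw \<rho> {..<l} (rays \<Sigma>) \<and>
     (\<exists>\<theta> :: nat \<Rightarrow> real.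
        (\<forall>i<l. \<exists>r>0. of_int (fst (ray_gen (\<rho> i))) = r * cos (\<theta> i) \<and>
                     of_int (snd (ray_gen (\<rho> i))) = r * sin (\<theta> i)) \<and>
        (\<forall>i j. i < j \<and> j < l \<longrightarrow> \<theta> i < \<theta> j) \<and>
        (\<forall>i<l. \<theta> i < \<theta> 0 + 2 * pi))"


section \<open>The toric variety of a fan\<close>

text \<open>The field of rational functions on the torus with character lattice M is the
  field of rational functions in two variables (the first one is the inner variable).\<close>

type_synonym ratfun = "complex poly poly fract"

definition rconst :: "complex \<Rightarrow> ratfun" where
  "rconst c = to_fract [:[:c:]:]"

definition chi :: "latt \<Rightarrow> ratfun" where
  "chi u = to_fract [:[:0, 1:]:] powi fst u * to_fract [:0, 1:] powi snd u"

definition chart_ring :: "(rat \<times> rat) set \<Rightarrow> ratfun set" where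
  "chart_ring \<sigma> = {f. \<exists>S c. finite S \<and> S \<subseteq> dual_monoid \<sigma> \<and> f = (\<Sum>u\<in>S. rconst (c u) * chi u)}"

definition subring_of :: "'a::field set \<Rightarrow> 'a ring" where
  "subring_of A = \<lparr>carrier = A, monoid.mult = (*), one = 1, zero = 0, add = (+)\<rparr>"

definition Spec :: "'a::field set \<Rightarrow> 'a set set" where
  "Spec A = {P. primeideal P (subring_of A)}"

definition Spec_open :: "'a::field set \<Rightarrow> 'a set set \<Rightarrow> bool" where
  "Spec_open A W \<longleftrightarrow> (\<exists>I\<subseteq>A. W = {P\<in>Spec A. \<not> I \<subseteq> P})"

definition localization :: "'a::field set \<Rightarrow> 'a set \<Rightarrow> 'a set" where
  "localization A P = {a / s | a s. a \<in> A \<and> s \<in> A - P}"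

text \<open>The spectra of the chart rings, for the cones of a fan, are glued along the spectra
  belonging to common faces. The result is an integral separated scheme, so a point is
  determined by its local ring inside the function field, and points of two charts get
  identified iff these local rings agree. The scheme is therefore represented by the set of
  its local rings: a point is its own stalk of the structure sheaf.\<close>

definition TV_points :: "(rat \<times> rat) set set \<Rightarrow> ratfun set set" where
  "TV_points \<Sigma> = {localization (chart_ring \<sigma>) P | \<sigma> P. \<sigma> \<in> \<Sigma> \<and> P \<in> Spec (chart_ring \<sigma>)}"

definition TV_open :: "(rat \<times> rat) set set \<Rightarrow> ratfun set set \<Rightarrow> bool" where
  "TV_open \<Sigma> U \<longleftrightarrow> U \<subseteq> TV_points \<Sigma> \<and>
     (\<forall>\<sigma>\<in>\<Sigma>. Spec_open (chart_ring \<sigma>)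
        {P\<in>Spec (chart_ring \<sigma>). localization (chart_ring \<sigma>) P \<in> U})"

definition TV :: "(rat \<times> rat) set set \<Rightarrow> ratfun set topology" where
  "TV \<Sigma> = topology (TV_open \<Sigma>)"

lemma Spec_open_Int:
  assumes "Spec_open A V" "Spec_open A W"
  shows "Spec_open A (V \<inter> W)"
proof -
  obtain I J where I: "I \<subseteq> A" "V = {P\<in>Spec A. \<not> I \<subseteq> P}"
    and J: "J \<subseteq> A" "W = {P\<in>Spec A. \<not> J \<subseteq> P}"
    using assms unfolding Spec_open_def by blast
  define K where "K = {x * y | x y. x \<in> I \<and> y \<in> J} \<inter> A"
  have "\<not> K \<subseteq> P \<longleftrightarrow> \<not> I \<subseteq> P \<and> \<not> J \<subseteq> P" if "P \<in> Spec A" for P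
  proof -
    interpret primeideal P "subring_of A" using that by (simp add: Spec_def)
    have closed: "x * y \<in> A" if "x \<in> A" "y \<in> A" for x y
      using m_closed[of x y] that by (simp add: subring_of_def)
    have l: "x * y \<in> P" if "x \<in> A" "y \<in> P" for x y
      using I_l_closed[of y x] that by (simp add: subring_of_def)
    have r: "x * y \<in> P" if "x \<in> P" "y \<in> A" for x y
      using I_r_closed[of x y] that by (simp add: subring_of_def)
    have pr: "x \<in> P \<or> y \<in> P" if "x \<in> A" "y \<in> A" "x * y \<in> P" for x y
      using I_prime[of x y] that by (simp add: subring_of_def)
    show ?thesis
    proof
      assume "\<not> K \<subseteq> P"
      then obtain x y where xy: "x \<in> I" "y \<in> J" "x * y \<notin> P" unfolding K_def by blast
      then have "x \<notin> P" "y \<notin> P" using I(1) J(1) l r by blast+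
      with xy show "\<not> I \<subseteq> P \<and> \<not> J \<subseteq> P" by blast
    next
      assume "\<not> I \<subseteq> P \<and> \<not> J \<subseteq> P"
      then obtain x y where xy: "x \<in> I" "x \<notin> P" "y \<in> J" "y \<notin> P" by blast
      then have A: "x \<in> A" "y \<in> A" using I(1) J(1) by auto
      have "x * y \<in> K" unfolding K_def using xy closed[OF A] by blast
      moreover have "x * y \<notin> P" using pr[OF A] xy by blast
      ultimately show "\<not> K \<subseteq> P" by blast
    qed
  qed
  then have "V \<inter> W = {P\<in>Spec A. \<not> K \<subseteq> P}" using I(2) J(2) by blast
  moreover have "K \<subseteq> A" unfolding K_def by blast
  ultimately show ?thesis unfolding Spec_open_def by blast
qed

lemma Spec_open_Union:
  assumes "\<And>W. W \<in> \<W> \<Longrightarrow> Spec_open A W"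
  shows "Spec_open A (\<Union>\<W>)"
proof -
  from assms have "\<forall>W\<in>\<W>. \<exists>I. I \<subseteq> A \<and> W = {P\<in>Spec A. \<not> I \<subseteq> P}"
    unfolding Spec_open_def by blast
  then obtain I where I: "\<And>W. W \<in> \<W> \<Longrightarrow> I W \<subseteq> A"
    "\<And>W. W \<in> \<W> \<Longrightarrow> W = {P\<in>Spec A. \<not> I W \<subseteq> P}" by metis
  have "P \<in> \<Union>\<W> \<longleftrightarrow> P \<in> {P\<in>Spec A. \<not> (\<Union>W\<in>\<W>. I W) \<subseteq> P}" for P
  proof -
    have "P \<in> W \<longleftrightarrow> P \<in> Spec A \<and> \<not> I W \<subseteq> P" if "W \<in> \<W>" for W
      using I(2)[OF that] by blast
    then show ?thesis by blast
  qed
  then have "\<Union>\<W> = {P\<in>Spec A. \<not> (\<Union>W\<in>\<W>. I W) \<subseteq> P}" by blast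
  moreover have "(\<Union>W\<in>\<W>. I W) \<subseteq> A" using I(1) by blast
  ultimately show ?thesis unfolding Spec_open_def by blast
qed

lemma istopology_TV_open: "istopology (TV_open \<Sigma>)"
  unfolding istopology_def
proof (intro conjI allI impI)
  fix S T assume *: "TV_open \<Sigma> S" "TV_open \<Sigma> T"
  have "{P\<in>Spec A. localization A P \<in> S \<inter> T} =
      {P\<in>Spec A. localization A P \<in> S} \<inter> {P\<in>Spec A. localization A P \<in> T}" for A :: "ratfun set"
    by blast
  with * show "TV_open \<Sigma> (S \<inter> T)"
    unfolding TV_open_def by (auto intro: Spec_open_Int)
next
  fix \<K> assume *: "\<forall>K\<in>\<K>. TV_open \<Sigma> K"
  have eq: "{P\<in>Spec A. localization A P \<in> \<Union>\<K>} =
      \<Union>((\<lambda>K. {P\<in>Spec A. localization A P \<in> K}) ` \<K>)" for A :: "ratfun set"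
    by blast
  have "Spec_open (chart_ring \<sigma>)
      {P\<in>Spec (chart_ring \<sigma>). localization (chart_ring \<sigma>) P \<in> \<Union>\<K>}" if "\<sigma> \<in> \<Sigma>" for \<sigma>
    unfolding eq by (rule Spec_open_Union) (use * that in \<open>auto simp: TV_open_def\<close>)
  moreover have "\<Union>\<K> \<subseteq> TV_points \<Sigma>" using * unfolding TV_open_def by blast
  ultimately show "TV_open \<Sigma> (\<Union>\<K>)" unfolding TV_open_def by blast
qed

lemma openin_TV: "openin (TV \<Sigma>) = TV_open \<Sigma>"
  unfolding TV_def by (rule topology_inverse') (rule istopology_TV_open)

lemma Spec_open_Spec: "Spec_open A (Spec A)"
proof -
  have "\<not> A \<subseteq> P" if "P \<in> Spec A" for P
  proof -
    interpret primeideal P "subring_of A" using that by (simp add: Spec_def)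
    show ?thesis using I_notcarr a_subset by (auto simp: subring_of_def)
  qed
  then show ?thesis unfolding Spec_open_def by blast
qed

lemma topspace_TV: "topspace (TV \<Sigma>) = TV_points \<Sigma>"
proof -
  have "{P\<in>Spec (chart_ring \<sigma>). localization (chart_ring \<sigma>) P \<in> TV_points \<Sigma>}
      = Spec (chart_ring \<sigma>)" if "\<sigma> \<in> \<Sigma>" for \<sigma>
    using that unfolding TV_points_def by blast
  then have "TV_open \<Sigma> (TV_points \<Sigma>)"
    unfolding TV_open_def by (auto simp: Spec_open_Spec)
  moreover have "U \<subseteq> TV_points \<Sigma>" if "TV_open \<Sigma> U" for U
    using that by (simp add: TV_open_def)
  ultimately show ?thesis unfolding topspace_def openin_TV by blast
qed

text \<open>Sections of the structure sheaf over a nonempty open set.\<close>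

definition TV_functions :: "ratfun set set \<Rightarrow> ratfun set" where
  "TV_functions U = \<Inter>U"


section \<open>The tangent sheaf\<close>

definition derivation :: "(ratfun \<Rightarrow> ratfun) \<Rightarrow> bool" where
  "derivation D \<longleftrightarrow> (\<forall>c. D (rconst c) = 0) \<and> (\<forall>f g. D (f + g) = D f + D g) \<and>
     (\<forall>f g. D (f * g) = f * D g + g * D f)"

text \<open>A section over a nonempty open set is a complex-linear derivation of the restricted
  structure sheaf. It extends uniquely to the function field, so sections are represented as
  derivations of the function field, and restriction maps are inclusions.\<close>

definition tangent_sheaf :: "(rat \<times> rat) set set \<Rightarrow> ratfun set set \<Rightarrow> (ratfun \<Rightarrow> ratfun) set" where
  "tangent_sheaf \<Sigma> U = {D. derivation D \<and>
     (\<forall>V. openin (TV \<Sigma>) V \<and> V \<noteq> {} \<and> V \<subseteq> U \<longrightarrow> D ` TV_functions V \<subseteq> TV_functions V)}"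

text \<open>Degree u: the derivation maps every character of exponent v to a multiple of the
  character of exponent u + v. Hence the product of the character of exponent u with a
  torus-invariant vector field has degree u.\<close>

definition homogeneous_derivation :: "latt \<Rightarrow> (ratfun \<Rightarrow> ratfun) \<Rightarrow> bool" where
  "homogeneous_derivation u D \<longleftrightarrow> derivation D \<and>
     (\<forall>v. \<exists>c. D (chi v) = rconst c * chi (fst u + fst v, snd u + snd v))"


section \<open>Cech cohomology\<close>

text \<open>Let X be an irreducible space and F a sheaf on X all of whose restriction maps between
  nonempty open sets are inclusions into a fixed vector space. The cohomology is the direct
  limit of Cech cohomology over all open covers. As usual one may restrict to the
  covers indexed by the points of X, where U x is a neighbourhood of x, refined by shrinking
  each U x. On cochains the refinement maps are inclusions, so the direct limit of the
  cochain complexes is a union inside the space of functions on tuples of points.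
  For a quasi-coherent sheaf on a separated noetherian scheme this is the cohomology in the
  sense of derived functors. An n-cochain takes lists of length n + 1; its values on other
  lists, or on lists with entries outside X, play no role.\<close>

definition cochains :: "'p topology \<Rightarrow> ('p set \<Rightarrow> 'v set) \<Rightarrow> nat \<Rightarrow> ('p list \<Rightarrow> 'v) set" where
  "cochains X F n = {c. \<exists>U. (\<forall>x\<in>topspace X. openin X (U x) \<and> x \<in> U x) \<and>
     (\<forall>xs. length xs = Suc n \<and> set xs \<subseteq> topspace X \<longrightarrow> c xs \<in> F (\<Inter>x\<in>set xs. U x))}"

definition cech_diff :: "('p list \<Rightarrow> 'v::ab_group_add) \<Rightarrow> 'p list \<Rightarrow> 'v" where
  "cech_diff c xs = (\<Sum>i<length xs.
     if even i then c (take i xs @ drop (Suc i) xs) else - c (take i xs @ drop (Suc i) xs))"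

definition cocycles :: "'p topology \<Rightarrow> ('p set \<Rightarrow> 'v::ab_group_add set) \<Rightarrow> nat \<Rightarrow> ('p list \<Rightarrow> 'v) set" where
  "cocycles X F n = {c\<in>cochains X F n.
     \<forall>xs. length xs = n + 2 \<and> set xs \<subseteq> topspace X \<longrightarrow> cech_diff c xs = 0}"

fun coboundaries :: "'p topology \<Rightarrow> ('p set \<Rightarrow> 'v::ab_group_add set) \<Rightarrow> nat \<Rightarrow> ('p list \<Rightarrow> 'v) set" where
  "coboundaries X F 0 = {c\<in>cochains X F 0.
     \<forall>xs. length xs = 1 \<and> set xs \<subseteq> topspace X \<longrightarrow> c xs = 0}"
| "coboundaries X F (Suc n) = {c\<in>cochains X F (Suc n). \<exists>b\<in>cochains X F n.
     \<forall>xs. length xs = n + 2 \<and> set xs \<subseteq> topspace X \<longrightarrow> c xs = cech_diff b xs}"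

definition cohom_class ::
    "'p topology \<Rightarrow> ('p set \<Rightarrow> 'v::ab_group_add set) \<Rightarrow> nat \<Rightarrow> ('p list \<Rightarrow> 'v) \<Rightarrow> ('p list \<Rightarrow> 'v) set" where
  "cohom_class X F n c = {d\<in>cocycles X F n. d - c \<in> coboundaries X F n}"

definition cohomology ::
    "'p topology \<Rightarrow> ('p set \<Rightarrow> 'v::ab_group_add set) \<Rightarrow> nat \<Rightarrow> ('p list \<Rightarrow> 'v) set set" where
  "cohomology X F n = cohom_class X F n ` cocycles X F n"


section \<open>Deformation and obstruction space\<close>

definition T1 :: "(rat \<times> rat) set set \<Rightarrow> (ratfun set list \<Rightarrow> ratfun \<Rightarrow> ratfun) set set" where
  "T1 \<Sigma> = cohomology (TV \<Sigma>) (tangent_sheaf \<Sigma>) 1"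

definition T2 :: "(rat \<times> rat) set set \<Rightarrow> (ratfun set list \<Rightarrow> ratfun \<Rightarrow> ratfun) set set" where
  "T2 \<Sigma> = cohomology (TV \<Sigma>) (tangent_sheaf \<Sigma>) 2"

text \<open>The component of degree u consists of the classes of cocycles all of whose values are
  homogeneous of degree u. One need not ask the cover to be torus-invariant: homogeneous
  sections extend to the torus-invariant hull of their domain, and the invariant hull of
  an intersection of two open sets contains every codimension one point of the
  intersection of their hulls.\<close>

definition T1_degree :: "(rat \<times> rat) set set \<Rightarrow> latt \<Rightarrow> (ratfun set list \<Rightarrow> ratfun \<Rightarrow> ratfun) set set" where
  "T1_degree \<Sigma> u = {\<xi>\<in>T1 \<Sigma>. \<exists>c\<in>\<xi>. \<forall>xs. length xs = 2 \<and> set xs \<subseteq> topspace (TV \<Sigma>) \<longrightarrow>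
     homogeneous_derivation u (c xs)}"

definition lin_comb ::
    "nat \<Rightarrow> (nat \<Rightarrow> 'p list \<Rightarrow> ratfun \<Rightarrow> ratfun) \<Rightarrow> (nat \<Rightarrow> complex) \<Rightarrow> 'p list \<Rightarrow> ratfun \<Rightarrow> ratfun" where
  "lin_comb n s a = (\<lambda>xs f. \<Sum>i<n. rconst (a i) * s i xs f)"

text \<open>A subspace W of the first cohomology has dimension n iff there are n classes, given by
  cocycles, such that forming linear combinations is a bijection from the n-tuples of
  complex numbers onto W.\<close>

definition T1_dim_eq ::
    "(rat \<times> rat) set set \<Rightarrow> (ratfun set list \<Rightarrow> ratfun \<Rightarrow> ratfun) set set \<Rightarrow> nat \<Rightarrow> bool" where
  "T1_dim_eq \<Sigma> W n \<longleftrightarrow> (\<exists>s. (\<forall>i<n. s i \<in> cocycles (TV \<Sigma>) (tangent_sheaf \<Sigma>) 1) \<and>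
     bij_betw (\<lambda>a. cohom_class (TV \<Sigma>) (tangent_sheaf \<Sigma>) 1 (lin_comb n s a))
       ({..<n} \<rightarrow>\<^sub>E (UNIV :: complex set)) W)"

end

theory Submission
  imports Defs "HOL-Library.Product_Plus"
begin

text \<open>A point is its own local ring, so a vector field is regular at a point iff it maps this ring
  to itself, and a nonempty set of points is handled pointwise: being a section over an open set
  is a condition on each of its points.

  A homogeneous 1-cocycle of degree u is a difference of fields given by a point n(x) of the complexified
  lattice N, one for each point x. Comparing at the generic points of the torus divisors shows that
  along a ray r the value n jumps by an arbitrary vector, a multiple of r, or not at all,
  according to whether the value of u at r is at least 0, equal to -1 or less. Since the rays on which u
  is nonnegative are consecutive, all jumps can be removed except those along rays with value -1 whose
  two neighbours are negative. These jumps survive: a regular field on a chart with two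
  negative rays has no component of degree u.

  For a 2-cocycle c and a fixed point p, put b(x, y) = c(p, x, y). A partition of unity makes
  b a coboundary modulo regular fields on each affine chart, and a second one makes these
  solutions agree, up to constant fields, on overlaps of charts. The remaining toric obstruction is a field
  on the torus. It is a sum of fields, each regular on the chart of some ray, since in every
  degree some ray is nonnegative.\<close>

section \<open>Laurent polynomials\<close>

text \<open>Cohomology is here a limit over all covers by neighbourhoods of points, so neither the
  cover by charts nor invariant neighbourhoods may be chosen, and the comparison with the charts has
  to be made by hand. In a fixed degree u the torus-fixed points make this possible: every
  neighbourhood of a fixed point contains the generic points of both invariant divisors through it,
  so neighbouring fixed points can be compared on the divisor they share, whatever the cover is. A
  2-cocycle has no degree, so there the passage to charts rests on clearing denominators; what
  remains is a single condition, that corrections on overlaps of consecutive charts close up after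
  one turn around the fan, and the grading enters only in meeting it. For the first cohomology the
  same closing problem is met by rotating the numbering, for each u separately, so that ray 0 is the
  last one before the negative rays (if there are any): the jump from the last chart back to the
  first then crosses a divisor along which every field of degree u is regular.\<close>

lemma rconst_add: "rconst (a + b) = rconst a + rconst b"
  unfolding rconst_def by (simp flip: to_fract_add)

lemma rconst_mult: "rconst (a * b) = rconst a * rconst b"
  unfolding rconst_def by (simp flip: to_fract_mult)

lemma rconst_uminus: "rconst (- a) = - rconst a"
  unfolding rconst_def by (simp flip: to_fract_uminus)

lemma rconst_diff: "rconst (a - b) = rconst a - rconst b"
  unfolding rconst_def by (simp flip: to_fract_diff)

lemma rconst_0 [simp]: "rconst 0 = 0"
  by (simp add: rconst_def)

lemma rconst_1 [simp]: "rconst 1 = 1"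
  unfolding rconst_def by (metis one_pCons to_fract_1)

lemma rconst_eq_0_iff [simp]: "rconst a = 0 \<longleftrightarrow> a = 0"
  by (simp add: rconst_def)

lemma rconst_eq_iff [simp]: "rconst a = rconst b \<longleftrightarrow> a = b"
  by (simp add: rconst_def)

lemma chi_nonzero [simp]: "chi u \<noteq> 0"
  by (simp add: chi_def)

lemma chi_add: "chi (u + v) = chi u * chi v"
  by (simp add: chi_def power_int_add)

lemma chi_0 [simp]: "chi 0 = 1" "chi (0, 0) = 1"
  by (simp_all add: chi_def)

lemma chi_uminus: "chi (- u) = inverse (chi u)"
  by (simp add: chi_def power_int_minus)

lemma chi_diff: "chi (u - v) = chi u / chi v"
  using chi_add[of u "- v"] by (simp add: chi_uminus divide_inverse)

lemma chi_pair: "chi (fst u + fst v, snd u + snd v) = chi u * chi v"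
  using chi_add[of u v] by (simp add: plus_prod_def)

text \<open>Makes coefficients accessible: Laurent monomials are moved into this range before
  polynomials are compared.\<close>

lemma chi_of_nat:
  assumes "0 \<le> a" "0 \<le> b"
  shows "rconst c * chi (a, b) = to_fract (monom (monom c (nat a)) (nat b))"
proof -
  have pw: "to_fract p ^ k = to_fract (p ^ k)" for p :: "complex poly poly" and k
    by (induction k) auto
  have 1: "[:[:0, 1:]:] ^ k = [:monom (1::complex) k:]" for k
    by (induction k) (auto simp: monom_Suc one_pCons)
  have 2: "[:0, 1:] ^ k = monom (1::complex poly) k" for k
    by (induction k) (simp_all add: monom_Suc monom_eq_1)
  have "rconst c * chi (a, b) = to_fract ([:[:c:]:] * ([:monom 1 (nat a):] * monom 1 (nat b)))"
    unfolding to_fract_mult using assms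
    by (simp add: chi_def rconst_def power_int_nonneg_exp pw 1 2)
  also have "[:[:c:]:] * ([:monom 1 (nat a):] * monom 1 (nat b)) = monom (monom c (nat a)) (nat b)"
    by (simp add: smult_monom)
  finally show ?thesis .
qed

text \<open>The Laurent polynomials supported in \<open>T\<close>. Chart rings are the case of a
  monoid; arbitrary \<open>T\<close> serve to express that certain coefficients vanish.\<close>

definition lspan :: "latt set \<Rightarrow> ratfun set" where
  "lspan T = {f. \<exists>S c. finite S \<and> S \<subseteq> T \<and> f = (\<Sum>u\<in>S. rconst (c u) * chi u)}"

lemma chart_ring_lspan: "chart_ring \<sigma> = lspan (dual_monoid \<sigma>)"
  by (simp add: chart_ring_def lspan_def)

lemma lspan_0 [simp]: "0 \<in> lspan T"
  unfolding lspan_def mem_Collect_eq by (intro exI[of _ "{}"]) simp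

lemma lspan_term: "u \<in> T \<Longrightarrow> rconst c * chi u \<in> lspan T"
  unfolding lspan_def mem_Collect_eq by (intro exI[of _ "{u}"] exI[of _ "\<lambda>_. c"]) simp

lemma lspan_chi: "u \<in> T \<Longrightarrow> chi u \<in> lspan T"
  using lspan_term[of u T 1] by simp

lemma lspan_mono: "S \<subseteq> T \<Longrightarrow> lspan S \<subseteq> lspan T"
  unfolding lspan_def by blast

lemma lspan_monoD: "f \<in> lspan S \<Longrightarrow> S \<subseteq> T \<Longrightarrow> f \<in> lspan T"
  using lspan_mono by blast

lemma lspan_add:
  assumes "f \<in> lspan T" "g \<in> lspan T"
  shows "f + g \<in> lspan T"
proof -
  obtain S c S' c' where *: "finite S" "S \<subseteq> T" "f = (\<Sum>u\<in>S. rconst (c u) * chi u)"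
    "finite S'" "S' \<subseteq> T" "g = (\<Sum>u\<in>S'. rconst (c' u) * chi u)"
    using assms unfolding lspan_def by blast
  let ?c = "\<lambda>u. if u \<in> S then c u else 0" and ?c' = "\<lambda>u. if u \<in> S' then c' u else 0"
  have "f = (\<Sum>u\<in>S \<union> S'. rconst (?c u) * chi u)" "g = (\<Sum>u\<in>S \<union> S'. rconst (?c' u) * chi u)"
    unfolding *(3,6) using *(1,4) by (auto intro!: sum.mono_neutral_cong_left simp del: sum.inter_restrict)
  then have "f + g = (\<Sum>u\<in>S \<union> S'. rconst (?c u + ?c' u) * chi u)"
    by (simp add: rconst_add sum.distrib distrib_right)
  then show ?thesis
    using *(1,2,4,5) unfolding lspan_def mem_Collect_eq
    by (intro exI[of _ "S \<union> S'"] exI[of _ "\<lambda>u. ?c u + ?c' u"]) simp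
qed

lemma lspan_sum: "(\<And>x. x \<in> A \<Longrightarrow> f x \<in> lspan T) \<Longrightarrow> sum f A \<in> lspan T"
  by (induction A rule: infinite_finite_induct) (auto intro: lspan_add)

lemma lspan_induct [consumes 1, case_names zero monom add]:
  assumes "f \<in> lspan T" "P 0" "\<And>c u. u \<in> T \<Longrightarrow> P (rconst c * chi u)"
    "\<And>f g. f \<in> lspan T \<Longrightarrow> g \<in> lspan T \<Longrightarrow> P f \<Longrightarrow> P g \<Longrightarrow> P (f + g)"
  shows "P f"
proof -
  obtain S c where *: "finite S" "S \<subseteq> T" "f = (\<Sum>u\<in>S. rconst (c u) * chi u)"
    using assms(1) unfolding lspan_def by blast
  have "P (\<Sum>u\<in>S. rconst (c u) * chi u)"
    using *(1,2) by (induction S) (auto intro!: assms lspan_sum lspan_term)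
  with *(3) show ?thesis by simp
qed

lemma lspan_term_mult:
  assumes "f \<in> lspan T" "\<And>v. v \<in> T \<Longrightarrow> u + v \<in> T'"
  shows "chi u * f \<in> lspan T'"
  using assms(1)
proof (induction rule: lspan_induct)
  case (monom c v)
  have "chi u * (rconst c * chi v) = rconst c * chi (u + v)" by (simp add: chi_add mult_ac)
  then show ?case using lspan_term assms(2)[OF monom] by metis
qed (auto simp: distrib_left intro: lspan_add)

lemma lspan_mult:
  assumes "f \<in> lspan T" "g \<in> lspan T'" "\<And>u v. u \<in> T \<Longrightarrow> v \<in> T' \<Longrightarrow> u + v \<in> T''"
  shows "f * g \<in> lspan T''"
  using assms(1)
proof (induction rule: lspan_induct)
  case (monom c u)
  from assms(2) have "rconst c * (chi u * g) \<in> lspan T''"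
  proof (induction rule: lspan_induct)
    case (monom d v)
    have "rconst c * (chi u * (rconst d * chi v)) = rconst (c * d) * chi (u + v)"
      by (simp add: chi_add mult_ac rconst_mult)
    then show ?case using lspan_term assms(3)[OF \<open>u \<in> T\<close> monom] by metis
  qed (auto simp: distrib_left intro: lspan_add)
  then show ?case by (simp add: mult_ac)
qed (auto simp: distrib_right intro: lspan_add)

lemma lspan_rconst_mult:
  assumes "f \<in> lspan T"
  shows "rconst c * f \<in> lspan T"
  using lspan_mult[OF lspan_term[of 0 "{0}" c] assms, of T] by simp

lemma lspan_uminus: "f \<in> lspan T \<Longrightarrow> - f \<in> lspan T"
  using lspan_rconst_mult[of f T "- 1"] by (simp add: rconst_uminus)

lemma lspan_diff: "f \<in> lspan T \<Longrightarrow> g \<in> lspan T \<Longrightarrow> f - g \<in> lspan T"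
  using lspan_add[of f T "- g"] lspan_uminus by simp

lemma lspan_union:
  assumes "f \<in> lspan (S \<union> T)"
  obtains g h where "g \<in> lspan S" "h \<in> lspan T" "f = g + h"
proof -
  from assms have "\<exists>g h. g \<in> lspan S \<and> h \<in> lspan T \<and> f = g + h"
  proof (induction rule: lspan_induct)
    case zero show ?case by (intro exI[of _ 0]) simp
  next
    case (monom c u)
    show ?case
    proof (cases "u \<in> S")
      case True
      then show ?thesis by (intro exI[of _ "rconst c * chi u"] exI[of _ 0]) (simp add: lspan_term)
    next
      case False
      with monom show ?thesis by (intro exI[of _ 0] exI[of _ "rconst c * chi u"]) (simp add: lspan_term)
    qed
  next
    case (add f f')
    then obtain g h g' h' where "g \<in> lspan S" "h \<in> lspan T" "f = g + h"
      "g' \<in> lspan S" "h' \<in> lspan T" "f' = g' + h'" by blast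
    then show ?case
      by (intro exI[of _ "g + g'"] exI[of _ "h + h'"]) (auto intro: lspan_add)
  qed
  with that show ?thesis by blast
qed

text \<open>The product with a high power of both variables is a polynomial, and its coefficients
  are the \<open>c u\<close>.\<close>

lemma chi_independent:
  assumes "finite S" "(\<Sum>u\<in>S. rconst (c u) * chi u) = 0" "u \<in> S"
  shows "c u = 0"
proof -
  define N where "N = (\<Sum>u\<in>S. \<bar>fst u\<bar> + \<bar>snd u\<bar>)"
  have N: "\<bar>fst v\<bar> \<le> N" "\<bar>snd v\<bar> \<le> N" if "v \<in> S" for v
    using member_le_sum[OF that, of "\<lambda>u. \<bar>fst u\<bar> + \<bar>snd u\<bar>"] assms(1) unfolding N_def by auto
  let ?e = "\<lambda>v. (fst v + N, snd v + N)"
  define p where "p = (\<Sum>v\<in>S. monom (monom (c v) (nat (fst v + N))) (nat (snd v + N)))"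
  have "to_fract p = (\<Sum>v\<in>S. rconst (c v) * chi (?e v))"
    unfolding p_def to_fract_sum
    by (rule sum.cong) (use N in \<open>force simp: chi_of_nat\<close>)+
  also have "\<dots> = (\<Sum>v\<in>S. rconst (c v) * chi v) * chi (N, N)"
    unfolding sum_distrib_right by (rule sum.cong) (use chi_pair[of _ "(N,N)"] in auto)
  finally have "p = 0" using assms(2) by simp
  then have "coeff (coeff p (nat (snd u + N))) (nat (fst u + N)) = 0" by simp
  moreover have "coeff (coeff p (nat (snd u + N))) (nat (fst u + N)) = (\<Sum>v\<in>S. if v = u then c v else 0)"
    unfolding p_def coeff_sum
  proof (rule sum.cong)
    fix v assume v: "v \<in> S"
    have "nat (snd v + N) = nat (snd u + N) \<longleftrightarrow> snd v = snd u"
      "nat (fst v + N) = nat (fst u + N) \<longleftrightarrow> fst v = fst u"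
      using N[OF v] N[OF assms(3)] by linarith+
    then show "coeff (coeff (monom (monom (c v) (nat (fst v + N))) (nat (snd v + N))) (nat (snd u + N)))
        (nat (fst u + N)) = (if v = u then c v else 0)"
      by (auto simp: prod_eq_iff)
  qed simp
  ultimately show ?thesis using assms(1,3) by simp
qed

text \<open>Stands in for the extraction of coefficients: an element whose support is confined in
  two incompatible ways is zero.\<close>

lemma lspan_disjoint:
  assumes "f \<in> lspan S" "f \<in> lspan T" "S \<inter> T = {}"
  shows "f = 0"
proof -
  obtain A a B b where *: "finite A" "A \<subseteq> S" "f = (\<Sum>u\<in>A. rconst (a u) * chi u)"
    "finite B" "B \<subseteq> T" "f = (\<Sum>u\<in>B. rconst (b u) * chi u)"
    using assms(1,2) unfolding lspan_def by blast
  have disj: "A \<inter> B = {}" using *(2,5) assms(3) by blast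
  let ?c = "\<lambda>u. if u \<in> A then a u else - b u"
  have "(\<Sum>u\<in>A \<union> B. rconst (?c u) * chi u)
      = (\<Sum>u\<in>A. rconst (?c u) * chi u) + (\<Sum>u\<in>B. rconst (?c u) * chi u)"
    by (rule sum.union_disjoint) (use * disj in auto)
  also have "(\<Sum>u\<in>B. rconst (?c u) * chi u) = (\<Sum>u\<in>B. - (rconst (b u) * chi u))"
    by (rule sum.cong) (use disj in \<open>auto simp: rconst_uminus\<close>)
  also have "(\<Sum>u\<in>A. rconst (?c u) * chi u) = f" unfolding *(3) by (rule sum.cong) auto
  finally have "(\<Sum>u\<in>A \<union> B. rconst (?c u) * chi u) = 0" using *(6) by (simp add: sum_negf)
  then have "?c u = 0" if "u \<in> A \<union> B" for u
    using chi_independent[of "A \<union> B" ?c u] *(1,4) that by blast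
  then have "a u = 0" if "u \<in> A" for u using that by (metis UnI1)
  then show ?thesis unfolding *(3) by simp
qed

lemma chi_mem_lspan_iff: "chi u \<in> lspan T \<longleftrightarrow> u \<in> T"
proof
  assume "chi u \<in> lspan T"
  then show "u \<in> T" using lspan_disjoint[of "chi u" "{u}" T] lspan_chi[of u "{u}"] by auto
qed (rule lspan_chi)

section \<open>Derivations of the field of rational functions\<close>

lemma derivation_rconst: "derivation D \<Longrightarrow> D (rconst c) = 0"
  and derivation_plus: "derivation D \<Longrightarrow> D (f + g) = D f + D g"
  and derivation_times: "derivation D \<Longrightarrow> D (f * g) = f * D g + g * D f"
  by (simp_all add: derivation_def)

lemma derivation_0: "derivation D \<Longrightarrow> D 0 = 0"
  using derivation_rconst[of D 0] by simp

lemma derivation_1: "derivation D \<Longrightarrow> D 1 = 0"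
  using derivation_rconst[of D 1] by simp

lemma derivation_rconst_mult: "derivation D \<Longrightarrow> D (rconst c * f) = rconst c * D f"
  by (simp add: derivation_times derivation_rconst)

lemma derivation_inverse:
  assumes "derivation D" "s \<noteq> 0"
  shows "D (inverse s) = - D s * inverse s * inverse s"
proof -
  have "0 = D (s * inverse s)" using assms by (simp add: derivation_1)
  also have "\<dots> = s * D (inverse s) + inverse s * D s" by (rule derivation_times[OF assms(1)])
  finally have "s * D (inverse s) = - (inverse s * D s)" by (simp add: eq_neg_iff_add_eq_0)
  then have "inverse s * (s * D (inverse s)) = - (inverse s * inverse s * D s)" by simp
  then show ?thesis using assms(2) by (simp add: field_simps)
qed

lemma derivation_divide:
  assumes "derivation D" "s \<noteq> 0"
  shows "D (a / s) = (D a - (a / s) * D s) / s"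
  unfolding divide_inverse derivation_times[OF assms(1)] derivation_inverse[OF assms]
  by (simp add: algebra_simps)

lemma derivation_zero_fun [simp]: "derivation 0"
  by (simp add: derivation_def)

lemma derivation_add: "derivation D \<Longrightarrow> derivation E \<Longrightarrow> derivation (D + E)"
  by (simp add: derivation_def algebra_simps)

lemma derivation_diff: "derivation D \<Longrightarrow> derivation E \<Longrightarrow> derivation (D - E)"
  by (simp add: derivation_def algebra_simps)

definition fmul :: "ratfun \<Rightarrow> (ratfun \<Rightarrow> ratfun) \<Rightarrow> ratfun \<Rightarrow> ratfun" where
  "fmul f D = (\<lambda>g. f * D g)"

lemma fmul_apply [simp]: "fmul f D g = f * D g"
  by (simp add: fmul_def)

lemma derivation_fmul: "derivation D \<Longrightarrow> derivation (fmul f D)"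
  by (simp add: derivation_def algebra_simps)

text \<open>The quotient rule is the only possible extension; the work lies in its independence of
  the chosen fraction.\<close>

lemma fract_derivation_exists:
  fixes d :: "'a::idom \<Rightarrow> 'a"
  assumes add: "\<And>p q. d (p + q) = d p + d q" and mult: "\<And>p q. d (p * q) = p * d q + q * d p"
  obtains D :: "'a fract \<Rightarrow> 'a fract" where "\<And>p. D (to_fract p) = to_fract (d p)"
    "\<And>f g. D (f + g) = D f + D g" "\<And>f g. D (f * g) = f * D g + g * D f"
proof -
  define R where "R f y \<longleftrightarrow> (\<exists>a b. b \<noteq> 0 \<and> f = Fract a b \<and> y = Fract (b * d a - a * d b) (b * b))"
    for f y :: "'a fract"
  define D where "D f = (THE y. R f y)" for f
  \<comment> \<open>Cross-multiplied equality of the two quotients, obtained by differentiating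
    \<open>a * b' = a' * b\<close>.\<close>
  have wd: "(b * d a - a * d b) * (b' * b') = (b' * d a' - a' * d b') * (b * b)"
    if "a * b' = a' * b" for a b a' b'
  proof -
    have e: "a * d b' + b' * d a = a' * d b + b * d a'"
      using arg_cong[OF that, of d] by (simp add: mult)
    have "(b * d a - a * d b) * (b' * b') = b' * (b * (b' * d a) - (a * b') * d b)"
      by (simp add: algebra_simps)
    also have "\<dots> = b' * b * (b' * d a - a' * d b)" unfolding that by (simp add: algebra_simps)
    also have "b' * d a - a' * d b = b * d a' - a * d b'" using e by (simp add: algebra_simps)
    also have "b' * b * (b * d a' - a * d b') = b * (b * (b' * d a') - (a * b') * d b')"
      by (simp add: algebra_simps)
    also have "\<dots> = (b' * d a' - a' * d b') * (b * b)" unfolding that by (simp add: algebra_simps)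
    finally show ?thesis .
  qed
  have D: "D (Fract a b) = Fract (b * d a - a * d b) (b * b)" if "b \<noteq> 0" for a b
    unfolding D_def
  proof (rule the_equality)
    show "R (Fract a b) (Fract (b * d a - a * d b) (b * b))" using that unfolding R_def by blast
  next
    fix y assume "R (Fract a b) y"
    then obtain a' b' where *: "b' \<noteq> 0" "Fract a b = Fract a' b'"
      "y = Fract (b' * d a' - a' * d b') (b' * b')" unfolding R_def by blast
    then have "a' * b = a * b'" using that by (simp add: eq_fract)
    then show "y = Fract (b * d a - a * d b) (b * b)"
      using wd[of a' b a b'] * that by (simp add: eq_fract)
  qed
  show ?thesis
  proof
    fix p
    have "d 1 = d 1 + d 1" using mult[of 1 1] by simp
    then have "d 1 = 0" by (metis add_cancel_right_left)
    then show "D (to_fract p) = to_fract (d p)" using D[of 1 p] by (simp add: to_fract_def)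
  next
    fix f g :: "'a fract"
    obtain a b where f: "f = Fract a b" "b \<noteq> 0" by (cases f) auto
    obtain a' b' where g: "g = Fract a' b'" "b' \<noteq> 0" by (cases g) auto
    have "D (f + g) = Fract (b * b' * d (a * b' + a' * b) - (a * b' + a' * b) * d (b * b'))
        (b * b' * (b * b'))"
      unfolding f(1) g(1) using f(2) g(2) by (simp add: D)
    also have "\<dots> = D f + D g"
      unfolding f(1) g(1) using f(2) g(2) by (simp add: D eq_fract add mult algebra_simps)
    finally show "D (f + g) = D f + D g" .
    have "D (f * g) = Fract (b * b' * d (a * a') - (a * a') * d (b * b')) (b * b' * (b * b'))"
      unfolding f(1) g(1) using f(2) g(2) by (simp add: D)
    also have "\<dots> = f * D g + g * D f"
      unfolding f(1) g(1) using f(2) g(2) by (simp add: D eq_fract add mult algebra_simps)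
    finally show "D (f * g) = f * D g + g * D f" .
  qed
qed

text \<open>Acting on coefficients extends a derivation in the inner variable to both variables, the
  outer one being treated as a constant.\<close>

lemma map_poly_derivation:
  fixes d :: "'a::comm_ring_1 \<Rightarrow> 'a"
  assumes add: "\<And>p q. d (p + q) = d p + d q" and mult: "\<And>p q. d (p * q) = p * d q + q * d p"
  shows "map_poly d (p + q) = map_poly d p + map_poly d q"
    "map_poly d (p * q) = p * map_poly d q + q * map_poly d p"
proof -
  have 0: "d 0 = 0" using add[of 0 0] by simp
  have sum: "d (sum f A) = (\<Sum>x\<in>A. d (f x))" for f :: "nat \<Rightarrow> 'a" and A
    by (induction A rule: infinite_finite_induct) (auto simp: 0 add)
  show "map_poly d (p + q) = map_poly d p + map_poly d q"
    by (rule poly_eqI) (simp add: coeff_map_poly 0 add)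
  show "map_poly d (p * q) = p * map_poly d q + q * map_poly d p"
  proof (rule poly_eqI)
    fix n
    have "coeff (map_poly d p * q) n = (\<Sum>i\<le>n. coeff q (n - i) * d (coeff p i))"
      by (simp add: coeff_mult coeff_map_poly 0) (simp add: mult.commute)
    then have "coeff (q * map_poly d p) n = (\<Sum>i\<le>n. coeff q (n - i) * d (coeff p i))"
      by (metis mult.commute)
    then show "coeff (map_poly d (p * q)) n = coeff (p * map_poly d q + q * map_poly d p) n"
      by (simp add: coeff_map_poly 0 coeff_mult sum mult sum.distrib)
  qed
qed

text \<open>The difference vanishes on both variables, hence on inner polynomials, on polynomials
  over these and, by the quotient rule, on fractions.\<close>

lemma derivation_eqI:
  assumes D: "derivation D" and E: "derivation E"
    and "D (chi (1, 0)) = E (chi (1, 0))" "D (chi (0, 1)) = E (chi (0, 1))"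
  shows "D = E"
proof -
  define G where "G = D - E"
  have G: "derivation G" using D E unfolding G_def by (rule derivation_diff)
  have "G (chi (1, 0)) = 0" "G (chi (0, 1)) = 0" using assms(3,4) by (simp_all add: G_def)
  then have x: "G (to_fract [:[:0, 1:]:]) = 0" and y: "G (to_fract [:0, 1:]) = 0"
    by (simp_all add: chi_def)
  have inner: "G (to_fract [:q:]) = 0" for q
  proof (induction q)
    case 0 then show ?case using derivation_0[OF G] by simp
  next
    case (pCons c q)
    have "to_fract [:pCons c q:] = rconst c + to_fract [:[:0, 1:]:] * to_fract [:q:]"
      unfolding rconst_def by (simp flip: to_fract_add to_fract_mult)
    then show ?case using pCons x by (simp add: derivation_plus[OF G] derivation_times[OF G] derivation_rconst[OF G])
  qed
  have outer: "G (to_fract p) = 0" for p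
  proof (induction p)
    case 0 then show ?case using derivation_0[OF G] by simp
  next
    case (pCons c q)
    have "to_fract (pCons c q) = to_fract [:c:] + to_fract [:0, 1:] * to_fract q"
      by (simp flip: to_fract_add to_fract_mult)
    then show ?case using pCons y by (simp add: derivation_plus[OF G] derivation_times[OF G] inner)
  qed
  have "G f = 0" for f
  proof -
    obtain a b where "f = to_fract a / to_fract b" "b \<noteq> 0"
      by (cases f) (auto simp: Fract_conv_to_fract)
    then show ?thesis using derivation_divide[OF G, of "to_fract b" "to_fract a"] by (simp add: outer)
  qed
  then show ?thesis unfolding G_def by (intro ext) (metis eq_iff_diff_eq_0 minus_apply)
qed

text \<open>These are x d/dx and y d/dy; the factors x and y make every character an
  eigenvector.\<close>

lemma euler_derivations_exist:
  obtains D E where "derivation D" "derivation E"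
    "D (chi (1, 0)) = chi (1, 0)" "D (chi (0, 1)) = 0"
    "E (chi (1, 0)) = 0" "E (chi (0, 1)) = chi (0, 1)"
proof -
  let ?x = "\<lambda>q :: complex poly. [:0, 1:] * pderiv q" and ?y = "\<lambda>p :: complex poly poly. [:0, 1:] * pderiv p"
  have x: "?x (p + q) = ?x p + ?x q" "?x (p * q) = p * ?x q + q * ?x p" for p q
    by (simp_all add: pderiv_add pderiv_mult algebra_simps)
  have y: "?y (p + q) = ?y p + ?y q" "?y (p * q) = p * ?y q + q * ?y p" for p q
    by (simp_all add: pderiv_add pderiv_mult algebra_simps)
  obtain D where D: "\<And>p. D (to_fract p) = to_fract (map_poly ?x p)"
    "\<And>f g. D (f + g) = D f + D g" "\<And>f g. D (f * g) = f * D g + g * D f"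
    using fract_derivation_exists[of "map_poly ?x"] map_poly_derivation[of ?x, OF x] by metis
  obtain E where E: "\<And>p. E (to_fract p) = to_fract (?y p)"
    "\<And>f g. E (f + g) = E f + E g" "\<And>f g. E (f * g) = f * E g + g * E f"
    using fract_derivation_exists[of ?y, OF y] by metis
  have mp: "map_poly ?x [:q:] = [:?x q:]" for q by (simp add: map_poly_pCons)
  have mp2: "map_poly ?x [:0, 1:] = 0" by (simp add: map_poly_pCons)
  show ?thesis
  proof
    have "D (rconst c) = 0" "E (rconst c) = 0" for c
      unfolding rconst_def D(1) E(1) mp by (simp_all add: pderiv_pCons)
    then show "derivation D" "derivation E"
      unfolding derivation_def using D(2,3) E(2,3) by blast+
    have "D (to_fract [:[:0, 1:]:]) = to_fract [:[:0, 1:]:]" "D (to_fract [:0, 1:]) = 0"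
      "E (to_fract [:[:0, 1:]:]) = 0" "E (to_fract [:0, 1:]) = to_fract [:0, 1:]"
      unfolding D(1) E(1) mp mp2 by (simp_all add: pderiv_pCons)
    then show "D (chi (1, 0)) = chi (1, 0)" "D (chi (0, 1)) = 0"
      "E (chi (1, 0)) = 0" "E (chi (0, 1)) = chi (0, 1)"
      by (simp_all add: chi_def)
  qed
qed

section \<open>Homogeneous vector fields as points of the complexified lattice N\<close>

definition npair :: "complex \<times> complex \<Rightarrow> latt \<Rightarrow> complex" where
  "npair n v = fst n * of_int (fst v) + snd n * of_int (snd v)"

lemma npair_simps [simp]:
  "npair (m + n) v = npair m v + npair n v" "npair (m - n) v = npair m v - npair n v"
  "npair n (u + v) = npair n u + npair n v" "npair n (- v) = - npair n v" "npair 0 v = 0" "npair n 0 = 0"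
  by (simp_all add: npair_def algebra_simps)

text \<open>The invariant vector field given by n, times the character of exponent u.\<close>

definition hder :: "latt \<Rightarrow> complex \<times> complex \<Rightarrow> ratfun \<Rightarrow> ratfun" where
  "hder u n = (THE D. derivation D \<and> (\<forall>v. D (chi v) = rconst (npair n v) * chi (u + v)))"

lemma derivation_power_int_const:
  assumes D: "derivation D" and "f \<noteq> 0" "D f = g * f"
  shows "D (f powi k) = of_int k * g * f powi k"
proof -
  have n: "D (f ^ m) = of_nat m * g * f ^ m" for m
    by (induction m) (simp_all add: derivation_1[OF D] derivation_times[OF D] assms(3) algebra_simps)
  show ?thesis
  proof (cases "k \<ge> 0")
    case True
    then show ?thesis using n[of "nat k"] by (simp add: power_int_def)
  next
    case False
    have "D (inverse (f ^ m)) = - of_nat m * g * inverse (f ^ m)" for m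
      using derivation_inverse[OF D, of "f ^ m"] assms(2) by (simp add: n field_simps)
    from this[of "nat (- k)"] False show ?thesis
      by (simp add: power_int_def power_inverse)
  qed
qed

lemma derivation_chi:
  assumes D: "derivation D" and "D (chi (1, 0)) = g * chi (1, 0)" "D (chi (0, 1)) = h * chi (0, 1)"
  shows "D (chi v) = (of_int (fst v) * g + of_int (snd v) * h) * chi v"
proof -
  have "chi v = chi (1, 0) powi fst v * chi (0, 1) powi snd v" by (simp add: chi_def)
  then show ?thesis
    using derivation_power_int_const[OF D _ assms(2)] derivation_power_int_const[OF D _ assms(3)]
    by (simp add: derivation_times[OF D] algebra_simps)
qed

lemma rconst_of_int: "rconst (of_int k) = of_int k"
proof -
  have "rconst (of_nat m) = of_nat m" for m by (induction m) (simp_all add: rconst_add)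
  then show ?thesis by (cases k) (auto simp: rconst_uminus rconst_diff rconst_add simp del: of_nat_Suc)
qed

lemma hder:
  shows derivation_hder: "derivation (hder u n)"
    and hder_chi: "hder u n (chi v) = rconst (npair n v) * chi (u + v)"
proof -
  obtain D E where DE: "derivation D" "derivation E"
    "D (chi (1, 0)) = chi (1, 0)" "D (chi (0, 1)) = 0"
    "E (chi (1, 0)) = 0" "E (chi (0, 1)) = chi (0, 1)"
    using euler_derivations_exist .
  have Dv: "D (chi v) = of_int (fst v) * chi v" for v
    using derivation_chi[OF DE(1), of 1 0 v] DE by simp
  have Ev: "E (chi v) = of_int (snd v) * chi v" for v
    using derivation_chi[OF DE(2), of 0 1 v] DE by simp
  let ?H = "fmul (chi u) (fmul (rconst (fst n)) D + fmul (rconst (snd n)) E)"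
  have H: "derivation ?H" by (intro derivation_fmul derivation_add DE)
  have Hv: "?H (chi v) = rconst (npair n v) * chi (u + v)" for v
    by (simp add: Dv Ev npair_def rconst_add rconst_mult rconst_of_int chi_add algebra_simps)
  have "derivation (hder u n) \<and> (\<forall>v. hder u n (chi v) = rconst (npair n v) * chi (u + v))"
    unfolding hder_def
  proof (rule theI[where a = ?H])
    show "derivation ?H \<and> (\<forall>v. ?H (chi v) = rconst (npair n v) * chi (u + v))" using H Hv by blast
  next
    fix F assume F: "derivation F \<and> (\<forall>v. F (chi v) = rconst (npair n v) * chi (u + v))"
    show "F = ?H" by (rule derivation_eqI) (use F H Hv in auto)
  qed
  then show "derivation (hder u n)" "hder u n (chi v) = rconst (npair n v) * chi (u + v)" by blast+
qed

lemma hder_add: "hder u (m + n) = hder u m + hder u n"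
  by (rule derivation_eqI)
    (auto intro!: derivation_add derivation_hder simp: hder_chi rconst_add distrib_right)

lemma hder_diff: "hder u (m - n) = hder u m - hder u n"
  by (rule derivation_eqI)
    (auto intro!: derivation_diff derivation_hder simp: hder_chi rconst_diff left_diff_distrib)

lemma hder_0: "hder u 0 = 0"
  by (rule derivation_eqI) (auto simp: derivation_hder hder_chi)

lemma homogeneous_hder: "homogeneous_derivation u (hder u n)"
  unfolding homogeneous_derivation_def
  using derivation_hder hder_chi by (auto simp: plus_prod_def)

text \<open>This turns homogeneous cochains into vectors: the constants at the two coordinate
  characters are the coordinates of \<open>n\<close>.\<close>

lemma homogeneous_imp_hder:
  assumes "homogeneous_derivation u D"
  obtains n where "D = hder u n"
proof -
  have D: "derivation D" using assms by (simp add: homogeneous_derivation_def)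
  obtain c where c: "\<And>v. D (chi v) = rconst (c v) * chi (u + v)"
    using assms unfolding homogeneous_derivation_def plus_prod_def by metis
  have "D = hder u (c (1, 0), c (0, 1))"
    by (rule derivation_eqI) (auto simp: D derivation_hder c hder_chi npair_def)
  then show ?thesis using that by blast
qed

text \<open>The invariant fields form a basis over the function field, so an arbitrary field is
  handled through two coefficients.\<close>

lemma derivation_decompose:
  assumes D: "derivation D"
  shows "D = fmul (D (chi (1, 0)) / chi (1, 0)) (hder 0 (1, 0)) + fmul (D (chi (0, 1)) / chi (0, 1)) (hder 0 (0, 1))"
  by (rule derivation_eqI[OF D])
    (auto intro!: derivation_add derivation_fmul derivation_hder simp: hder_chi npair_def)

lemma fmul_chi_hder: "fmul (rconst c * chi u) (hder v n) = hder (u + v) (c * fst n, c * snd n)"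
  by (rule derivation_eqI)
    (auto intro!: derivation_fmul derivation_hder simp: hder_chi npair_def chi_add rconst_mult rconst_add algebra_simps)

section \<open>Local rings in a field\<close>

text \<open>Versions for plain sets, so that all arithmetic stays that of the field;
  \<open>Spec_iff\<close> ties them to the spectrum.\<close>

definition is_subring :: "'a::field set \<Rightarrow> bool" where
  "is_subring A \<longleftrightarrow> 0 \<in> A \<and> 1 \<in> A \<and> (\<forall>a\<in>A. \<forall>b\<in>A. a - b \<in> A) \<and> (\<forall>a\<in>A. \<forall>b\<in>A. a * b \<in> A)"

definition is_ideal :: "'a::field set \<Rightarrow> 'a set \<Rightarrow> bool" where
  "is_ideal A P \<longleftrightarrow> P \<subseteq> A \<and> 0 \<in> P \<and> (\<forall>a\<in>P. \<forall>b\<in>P. a + b \<in> P) \<and> (\<forall>a\<in>A. \<forall>b\<in>P. a * b \<in> P)"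

definition is_prime :: "'a::field set \<Rightarrow> 'a set \<Rightarrow> bool" where
  "is_prime A P \<longleftrightarrow> is_ideal A P \<and> 1 \<notin> P \<and> (\<forall>a\<in>A. \<forall>b\<in>A. a * b \<in> P \<longrightarrow> a \<in> P \<or> b \<in> P)"

lemma is_subring_0: "is_subring A \<Longrightarrow> 0 \<in> A"
  and is_subring_1: "is_subring A \<Longrightarrow> 1 \<in> A"
  and is_subring_diff: "is_subring A \<Longrightarrow> a \<in> A \<Longrightarrow> b \<in> A \<Longrightarrow> a - b \<in> A"
  and is_subring_mult: "is_subring A \<Longrightarrow> a \<in> A \<Longrightarrow> b \<in> A \<Longrightarrow> a * b \<in> A"
  by (auto simp: is_subring_def)

lemma is_subring_uminus: "is_subring A \<Longrightarrow> a \<in> A \<Longrightarrow> - a \<in> A"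
  using is_subring_diff[of A 0 a] is_subring_0 by auto

lemma is_subring_add: "is_subring A \<Longrightarrow> a \<in> A \<Longrightarrow> b \<in> A \<Longrightarrow> a + b \<in> A"
  using is_subring_diff[of A a "- b"] is_subring_uminus by auto

lemma is_subring_power: "is_subring A \<Longrightarrow> a \<in> A \<Longrightarrow> a ^ n \<in> A"
  by (induction n) (auto simp: is_subring_1 is_subring_mult)

lemma is_subring_sum: "is_subring A \<Longrightarrow> (\<And>x. x \<in> I \<Longrightarrow> f x \<in> A) \<Longrightarrow> sum f I \<in> A"
  by (induction I rule: infinite_finite_induct) (auto simp: is_subring_0 is_subring_add)

lemma is_ideal_sum: "is_ideal A P \<Longrightarrow> (\<And>x. x \<in> I \<Longrightarrow> f x \<in> P) \<Longrightarrow> sum f I \<in> P"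
  by (induction I rule: infinite_finite_induct) (auto simp: is_ideal_def)

lemma is_prime_power: "is_prime A P \<Longrightarrow> is_subring A \<Longrightarrow> a \<in> A \<Longrightarrow> a ^ n \<in> P \<Longrightarrow> a \<in> P"
proof (induction n)
  case (Suc n)
  then have "a \<in> P \<or> a ^ n \<in> P" unfolding is_prime_def using is_subring_power[of A a n] by auto
  with Suc show ?case by blast
qed (simp add: is_prime_def)

lemma ring_subring_of:
  assumes "is_subring A"
  shows "cring (subring_of A)"
proof (rule cringI)
  show "abelian_group (subring_of A)"
  proof (rule abelian_groupI)
    fix x assume "x \<in> carrier (subring_of A)"
    then show "\<exists>y\<in>carrier (subring_of A). y \<oplus>\<^bsub>subring_of A\<^esub> x = \<zero>\<^bsub>subring_of A\<^esub>"
      using assms by (intro bexI[of _ "- x"]) (auto simp: subring_of_def is_subring_uminus)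
  qed (use assms in \<open>auto simp: subring_of_def is_subring_add is_subring_0\<close>)
  show "comm_monoid (subring_of A)"
    by (rule comm_monoidI) (use assms in \<open>auto simp: subring_of_def is_subring_mult is_subring_1\<close>)
qed (auto simp: subring_of_def distrib_right)

lemma Spec_iff:
  assumes A: "is_subring A"
  shows "P \<in> Spec A \<longleftrightarrow> is_prime A P"
proof
  assume "P \<in> Spec A"
  then interpret primeideal P "subring_of A" by (simp add: Spec_def)
  have "P \<subseteq> A" using a_subset by (simp add: subring_of_def)
  moreover have "0 \<in> P" using additive_subgroup.zero_closed[OF additive_subgroup_axioms] by (simp add: subring_of_def)
  moreover have "a + b \<in> P" if "a \<in> P" "b \<in> P" for a b
    using additive_subgroup.a_closed[OF additive_subgroup_axioms that] by (simp add: subring_of_def)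
  moreover have "a * b \<in> P" if "a \<in> A" "b \<in> P" for a b
    using I_l_closed[of b a] that by (simp add: subring_of_def)
  moreover have "1 \<notin> P"
  proof
    assume "1 \<in> P"
    then have "\<one>\<^bsub>subring_of A\<^esub> \<in> P" by (simp add: subring_of_def)
    then show False using one_imp_carrier I_notcarr by blast
  qed
  moreover have "a \<in> P \<or> b \<in> P" if "a \<in> A" "b \<in> A" "a * b \<in> P" for a b
    using I_prime[of a b] that by (simp add: subring_of_def)
  ultimately show "is_prime A P" unfolding is_prime_def is_ideal_def by simp
next
  assume P: "is_prime A P"
  interpret R: cring "subring_of A" by (rule ring_subring_of[OF A])
  have neg: "- a \<in> P" if "a \<in> P" for a
  proof -
    have "- 1 \<in> A" using A is_subring_uminus is_subring_1 by blast
    then have "- 1 * a \<in> P" using P that unfolding is_prime_def is_ideal_def by blast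
    then show ?thesis by simp
  qed
  have inv: "\<ominus>\<^bsub>subring_of A\<^esub> a = - a" if "a \<in> A" for a
    by (rule R.minus_equality) (use that A in \<open>auto simp: subring_of_def is_subring_uminus\<close>)
  have "ideal P (subring_of A)"
  proof (rule idealI)
    show "subgroup P (add_monoid (subring_of A))"
    proof (rule group.subgroupI)
      show "group (add_monoid (subring_of A))" by (rule R.add.is_group)
      show "P \<subseteq> carrier (add_monoid (subring_of A))" "P \<noteq> {}"
        using P by (auto simp: subring_of_def is_prime_def is_ideal_def)
    next
      fix a assume a: "a \<in> P"
      then have "a \<in> A" using P by (auto simp: is_prime_def is_ideal_def)
      then have "inv\<^bsub>add_monoid (subring_of A)\<^esub> a = - a" using inv by (simp add: a_inv_def)
      then show "inv\<^bsub>add_monoid (subring_of A)\<^esub> a \<in> P" using neg[OF a] by simp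
    next
      fix a b assume "a \<in> P" "b \<in> P"
      then show "a \<otimes>\<^bsub>add_monoid (subring_of A)\<^esub> b \<in> P"
        using P by (auto simp: subring_of_def is_prime_def is_ideal_def)
    qed
  next
    fix a x assume a: "a \<in> P" and "x \<in> carrier (subring_of A)"
    then have "x * a \<in> P" using P by (simp add: is_prime_def is_ideal_def subring_of_def)
    then show "x \<otimes>\<^bsub>subring_of A\<^esub> a \<in> P" "a \<otimes>\<^bsub>subring_of A\<^esub> x \<in> P"
      by (simp_all add: subring_of_def mult.commute)
  qed (rule R.ring_axioms)
  then show "P \<in> Spec A" unfolding Spec_def mem_Collect_eq
  proof (rule primeidealI[OF _ R.is_cring])
    show "carrier (subring_of A) \<noteq> P"
      using P is_subring_1[OF A] by (auto simp: subring_of_def is_prime_def)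
  qed (use P in \<open>auto simp: subring_of_def is_prime_def\<close>)
qed

text \<open>An ideal that is maximal among those containing \<open>I\<close> and no power of
  \<open>f\<close> is prime; it exists by Zorn's lemma.\<close>

lemma prime_avoiding_powers:
  fixes A :: "'a::field set"
  assumes A: "is_subring A" and I: "is_ideal A I" and f: "f \<in> A" "\<And>n. f ^ n \<notin> I"
  obtains P where "is_prime A P" "I \<subseteq> P" "f \<notin> P"
proof -
  define S where "S = {J. is_ideal A J \<and> I \<subseteq> J \<and> (\<forall>n. f ^ n \<notin> J)}"
  have "\<exists>M\<in>S. \<forall>X\<in>S. M \<subseteq> X \<longrightarrow> X = M"
  proof (rule subset_Zorn_nonempty)
    show "S \<noteq> {}" using I f unfolding S_def by auto
  next
    fix C assume C: "C \<noteq> {}" "subset.chain S C"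
    then have CS: "C \<subseteq> S" and lin: "\<And>J K. J \<in> C \<Longrightarrow> K \<in> C \<Longrightarrow> J \<subseteq> K \<or> K \<subseteq> J"
      by (auto simp: subset_chain_def)
    have id: "\<And>J. J \<in> C \<Longrightarrow> is_ideal A J" using CS by (auto simp: S_def)
    have "is_ideal A (\<Union>C)"
      unfolding is_ideal_def
    proof (intro conjI ballI)
      show "\<Union>C \<subseteq> A" "0 \<in> \<Union>C" using C(1) id unfolding is_ideal_def by blast+
    next
      fix a b assume "a \<in> \<Union>C" "b \<in> \<Union>C"
      then obtain J K where JK: "a \<in> J" "J \<in> C" "b \<in> K" "K \<in> C" by blast
      then have "a + b \<in> J \<or> a + b \<in> K" using lin[OF JK(2,4)] id unfolding is_ideal_def by blast
      then show "a + b \<in> \<Union>C" using JK by blast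
    next
      fix a b assume "a \<in> A" "b \<in> \<Union>C"
      then show "a * b \<in> \<Union>C" using id unfolding is_ideal_def by blast
    qed
    then show "\<Union>C \<in> S" using C(1) CS unfolding S_def by blast
  qed
  then obtain M where M: "M \<in> S" "\<And>X. X \<in> S \<Longrightarrow> M \<subseteq> X \<Longrightarrow> X = M" by blast
  have Mid: "is_ideal A M" "I \<subseteq> M" "\<And>n. f ^ n \<notin> M" using M(1) unfolding S_def by auto
  \<comment> \<open>By maximality, adjoining \<open>a\<close> to \<open>M\<close> must reach a power
    of \<open>f\<close>. Multiplying two such relations will put a power of \<open>f\<close> into
    \<open>M\<close>.\<close>
  have step: "\<exists>n x m. x \<in> A \<and> m \<in> M \<and> f ^ n = m + x * a" if a: "a \<in> A" "a \<notin> M" for a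
  proof (rule ccontr)
    assume no: "\<nexists>n x m. x \<in> A \<and> m \<in> M \<and> f ^ n = m + x * a"
    define X where "X = {m + x * a | m x. m \<in> M \<and> x \<in> A}"
    have "is_ideal A X"
      unfolding is_ideal_def
    proof (intro conjI ballI)
      show "X \<subseteq> A" using Mid(1) a(1) A unfolding X_def is_ideal_def
        by (auto intro!: is_subring_add is_subring_mult)
      show "0 \<in> X" using Mid(1) A unfolding X_def is_ideal_def
        by (auto intro!: exI[of _ 0] simp: is_subring_0)
    next
      fix u v assume "u \<in> X" "v \<in> X"
      then obtain m x m' x' where "u = m + x * a" "v = m' + x' * a" "m \<in> M" "m' \<in> M" "x \<in> A" "x' \<in> A"
        unfolding X_def by blast
      then have "u + v = (m + m') + (x + x') * a" "m + m' \<in> M" "x + x' \<in> A"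
        using Mid(1) A by (simp_all add: is_subring_add algebra_simps is_ideal_def)
      then show "u + v \<in> X" unfolding X_def by blast
    next
      fix u v assume "u \<in> A" "v \<in> X"
      then obtain m x where "v = m + x * a" "m \<in> M" "x \<in> A"
        unfolding X_def by blast
      then have "u * v = u * m + (u * x) * a" "u * m \<in> M" "u * x \<in> A"
        using Mid(1) A \<open>u \<in> A\<close> by (simp_all add: is_subring_mult distrib_left mult.assoc is_ideal_def)
      then show "u * v \<in> X" unfolding X_def by blast
    qed
    moreover have MX: "M \<subseteq> X" using A unfolding X_def by (force simp: is_subring_0)
    ultimately have "X \<in> S" using Mid(2) no unfolding S_def X_def by blast
    then have "X = M" using M(2) MX by blast
    moreover have "0 + 1 * a \<in> X" using Mid(1) is_subring_1[OF A] unfolding X_def is_ideal_def by blast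
    ultimately show False using a(2) by simp
  qed
  have "is_prime A M"
    unfolding is_prime_def
  proof (intro conjI ballI impI)
    show "1 \<notin> M" using Mid(3)[of 0] by simp
  next
    fix a b assume ab: "a \<in> A" "b \<in> A" "a * b \<in> M"
    show "a \<in> M \<or> b \<in> M"
    proof (rule ccontr)
      assume no: "\<not> (a \<in> M \<or> b \<in> M)"
      obtain n x m where 1: "x \<in> A" "m \<in> M" "f ^ n = m + x * a" using step[OF ab(1)] no by blast
      obtain n' x' m' where 2: "x' \<in> A" "m' \<in> M" "f ^ n' = m' + x' * b" using step[OF ab(2)] no by blast
      have "f ^ (n + n') = (m' + x' * b) * m + (x * a) * m' + (x * x') * (a * b)"
        unfolding power_add 1(3) 2(3) by (simp add: algebra_simps)
      moreover have "\<dots> \<in> M"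
      proof -
        have "m' + x' * b \<in> A" "x * a \<in> A" "x * x' \<in> A"
          using 1 2 ab A Mid(1) by (auto intro!: is_subring_add is_subring_mult simp: is_ideal_def)
        then show ?thesis using Mid(1) 1(2) 2(2) ab(3) unfolding is_ideal_def by blast
      qed
      ultimately show False using Mid(3) by metis
    qed
  qed (rule Mid(1))
  moreover have "f \<notin> M" using Mid(3)[of 1] by simp
  ultimately show ?thesis using that Mid(2) by blast
qed

section \<open>Points of an affine chart as local rings\<close>

definition loc_points :: "'a::field set \<Rightarrow> 'a set set" where
  "loc_points A = {localization A P | P. is_prime A P}"

lemma prime_mem_0: "is_prime A P \<Longrightarrow> 0 \<in> P"
  by (simp add: is_prime_def is_ideal_def)

lemma localization_iff:
  assumes "is_prime A P"
  shows "g \<in> localization A P \<longleftrightarrow> (\<exists>s\<in>A - P. s \<noteq> 0 \<and> s * g \<in> A)"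
proof
  assume "g \<in> localization A P"
  then obtain a s where *: "g = a / s" "a \<in> A" "s \<in> A - P" unfolding localization_def by blast
  then have "s \<noteq> 0" using prime_mem_0[OF assms] by auto
  then show "\<exists>s\<in>A - P. s \<noteq> 0 \<and> s * g \<in> A" using * by (intro bexI[of _ s]) auto
next
  assume "\<exists>s\<in>A - P. s \<noteq> 0 \<and> s * g \<in> A"
  then obtain s where *: "s \<in> A - P" "s \<noteq> 0" "s * g \<in> A" by blast
  then have "g = (s * g) / s" by simp
  then show "g \<in> localization A P" using * unfolding localization_def by blast
qed

lemma localization_superset: "is_subring A \<Longrightarrow> is_prime A P \<Longrightarrow> A \<subseteq> localization A P"
  by (auto simp: localization_iff is_subring_1 is_prime_def intro!: bexI[of _ 1])

lemma localization_subring: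
  assumes A: "is_subring A" and P: "is_prime A P"
  shows "is_subring (localization A P)"
proof -
  let ?x = "localization A P"
  have "0 \<in> ?x" "1 \<in> ?x"
    using localization_superset[OF A P] is_subring_0[OF A] is_subring_1[OF A] by auto
  moreover have "g - h \<in> ?x \<and> g * h \<in> ?x" if gh: "g \<in> ?x" "h \<in> ?x" for g h
  proof -
    obtain s t where *: "s \<in> A - P" "s \<noteq> 0" "s * g \<in> A" "t \<in> A - P" "t \<noteq> 0" "t * h \<in> A"
      using gh unfolding localization_iff[OF P] by blast
    have st: "s * t \<in> A - P" "s * t \<noteq> 0"
      using * P A by (auto simp: is_prime_def is_subring_mult)
    have "s * t * (g - h) = t * (s * g) - s * (t * h)" "s * t * (g * h) = (s * g) * (t * h)"
      by (simp_all add: algebra_simps)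
    moreover have "t * (s * g) - s * (t * h) \<in> A" "(s * g) * (t * h) \<in> A"
      using * by (simp_all add: is_subring_diff[OF A] is_subring_mult[OF A])
    ultimately have "s * t * (g - h) \<in> A" "s * t * (g * h) \<in> A" by (simp_all only:)
    then show ?thesis using st unfolding localization_iff[OF P] by blast
  qed
  ultimately show ?thesis unfolding is_subring_def by blast
qed

text \<open>Lets a point, which is only given as a ring, recover its prime: the elements of
  \<open>A\<close> that are not units there.\<close>

lemma localization_unit_iff:
  assumes A: "is_subring A" and P: "is_prime A P" and "a \<in> A"
  shows "a \<notin> P \<longleftrightarrow> a \<noteq> 0 \<and> inverse a \<in> localization A P"
proof
  assume a: "a \<notin> P"
  then have nz: "a \<noteq> 0" using prime_mem_0[OF P] by auto
  then have "a * inverse a \<in> A" using is_subring_1[OF A] by simp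
  then show "a \<noteq> 0 \<and> inverse a \<in> localization A P"
    using a nz assms unfolding localization_iff[OF P] by blast
next
  assume *: "a \<noteq> 0 \<and> inverse a \<in> localization A P"
  then obtain s where s: "s \<in> A - P" "s * inverse a \<in> A" unfolding localization_iff[OF P] by blast
  have "a \<in> P \<Longrightarrow> (s * inverse a) * a \<in> P" using P s unfolding is_prime_def is_ideal_def by blast
  moreover have "(s * inverse a) * a = s" using * by simp
  ultimately show "a \<notin> P" using s by auto
qed

lemma loc_pointsE:
  assumes "x \<in> loc_points A"
  obtains P where "is_prime A P" "x = localization A P"
  using assms unfolding loc_points_def by blast

lemma loc_points_subring: "is_subring A \<Longrightarrow> x \<in> loc_points A \<Longrightarrow> is_subring x"
  by (metis loc_pointsE localization_subring)

lemma loc_points_superset: "is_subring A \<Longrightarrow> x \<in> loc_points A \<Longrightarrow> A \<subseteq> x"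
  by (metis loc_pointsE localization_superset)

text \<open>Once denominators are cleared, a nonunit has its numerator in \<open>Q\<close>, and
  \<open>Q\<close> is closed under addition.\<close>

lemma localization_nonunit_add:
  assumes B: "is_subring B" and Q: "is_prime B Q"
    and y: "y \<in> localization B Q" "y = 0 \<or> inverse y \<notin> localization B Q"
    and z: "z \<in> localization B Q" "z = 0 \<or> inverse z \<notin> localization B Q"
  shows "y + z = 0 \<or> inverse (y + z) \<notin> localization B Q"
proof -
  let ?x = "localization B Q"
  have sub: "is_subring ?x" by (rule localization_subring[OF B Q])
  have mem: "s * y \<in> Q" if s: "s \<in> B - Q" "s \<noteq> 0" "s * y \<in> B" and nu: "y = 0 \<or> inverse y \<notin> ?x" for s y
  proof (rule ccontr)
    assume "s * y \<notin> Q"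
    then have "s * y \<noteq> 0" "inverse (s * y) \<in> ?x" using localization_unit_iff[OF B Q s(3)] by auto
    then have "s * inverse (s * y) \<in> ?x"
      using s localization_superset[OF B Q] by (intro is_subring_mult[OF sub]) auto
    then show False using nu \<open>s * y \<noteq> 0\<close> s by (auto simp: field_simps)
  qed
  obtain s t where *: "s \<in> B - Q" "s \<noteq> 0" "s * y \<in> B" "t \<in> B - Q" "t \<noteq> 0" "t * z \<in> B"
    using y(1) z(1) unfolding localization_iff[OF Q] by blast
  have "s * y \<in> Q" "t * z \<in> Q" using mem[of s y] mem[of t z] * y z by auto
  then have "t * (s * y) + s * (t * z) \<in> Q"
    using * Q unfolding is_prime_def is_ideal_def by blast
  then have st: "(s * t) * (y + z) \<in> Q" by (simp add: algebra_simps)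
  have "s * t \<in> B" "s * t \<notin> Q" using * B Q by (auto simp: is_prime_def is_subring_mult)
  show ?thesis
  proof (rule ccontr)
    assume "\<not> ?thesis"
    then have nz: "y + z \<noteq> 0" "inverse (y + z) \<in> ?x" by auto
    have "inverse (s * t) \<in> ?x" using localization_unit_iff[OF B Q \<open>s * t \<in> B\<close>] \<open>s * t \<notin> Q\<close> by blast
    then have "inverse ((s * t) * (y + z)) \<in> ?x"
      using nz is_subring_mult[OF sub] by (metis inverse_mult_distrib)
    moreover have "(s * t) * (y + z) \<in> B" using st Q unfolding is_prime_def is_ideal_def by blast
    ultimately show False
      using st localization_unit_iff[OF B Q] nz * by (metis mult_eq_0_iff)
  qed
qed

text \<open>The principle behind gluing: \<open>P\<close> is the contraction of the maximal ideal of
  the local ring, and since elements of \<open>B\<close> are fractions over \<open>A\<close> with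
  denominators that are units there, localizing \<open>A\<close> at \<open>P\<close> gives the same
  ring.\<close>

lemma localization_change_ring:
  assumes A: "is_subring A" and B: "is_subring B" and Q: "is_prime B Q"
    and sub: "A \<subseteq> localization B Q"
    and clear: "\<And>b. b \<in> B \<Longrightarrow> \<exists>s\<in>A. s \<noteq> 0 \<and> inverse s \<in> localization B Q \<and> s * b \<in> A"
  defines "P \<equiv> {a\<in>A. a = 0 \<or> inverse a \<notin> localization B Q}"
  shows "is_prime A P" "localization B Q = localization A P"
proof -
  let ?x = "localization B Q"
  have x: "is_subring ?x" by (rule localization_subring[OF B Q])
  have inv_mult: "inverse a \<in> ?x \<and> inverse b \<in> ?x" if "a \<in> ?x" "b \<in> ?x" "a * b \<noteq> 0" "inverse (a * b) \<in> ?x" for a b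
  proof -
    have "b * inverse (a * b) \<in> ?x" "a * inverse (a * b) \<in> ?x"
      by (rule is_subring_mult[OF x that(2,4)] is_subring_mult[OF x that(1,4)])+
    moreover have "a \<noteq> 0" "b \<noteq> 0" using that(3) by simp_all
    then have "b * inverse (a * b) = inverse a" "a * inverse (a * b) = inverse b" by simp_all
    ultimately show ?thesis by (simp only: simp_thms)
  qed
  have P_iff: "a \<in> P \<longleftrightarrow> a \<in> A \<and> (a = 0 \<or> inverse a \<notin> ?x)" for a by (simp add: P_def)
  show P: "is_prime A P"
    unfolding is_prime_def is_ideal_def
  proof (intro conjI ballI impI)
    show "P \<subseteq> A" using P_iff by blast
    show "0 \<in> P" "1 \<notin> P" using is_subring_0[OF A] is_subring_1[OF x] by (simp_all add: P_iff)
  next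
    fix a b assume *: "a \<in> P" "b \<in> P"
    then have "a \<in> A" "b \<in> A" using P_iff by blast+
    moreover have "a + b = 0 \<or> inverse (a + b) \<notin> ?x"
      by (rule localization_nonunit_add[OF B Q]) (use * P_iff sub in blast)+
    ultimately show "a + b \<in> P" unfolding P_iff using is_subring_add[OF A] by blast
  next
    fix a b assume *: "a \<in> A" "b \<in> P"
    then have b: "b \<in> A" "b = 0 \<or> inverse b \<notin> ?x" using P_iff by blast+
    have "a * b = 0 \<or> inverse (a * b) \<notin> ?x"
    proof (rule ccontr)
      assume no: "\<not> ?thesis"
      have "a \<in> ?x" "b \<in> ?x" using *(1) b(1) sub by blast+
      then have "inverse b \<in> ?x" using inv_mult[of a b] no by blast
      moreover have "b \<noteq> 0" using no by auto
      ultimately show False using b(2) by blast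
    qed
    then show "a * b \<in> P" unfolding P_iff using is_subring_mult[OF A *(1) b(1)] by blast
  next
    fix a b assume *: "a \<in> A" "b \<in> A" "a * b \<in> P"
    show "a \<in> P \<or> b \<in> P"
    proof (rule ccontr)
      assume "\<not> ?thesis"
      then have "a \<noteq> 0" "b \<noteq> 0" "inverse a \<in> ?x" "inverse b \<in> ?x" using * P_iff by blast+
      then have "a * b \<noteq> 0" "inverse (a * b) \<in> ?x" using is_subring_mult[OF x] by simp_all
      then show False using *(3) P_iff by blast
    qed
  qed
  show "?x = localization A P"
  proof (intro subset_antisym subsetI)
    fix g assume "g \<in> localization A P"
    then obtain s where s: "s \<in> A" "s \<notin> P" "s \<noteq> 0" "s * g \<in> A" unfolding localization_iff[OF P] by blast
    then have "inverse s \<in> ?x" using P_iff by blast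
    then have "inverse s * (s * g) \<in> ?x" by (rule is_subring_mult[OF x]) (use s(4) sub in blast)
    moreover have "inverse s * (s * g) = g" using s(3) by (simp flip: mult.assoc)
    ultimately show "g \<in> ?x" by (simp only:)
  next
    fix g assume "g \<in> ?x"
    then obtain s where s: "s \<in> B" "s \<notin> Q" "s \<noteq> 0" "s * g \<in> B" unfolding localization_iff[OF Q] by blast
    obtain t where t: "t \<in> A" "t \<noteq> 0" "inverse t \<in> ?x" "t * s \<in> A" using clear[OF s(1)] by blast
    obtain r where r: "r \<in> A" "r \<noteq> 0" "inverse r \<in> ?x" "r * (s * g) \<in> A" using clear[OF s(4)] by blast
    define e where "e = r * (t * s)"
    have "inverse s \<in> ?x" using localization_unit_iff[OF B Q s(1)] s(2) by blast
    then have "inverse e \<in> ?x"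
      unfolding e_def inverse_mult_distrib by (intro is_subring_mult[OF x] t(3) r(3))
    moreover have e: "e \<in> A" "e \<noteq> 0"
      unfolding e_def using is_subring_mult[OF A r(1) t(4)] r(2) t(2) s(3) by simp_all
    ultimately have "e \<notin> P" using P_iff by blast
    moreover have "e * g \<in> A"
      using is_subring_mult[OF A t(1) r(4)] unfolding e_def by (simp only: mult_ac)
    ultimately show "g \<in> localization A P"
      unfolding localization_iff[OF P] using e by blast
  qed
qed

text \<open>The previous lemma for \<open>A\<close> inside \<open>B\<close>, where the contraction
  becomes \<open>A \<inter> Q\<close>.\<close>

lemma localization_subring_eq:
  assumes A: "is_subring A" and B: "is_subring B" and Q: "is_prime B Q" and sub: "A \<subseteq> B"
    and clear: "\<And>b. b \<in> B \<Longrightarrow> \<exists>s\<in>A - Q. s * b \<in> A"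
  shows "is_prime A (A \<inter> Q)" "localization B Q = localization A (A \<inter> Q)"
proof -
  have P: "{a\<in>A. a = 0 \<or> inverse a \<notin> localization B Q} = A \<inter> Q"
    using localization_unit_iff[OF B Q] sub by blast
  have sub': "A \<subseteq> localization B Q" using sub localization_superset[OF B Q] by blast
  have clear': "\<exists>s\<in>A. s \<noteq> 0 \<and> inverse s \<in> localization B Q \<and> s * b \<in> A" if "b \<in> B" for b
    using clear[OF that] localization_unit_iff[OF B Q] sub by blast
  show "is_prime A (A \<inter> Q)" "localization B Q = localization A (A \<inter> Q)"
    using localization_change_ring[OF A B Q sub' clear'] unfolding P by blast+
qed

section \<open>Denominators and partitions of unity\<close>

lemma Inter_loc_points:
  assumes A: "is_subring A" and f: "f \<in> A"
    and g: "\<And>x. x \<in> loc_points A \<Longrightarrow> f \<noteq> 0 \<Longrightarrow> inverse f \<in> x \<Longrightarrow> g \<in> x"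
  obtains N where "f ^ N * g \<in> A"
proof (rule ccontr)
  assume no: "\<not> thesis"
  let ?I = "{a\<in>A. a * g \<in> A}"
  have I: "is_ideal A ?I"
    using A by (auto simp: is_ideal_def is_subring_0 is_subring_add is_subring_mult distrib_right mult.assoc)
  \<comment> \<open>\<open>?I\<close> is the ideal of denominators of \<open>g\<close>. A prime
    containing it and avoiding \<open>f\<close> is a point at which \<open>f\<close> is invertible
    but \<open>g\<close> is not regular.\<close>
  have "f ^ n \<notin> ?I" for n using no that by blast
  then obtain P where P: "is_prime A P" "?I \<subseteq> P" "f \<notin> P"
    using prime_avoiding_powers[OF A I f] by metis
  have "localization A P \<in> loc_points A" using P unfolding loc_points_def by blast
  then have "g \<in> localization A P"
    using g[of "localization A P"] localization_unit_iff[OF A P(1) f] P(3) by blast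
  then show False using P(2) unfolding localization_iff[OF P(1)] by blast
qed

text \<open>Quasi-compactness: an ideal contained in no prime is the whole ring, and only finitely
  many \<open>g i\<close> are needed to write 1.\<close>

lemma unit_ideal:
  fixes A :: "'a::field set" and g :: "'b \<Rightarrow> 'a"
  assumes A: "is_subring A" and g: "\<And>i. i \<in> I \<Longrightarrow> g i \<in> A"
    and cover: "\<And>P. is_prime A P \<Longrightarrow> \<exists>i\<in>I. g i \<notin> P"
  obtains J a where "finite J" "J \<subseteq> I" "\<And>i. i \<in> J \<Longrightarrow> a i \<in> A" "(\<Sum>i\<in>J. a i * g i) = 1"
proof (rule ccontr)
  assume no: "\<not> thesis"
  define G where "G = {x. \<exists>J a. finite J \<and> J \<subseteq> I \<and> (\<forall>i\<in>J. a i \<in> A) \<and> x = (\<Sum>i\<in>J. a i * g i)}"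
  have G: "is_ideal A G"
    unfolding is_ideal_def
  proof (intro conjI ballI)
    show "G \<subseteq> A" using A g unfolding G_def by (auto intro!: is_subring_sum is_subring_mult)
    show "0 \<in> G" unfolding G_def mem_Collect_eq by (intro exI[of _ "{}"]) simp
  next
    fix x y assume "x \<in> G" "y \<in> G"
    then obtain J a J' a' where *: "finite J" "J \<subseteq> I" "\<forall>i\<in>J. a i \<in> A" "x = (\<Sum>i\<in>J. a i * g i)"
      "finite J'" "J' \<subseteq> I" "\<forall>i\<in>J'. a' i \<in> A" "y = (\<Sum>i\<in>J'. a' i * g i)" unfolding G_def by blast
    let ?c = "\<lambda>u. if u \<in> J then a u else 0" and ?c' = "\<lambda>u. if u \<in> J' then a' u else 0"
    have "x = (\<Sum>i\<in>J \<union> J'. ?c i * g i)" "y = (\<Sum>i\<in>J \<union> J'. ?c' i * g i)"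
      unfolding *(4,8) using *(1,5) by (auto intro!: sum.mono_neutral_cong_left)
    then have "x + y = (\<Sum>i\<in>J \<union> J'. (?c i + ?c' i) * g i)"
      by (simp add: sum.distrib distrib_right)
    moreover have "\<forall>i\<in>J \<union> J'. ?c i + ?c' i \<in> A" using *(3,7) A by (auto simp: is_subring_add is_subring_0)
    ultimately show "x + y \<in> G" using *(1,2,5,6) unfolding G_def mem_Collect_eq
      by (intro exI[of _ "J \<union> J'"] exI[of _ "\<lambda>i. ?c i + ?c' i"]) simp
  next
    fix x y assume x: "x \<in> A" and "y \<in> G"
    then obtain J a where *: "finite J" "J \<subseteq> I" "\<forall>i\<in>J. a i \<in> A" "y = (\<Sum>i\<in>J. a i * g i)"
      unfolding G_def by blast
    have "x * y = (\<Sum>i\<in>J. (x * a i) * g i)" unfolding *(4) by (simp add: sum_distrib_left mult.assoc)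
    then show "x * y \<in> G" using * x A unfolding G_def mem_Collect_eq
      by (intro exI[of _ J] exI[of _ "\<lambda>i. x * a i"]) (auto simp: is_subring_mult)
  qed
  have "(1::'a) ^ n \<notin> G" for n using no that unfolding G_def by fastforce
  then obtain P where P: "is_prime A P" "G \<subseteq> P"
    using prime_avoiding_powers[OF A G is_subring_1[OF A]] by metis
  have "g i \<in> G" if "i \<in> I" for i
    unfolding G_def mem_Collect_eq using that A
    by (intro exI[of _ "{i}"] exI[of _ "\<lambda>_. 1"]) (auto simp: is_subring_1)
  then show False using cover[OF P(1)] P(2) by blast
qed

text \<open>Primes do not distinguish an element from its powers, so the powers cover as
  well.\<close>

lemma unit_ideal_power:
  fixes A :: "'a::field set" and g :: "'b \<Rightarrow> 'a"
  assumes A: "is_subring A" and g: "\<And>i. i \<in> I \<Longrightarrow> g i \<in> A"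
    and cover: "\<And>P. is_prime A P \<Longrightarrow> \<exists>i\<in>I. g i \<notin> P"
  obtains J a where "finite J" "J \<subseteq> I" "\<And>i. i \<in> J \<Longrightarrow> a i \<in> A" "(\<Sum>i\<in>J. a i * g i ^ N) = 1"
proof -
  have 1: "g i ^ N \<in> A" if "i \<in> I" for i using that g A by (simp add: is_subring_power)
  have 2: "\<exists>i\<in>I. g i ^ N \<notin> P" if "is_prime A P" for P
    using cover[OF that] is_prime_power[OF that A] g by blast
  obtain J a where "finite J" "J \<subseteq> I" "\<And>i. i \<in> J \<Longrightarrow> a i \<in> A" "(\<Sum>i\<in>J. a i * g i ^ N) = 1"
    using unit_ideal[OF A, of I "\<lambda>i. g i ^ N", OF 1 2] by metis
  then show ?thesis by (rule that)
qed

section \<open>Vanishing of cohomology on affine charts\<close>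

lemma fmul_add: "fmul g (D + E) = fmul g D + fmul g E"
  and fmul_diff: "fmul g (D - E) = fmul g D - fmul g E"
  and fmul_fmul: "fmul g (fmul h D) = fmul (g * h) D"
  and fmul_one: "fmul 1 D = D"
  by (auto simp: fmul_def algebra_simps)

lemma sum_fun_apply: "(\<Sum>i\<in>I. D i) f = (\<Sum>i\<in>I. D i f)"
  for D :: "'i \<Rightarrow> 'a \<Rightarrow> 'b::comm_monoid_add"
  by (induction I rule: infinite_finite_induct) auto

lemma sum_fmul: "(\<Sum>i\<in>I. fmul (c i) D) = fmul (\<Sum>i\<in>I. c i) D"
  by (rule ext) (simp add: sum_fun_apply sum_distrib_right)

text \<open>The stalk of the tangent sheaf, the point x being its own local ring.\<close>

definition tstalk :: "ratfun set \<Rightarrow> (ratfun \<Rightarrow> ratfun) set" where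
  "tstalk x = {D. derivation D \<and> D ` x \<subseteq> x}"

lemma tstalkI: "derivation D \<Longrightarrow> (\<And>g. g \<in> x \<Longrightarrow> D g \<in> x) \<Longrightarrow> D \<in> tstalk x"
  unfolding tstalk_def by blast

lemma tstalk_derivation: "D \<in> tstalk x \<Longrightarrow> derivation D"
  by (simp add: tstalk_def)

lemma tstalk_apply: "D \<in> tstalk x \<Longrightarrow> g \<in> x \<Longrightarrow> D g \<in> x"
  unfolding tstalk_def by blast

lemma tstalk_0: "is_subring x \<Longrightarrow> 0 \<in> tstalk x"
  by (rule tstalkI) (simp_all add: is_subring_0)

lemma tstalk_add:
  assumes "is_subring x" "D \<in> tstalk x" "E \<in> tstalk x"
  shows "D + E \<in> tstalk x"
  by (rule tstalkI)
    (simp_all add: assms derivation_add tstalk_derivation[OF assms(2)] tstalk_derivation[OF assms(3)]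
      is_subring_add[OF assms(1)] tstalk_apply[OF assms(2)] tstalk_apply[OF assms(3)])

lemma tstalk_diff:
  assumes "is_subring x" "D \<in> tstalk x" "E \<in> tstalk x"
  shows "D - E \<in> tstalk x"
  by (rule tstalkI)
    (simp_all add: assms derivation_diff tstalk_derivation[OF assms(2)] tstalk_derivation[OF assms(3)]
      is_subring_diff[OF assms(1)] tstalk_apply[OF assms(2)] tstalk_apply[OF assms(3)])

lemma tstalk_uminus:
  assumes "is_subring x" "D \<in> tstalk x"
  shows "- D \<in> tstalk x"
  using tstalk_diff[OF assms(1) tstalk_0[OF assms(1)] assms(2)] by simp

lemma tstalk_fmul:
  assumes "is_subring x" "g \<in> x" "D \<in> tstalk x"
  shows "fmul g D \<in> tstalk x"
  by (rule tstalkI)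
    (simp_all add: assms derivation_fmul tstalk_derivation[OF assms(3)]
      is_subring_mult[OF assms(1)] tstalk_apply[OF assms(3)])

lemma tstalk_sum:
  assumes "is_subring x" "\<And>i. i \<in> I \<Longrightarrow> D i \<in> tstalk x"
  shows "sum D I \<in> tstalk x"
  using assms(2) by (induction I rule: infinite_finite_induct)
    (simp_all add: tstalk_0[OF assms(1)] tstalk_add[OF assms(1)])

text \<open>At the level of points: the locus where a product is invertible is the intersection of
  the loci of its factors.\<close>

lemma subring_inverse_mult:
  assumes x: "is_subring x" and "a \<in> x" "b \<in> x" "a \<noteq> 0" "b \<noteq> 0"
  shows "inverse (a * b) \<in> x \<longleftrightarrow> inverse a \<in> x \<and> inverse b \<in> x"
proof
  assume *: "inverse (a * b) \<in> x"
  have "b * inverse (a * b) = inverse a" "a * inverse (a * b) = inverse b"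
    using assms(4,5) by simp_all
  then show "inverse a \<in> x \<and> inverse b \<in> x"
    using is_subring_mult[OF x assms(3) *] is_subring_mult[OF x assms(2) *] by (simp only: simp_thms)
next
  assume "inverse a \<in> x \<and> inverse b \<in> x"
  then show "inverse (a * b) \<in> x" using is_subring_mult[OF x] by simp
qed

text \<open>The finite set \<open>G\<close> of test functions gives the tangent sheaf its coherence:
  a single power of a denominator serves all of them at once.\<close>

locale affine_chart =
  fixes A :: "ratfun set" and G :: "ratfun set"
  assumes A: "is_subring A" and G: "finite G" "G \<subseteq> A"
    and gen: "\<And>x D. x \<in> loc_points A \<Longrightarrow> derivation D \<Longrightarrow> D ` G \<subseteq> x \<Longrightarrow> D \<in> tstalk x"
begin

abbreviation X where "X \<equiv> loc_points A"

lemma X_subring: "z \<in> X \<Longrightarrow> is_subring z"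
  using loc_points_subring[OF A] .

lemma X_superset: "z \<in> X \<Longrightarrow> g \<in> A \<Longrightarrow> g \<in> z"
  using loc_points_superset[OF A] by blast

text \<open>A field on the locus where \<open>f\<close> is invertible sends each test function to a
  fraction with a power of \<open>f\<close> below; the sum of these exponents suffices.\<close>

lemma clear_denominator:
  assumes f: "f \<in> A" "f \<noteq> 0" and D: "\<And>z. z \<in> X \<Longrightarrow> inverse f \<in> z \<Longrightarrow> D \<in> tstalk z"
  obtains N where "\<And>z. z \<in> X \<Longrightarrow> fmul (f ^ N) D \<in> tstalk z"
proof -
  \<comment> \<open>Some point with \<open>f\<close> invertible is needed to know that
    \<open>D\<close> is a derivation at all.\<close>
  have "is_ideal A {0}" by (simp add: is_ideal_def is_subring_0[OF A])
  moreover have "f ^ n \<notin> {0}" for n using f(2) by simp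
  ultimately obtain P where P: "is_prime A P" "f \<notin> P"
    using prime_avoiding_powers[OF A _ f(1), of "{0}"] by metis
  have "localization A P \<in> X" using P(1) unfolding loc_points_def by blast
  moreover have "inverse f \<in> localization A P" using localization_unit_iff[OF A P(1) f(1)] P(2) by blast
  ultimately have der: "derivation D" using D tstalk_derivation by blast
  have "\<exists>N. f ^ N * D g \<in> A" if "g \<in> G" for g
  proof -
    have "D g \<in> z" if z: "z \<in> X" "inverse f \<in> z" for z
      using tstalk_apply[OF D[OF z]] X_superset[OF z(1)] G(2) \<open>g \<in> G\<close> by blast
    then show ?thesis using Inter_loc_points[OF A f(1), of "D g"] by metis
  qed
  then obtain N where N: "\<And>g. g \<in> G \<Longrightarrow> f ^ N g * D g \<in> A" by metis
  show ?thesis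
  proof (rule that[of "sum N G"])
    fix z assume z: "z \<in> X"
    have "fmul (f ^ sum N G) D g \<in> A" if g: "g \<in> G" for g
    proof -
      have "N g \<le> sum N G" using member_le_sum[of g G N] g G(1) by simp
      then have "f ^ sum N G * D g = f ^ (sum N G - N g) * (f ^ N g * D g)"
        by (simp add: mult.assoc[symmetric] power_add[symmetric])
      then show ?thesis using is_subring_mult[OF A is_subring_power[OF A f(1)] N[OF g]]
        by (simp only: fmul_apply)
    qed
    then show "fmul (f ^ sum N G) D \<in> tstalk z"
      using X_superset[OF z] by (intro gen[OF z] derivation_fmul der) blast
  qed
qed

lemma clear_denominators:
  assumes T: "finite T" and f: "\<And>t. t \<in> T \<Longrightarrow> f t \<in> A" "\<And>t. t \<in> T \<Longrightarrow> f t \<noteq> 0"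
    and D: "\<And>t z. t \<in> T \<Longrightarrow> z \<in> X \<Longrightarrow> inverse (f t) \<in> z \<Longrightarrow> D t \<in> tstalk z"
  obtains N where "\<And>t z. t \<in> T \<Longrightarrow> z \<in> X \<Longrightarrow> fmul (f t ^ N) (D t) \<in> tstalk z"
proof -
  have "\<exists>N. \<forall>z\<in>X. fmul (f t ^ N) (D t) \<in> tstalk z" if "t \<in> T" for t
    using clear_denominator[OF f(1)[OF that] f(2)[OF that] D[OF that]] by metis
  then obtain N where N: "\<And>t z. t \<in> T \<Longrightarrow> z \<in> X \<Longrightarrow> fmul (f t ^ N t) (D t) \<in> tstalk z" by metis
  show ?thesis
  proof (rule that[of "sum N T"])
    fix t z assume t: "t \<in> T" and z: "z \<in> X"
    have "N t \<le> sum N T" using member_le_sum[of t T N] t T by simp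
    then have "fmul (f t ^ sum N T) (D t) = fmul (f t ^ (sum N T - N t)) (fmul (f t ^ N t) (D t))"
      unfolding fmul_fmul by (simp add: power_add[symmetric])
    then show "fmul (f t ^ sum N T) (D t) \<in> tstalk z"
      using tstalk_fmul[OF X_subring[OF z] is_subring_power[OF X_subring[OF z] X_superset[OF z f(1)[OF t]]] N[OF t z]]
      by simp
  qed
qed

text \<open>The finite subcover \<open>J\<close> comes before the exponent \<open>N\<close>, because
  \<open>N\<close> will depend on denominators of fields indexed by \<open>J\<close>.\<close>

lemma partition_of_unity:
  assumes f: "\<And>x. x \<in> X \<Longrightarrow> f x \<in> A \<and> f x \<noteq> 0 \<and> inverse (f x) \<in> x"
  shows "\<exists>J. finite J \<and> J \<subseteq> X \<and> (\<forall>z\<in>X. \<exists>y\<in>J. inverse (f y) \<in> z) \<and>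
    (\<forall>N. \<exists>c. (\<forall>x\<in>J. c x \<in> A) \<and> (\<Sum>x\<in>J. c x * f x ^ N) = 1)"
proof -
  have fA: "\<And>x. x \<in> X \<Longrightarrow> f x \<in> A" using f by blast
  have cover: "\<exists>x\<in>X. f x \<notin> P" if P: "is_prime A P" for P
  proof -
    have x: "localization A P \<in> X" using P unfolding loc_points_def by blast
    then show ?thesis using f[OF x] localization_unit_iff[OF A P] by blast
  qed
  obtain J a where J: "finite J" "J \<subseteq> X" "\<And>i. i \<in> J \<Longrightarrow> a i \<in> A" "(\<Sum>i\<in>J. a i * f i) = 1"
    using unit_ideal[OF A fA cover] by metis
  have coverJ: "\<exists>x\<in>J. f x \<notin> P" if P: "is_prime A P" for P
  proof (rule ccontr)
    assume no: "\<not> ?thesis"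
    have id: "is_ideal A P" using P by (simp add: is_prime_def)
    have "a i * f i \<in> P" if "i \<in> J" for i
      using id J(3)[OF that] no that unfolding is_ideal_def by blast
    then have "(\<Sum>i\<in>J. a i * f i) \<in> P" by (rule is_ideal_sum[OF id])
    then show False using J(4) P by (simp add: is_prime_def)
  qed
  have fJ: "f x \<in> A" if "x \<in> J" for x using fA J(2) that by blast
  show ?thesis
  proof (intro exI[of _ J] conjI J(1,2) ballI allI)
    fix z assume "z \<in> X"
    then obtain P where P: "is_prime A P" "z = localization A P" by (rule loc_pointsE)
    obtain y where "y \<in> J" "f y \<notin> P" using coverJ[OF P(1)] by blast
    then show "\<exists>y\<in>J. inverse (f y) \<in> z"
      using localization_unit_iff[OF A P(1) fJ] P(2) by blast
  next
    fix N
    have "\<exists>J' c. finite J' \<and> J' \<subseteq> J \<and> (\<forall>i\<in>J'. c i \<in> A) \<and> (\<Sum>i\<in>J'. c i * f i ^ N) = 1"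
    proof (rule unit_ideal_power[OF A fJ coverJ, where N = N])
      fix J' c assume "finite J'" "J' \<subseteq> J" "\<And>i. i \<in> J' \<Longrightarrow> c i \<in> A" "(\<Sum>i\<in>J'. c i * f i ^ N) = 1"
      then show ?thesis by (intro exI[of _ J'] exI[of _ c] conjI ballI)
    qed
    then obtain J' c where *: "finite J'" "J' \<subseteq> J" "\<And>i. i \<in> J' \<Longrightarrow> c i \<in> A" "(\<Sum>i\<in>J'. c i * f i ^ N) = 1"
      by blast
    \<comment> \<open>For a given \<open>N\<close> a smaller index set \<open>J'\<close> may arise;
      extending by zero keeps \<open>J\<close> independent of \<open>N\<close>.\<close>
    let ?c = "\<lambda>i. if i \<in> J' then c i else 0"
    have "(\<Sum>x\<in>J. ?c x * f x ^ N) = (\<Sum>i\<in>J'. c i * f i ^ N)"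
      using J(1) *(2) by (intro sum.mono_neutral_cong_right) auto
    moreover have "\<forall>x\<in>J. ?c x \<in> A" using *(3) is_subring_0[OF A] by simp
    ultimately show "\<exists>c. (\<forall>x\<in>J. c x \<in> A) \<and> (\<Sum>x\<in>J. c x * f x ^ N) = 1"
      unfolding *(4) by (intro exI[of _ ?c] conjI)
  qed
qed

text \<open>Where \<open>g\<close> is invertible, the factor \<open>c * f ^ N\<close> equals a
  regular function times \<open>(f * g) ^ N\<close>, and this clears the denominators of
  \<open>D\<close>.\<close>

lemma partition_term:
  assumes z: "z \<in> X" and c: "c \<in> A" and g: "g \<in> A" "g \<noteq> 0" "inverse g \<in> z"
    and D: "fmul ((f * g) ^ N) D \<in> tstalk z"
  shows "fmul (c * f ^ N) D \<in> tstalk z"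
proof -
  have sub: "is_subring z" by (rule X_subring[OF z])
  have "c * inverse g ^ N \<in> z"
    by (rule is_subring_mult[OF sub X_superset[OF z c] is_subring_power[OF sub g(3)]])
  moreover have "c * inverse g ^ N * (f * g) ^ N = c * f ^ N"
    using g(2) by (simp add: power_mult_distrib power_inverse)
  ultimately show ?thesis using tstalk_fmul[OF sub _ D] by (metis fmul_fmul)
qed

text \<open>The \<open>b x\<close> are germs that agree modulo regular fields. Lifting them to one
  field \<open>h\<close> expresses that the first cohomology of the tangent sheaf vanishes on an
  affine chart.\<close>

lemma affine_H1:
  assumes f: "\<And>x. x \<in> X \<Longrightarrow> f x \<in> A \<and> f x \<noteq> 0 \<and> inverse (f x) \<in> x"
    and b: "\<And>x z. x \<in> X \<Longrightarrow> z \<in> X \<Longrightarrow> inverse (f x) \<in> z \<Longrightarrow> b x - b z \<in> tstalk z"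
  obtains h where "\<And>z. z \<in> X \<Longrightarrow> b z - h \<in> tstalk z"
proof -
  obtain J where "finite J \<and> J \<subseteq> X \<and> (\<forall>z\<in>X. \<exists>y\<in>J. inverse (f y) \<in> z) \<and>
      (\<forall>N. \<exists>c. (\<forall>x\<in>J. c x \<in> A) \<and> (\<Sum>x\<in>J. c x * f x ^ N) = 1)"
    using partition_of_unity[of f, OF f] ..
  then have J: "finite J" "J \<subseteq> X" "\<And>z. z \<in> X \<Longrightarrow> \<exists>y\<in>J. inverse (f y) \<in> z"
    "\<And>N. \<exists>c. (\<forall>x\<in>J. c x \<in> A) \<and> (\<Sum>x\<in>J. c x * f x ^ N) = 1"
    by simp_all
  have fJ: "f x \<in> A" "f x \<noteq> 0" if "x \<in> J" for x using f J(2) that by blast+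
  have pair: "b y - b x \<in> tstalk z"
    if "x \<in> J" "y \<in> J" "z \<in> X" "inverse (f x * f y) \<in> z" for x y z
  proof -
    have "inverse (f x) \<in> z" "inverse (f y) \<in> z"
      using subring_inverse_mult[OF X_subring[OF that(3)] X_superset[OF that(3) fJ(1)[OF that(1)]]
          X_superset[OF that(3) fJ(1)[OF that(2)]] fJ(2)[OF that(1)] fJ(2)[OF that(2)]] that(4) by blast+
    then have "b x - b z \<in> tstalk z" "b y - b z \<in> tstalk z"
      using b J(2) that by blast+
    then have "(b y - b z) - (b x - b z) \<in> tstalk z" using tstalk_diff[OF X_subring[OF that(3)]] by blast
    then show ?thesis by simp
  qed
  have 1: "finite (J \<times> J)" using J(1) by simp
  have 2: "f (fst t) * f (snd t) \<in> A" "f (fst t) * f (snd t) \<noteq> 0" if "t \<in> J \<times> J" for t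
    using that fJ is_subring_mult[OF A] by auto
  have 3: "b (snd t) - b (fst t) \<in> tstalk z"
    if "t \<in> J \<times> J" "z \<in> X" "inverse (f (fst t) * f (snd t)) \<in> z" for t z
    using pair[of "fst t" "snd t" z] that by auto
  obtain N where N: "\<And>t z. t \<in> J \<times> J \<Longrightarrow> z \<in> X \<Longrightarrow>
      fmul ((f (fst t) * f (snd t)) ^ N) (b (snd t) - b (fst t)) \<in> tstalk z"
    using clear_denominators[of "J \<times> J" "\<lambda>t. f (fst t) * f (snd t)" "\<lambda>t. b (snd t) - b (fst t)", OF 1 2 3]
    by metis
  obtain c where c: "\<And>x. x \<in> J \<Longrightarrow> c x \<in> A" "(\<Sum>x\<in>J. c x * f x ^ N) = 1" using J(4) by blast
  \<comment> \<open>The average of \<open>b\<close> over the partition of unity: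
    \<open>b y - h\<close> is the average of the differences \<open>b y - b x\<close>, whose
    denominators \<open>N\<close> clears.\<close>
  define h where "h = (\<Sum>x\<in>J. fmul (c x * f x ^ N) (b x))"
  show ?thesis
  proof (rule that[of h])
    fix z assume z: "z \<in> X"
    note sub = X_subring[OF z]
    obtain y where y: "y \<in> J" "inverse (f y) \<in> z" using J(3)[OF z] by blast
    have "(\<Sum>x\<in>J. fmul (c x * f x ^ N) (b y - b x)) = fmul 1 (b y) - h"
      unfolding h_def fmul_diff sum_subtractf sum_fmul c(2) ..
    moreover have "(\<Sum>x\<in>J. fmul (c x * f x ^ N) (b y - b x)) \<in> tstalk z"
    proof (rule tstalk_sum[OF sub])
      fix x assume x: "x \<in> J"
      show "fmul (c x * f x ^ N) (b y - b x) \<in> tstalk z"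
        using partition_term[OF z c(1)[OF x] fJ[OF y(1)] y(2)] N[of "(x, y)", OF _ z] x y(1) by simp
    qed
    ultimately have "b y - h \<in> tstalk z" by (simp add: fmul_one)
    moreover have "b y - b z \<in> tstalk z" using b[of y z] J(2) y z by blast
    ultimately have "(b y - h) - (b y - b z) \<in> tstalk z" using tstalk_diff[OF sub] by blast
    then show "b z - h \<in> tstalk z" by simp
  qed
qed

text \<open>A 1-cochain whose coboundary is regular is, modulo regular fields, a coboundary on a
  finer cover. The solution is a contracting homotopy averaged over the finite subcover
  \<open>J\<close>.\<close>

lemma affine_H2:
  assumes f: "\<And>x. x \<in> X \<Longrightarrow> f x \<in> A \<and> f x \<noteq> 0 \<and> inverse (f x) \<in> x"
    and b: "\<And>x y z w. x \<in> X \<Longrightarrow> y \<in> X \<Longrightarrow> z \<in> X \<Longrightarrow> w \<in> X \<Longrightarrow>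
      inverse (f x) \<in> w \<Longrightarrow> inverse (f y) \<in> w \<Longrightarrow> inverse (f z) \<in> w \<Longrightarrow>
      b x y + b y z - b x z \<in> tstalk w"
  obtains a g where "\<And>x. x \<in> X \<Longrightarrow> g x \<in> A \<and> g x \<noteq> 0 \<and> inverse (g x) \<in> x"
    "\<And>x y w. x \<in> X \<Longrightarrow> y \<in> X \<Longrightarrow> w \<in> X \<Longrightarrow> inverse (g x) \<in> w \<Longrightarrow> inverse (g y) \<in> w \<Longrightarrow>
      b x y - a y + a x \<in> tstalk w"
proof -
  obtain J where "finite J \<and> J \<subseteq> X \<and> (\<forall>z\<in>X. \<exists>y\<in>J. inverse (f y) \<in> z) \<and>
      (\<forall>N. \<exists>c. (\<forall>x\<in>J. c x \<in> A) \<and> (\<Sum>x\<in>J. c x * f x ^ N) = 1)"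
    using partition_of_unity[of f, OF f] ..
  then have J: "finite J" "J \<subseteq> X" "\<And>z. z \<in> X \<Longrightarrow> \<exists>y\<in>J. inverse (f y) \<in> z"
    "\<And>N. \<exists>c. (\<forall>x\<in>J. c x \<in> A) \<and> (\<Sum>x\<in>J. c x * f x ^ N) = 1"
    by simp_all
  have fJ: "f x \<in> A" "f x \<noteq> 0" if "x \<in> J" for x using f J(2) that by blast+
  define C where "C x y z = b x y + b y z - b x z" for x y z
  have C: "C i p q \<in> tstalk z"
    if J3: "i \<in> J" "p \<in> J" "q \<in> J" and z: "z \<in> X" and u: "inverse (f i * (f p * f q)) \<in> z" for i p q z
  proof -
    note m = subring_inverse_mult[OF X_subring[OF z]]
    have mem: "f i \<in> z" "f p \<in> z" "f q \<in> z" "f p * f q \<in> z" "f p * f q \<noteq> 0"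
      using X_superset[OF z] fJ J3 is_subring_mult[OF A] by simp_all
    have "inverse (f i) \<in> z" "inverse (f p * f q) \<in> z"
      using m[OF mem(1,4) fJ(2)[OF J3(1)] mem(5)] u by blast+
    moreover from this have "inverse (f p) \<in> z" "inverse (f q) \<in> z"
      using m[OF mem(2,3) fJ(2)[OF J3(2)] fJ(2)[OF J3(3)]] by blast+
    ultimately show ?thesis unfolding C_def using b[of i p q z] J(2) J3 z by blast
  qed
  have 1: "finite (J \<times> J \<times> J)" using J(1) by simp
  have 2: "f (fst t) * (f (fst (snd t)) * f (snd (snd t))) \<in> A"
    "f (fst t) * (f (fst (snd t)) * f (snd (snd t))) \<noteq> 0" if "t \<in> J \<times> J \<times> J" for t
    using that fJ is_subring_mult[OF A] by auto
  have 3: "C (fst t) (fst (snd t)) (snd (snd t)) \<in> tstalk z"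
    if "t \<in> J \<times> J \<times> J" "z \<in> X" "inverse (f (fst t) * (f (fst (snd t)) * f (snd (snd t)))) \<in> z" for t z
    using C[of "fst t" "fst (snd t)" "snd (snd t)" z] that by auto
  obtain N where N: "\<And>t z. t \<in> J \<times> J \<times> J \<Longrightarrow> z \<in> X \<Longrightarrow>
      fmul ((f (fst t) * (f (fst (snd t)) * f (snd (snd t)))) ^ N) (C (fst t) (fst (snd t)) (snd (snd t))) \<in> tstalk z"
    using clear_denominators[of "J \<times> J \<times> J" "\<lambda>t. f (fst t) * (f (fst (snd t)) * f (snd (snd t)))"
        "\<lambda>t. C (fst t) (fst (snd t)) (snd (snd t))", OF 1 2 3]
    by metis
  obtain c where c: "\<And>x. x \<in> J \<Longrightarrow> c x \<in> A" "(\<Sum>x\<in>J. c x * f x ^ N) = 1" using J(4) by blast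
  \<comment> \<open>A refinement map to the finite subcover; multiplying by \<open>f (r x)\<close>
    shrinks the neighbourhood of \<open>x\<close> into that of \<open>r x\<close>.\<close>
  obtain r where r: "\<And>x. x \<in> X \<Longrightarrow> r x \<in> J \<and> inverse (f (r x)) \<in> x" using J(3) by metis
  define S where "S p = (\<Sum>i\<in>J. fmul (c i * f i ^ N) (b i p))" for p
  define a where "a x = S (r x) + b (r x) x" for x
  define g where "g x = f x * f (r x)" for x
  show ?thesis
  proof (rule that[of g a])
    fix x assume x: "x \<in> X"
    have "f x \<in> A" "f x \<noteq> 0" "inverse (f x) \<in> x" "f (r x) \<in> A" "f (r x) \<noteq> 0" "inverse (f (r x)) \<in> x"
      using f[OF x] r[OF x] fJ by blast+
    then show "g x \<in> A \<and> g x \<noteq> 0 \<and> inverse (g x) \<in> x"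
      unfolding g_def using is_subring_mult[OF A] is_subring_mult[OF X_subring[OF x]] by simp
  next
    fix x y w assume x: "x \<in> X" and y: "y \<in> X" and w: "w \<in> X"
      and g: "inverse (g x) \<in> w" "inverse (g y) \<in> w"
    note sub = X_subring[OF w]
    define p q where "p = r x" and "q = r y"
    have pq: "p \<in> J" "q \<in> J" using r x y by (auto simp: p_def q_def)
    have split: "inverse (f u) \<in> w \<and> inverse (f (r u)) \<in> w" if u: "u \<in> X" "inverse (g u) \<in> w" for u
    proof -
      have "f u \<in> w" "f u \<noteq> 0" "f (r u) \<in> w" "f (r u) \<noteq> 0"
        using f[OF u(1)] r[OF u(1)] fJ X_superset[OF w] by blast+
      then show ?thesis using subring_inverse_mult[OF sub] u(2) unfolding g_def by blast
    qed
    have inv: "inverse (f x) \<in> w" "inverse (f p) \<in> w" "inverse (f y) \<in> w" "inverse (f q) \<in> w"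
      using split[OF x g(1)] split[OF y g(2)] by (auto simp: p_def q_def)
    have pqX: "p \<in> X" "q \<in> X" using pq J(2) by auto
    have "C p x y \<in> tstalk w" "C p q y \<in> tstalk w"
      unfolding C_def using b pqX x y w inv by blast+
    then have A1: "C p x y - C p q y \<in> tstalk w" by (rule tstalk_diff[OF sub])
    have A2: "(\<Sum>i\<in>J. fmul (c i * f i ^ N) (C i p q)) \<in> tstalk w"
    proof (rule tstalk_sum[OF sub])
      fix i assume i: "i \<in> J"
      have e: "f p * f q \<in> A" "f p * f q \<noteq> 0" "inverse (f p * f q) \<in> w"
        using fJ pq is_subring_mult[OF A] is_subring_mult[OF sub inv(2,4)] by simp_all
      show "fmul (c i * f i ^ N) (C i p q) \<in> tstalk w"
        using partition_term[OF w c(1)[OF i] e] N[of "(i, p, q)", OF _ w] i pq by simp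
    qed
    have "(\<Sum>i\<in>J. fmul (c i * f i ^ N) (C i p q)) = S p + b p q - S q"
      unfolding C_def fmul_diff fmul_add sum_subtractf sum.distrib S_def sum_fmul c(2) fmul_one ..
    \<comment> \<open>In the two terms with \<open>C p\<close>, passing from \<open>x\<close> to
      \<open>y\<close> is compared with passing from \<open>p\<close> to \<open>q\<close>; the
      average of \<open>C i p q\<close> accounts for the latter.\<close>
    then have "b x y - a y + a x = (C p x y - C p q y) + (\<Sum>i\<in>J. fmul (c i * f i ^ N) (C i p q))"
      unfolding a_def C_def p_def q_def by (simp add: algebra_simps)
    then show "b x y - a y + a x \<in> tstalk w" using tstalk_add[OF sub A1 A2] by simp
  qed
qed

end

section \<open>Complete smooth fans in rank 2\<close>

definition det2 :: "latt \<Rightarrow> latt \<Rightarrow> int" where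
  "det2 e f = fst e * snd f - snd e * fst f"

lemma det2_self [simp]: "det2 e e = 0"
  by (simp add: det2_def)

lemma det2_swap: "det2 f e = - det2 e f"
  by (simp add: det2_def)

lemma lpair_simps:
  "lpair (m + n) u = lpair m u + lpair n u" "lpair n (u + v) = lpair n u + lpair n v"
  "lpair n (u - v) = lpair n u - lpair n v" "lpair n (- u) = - lpair n u" "lpair n 0 = 0"
  "lpair n (k * a, k * b) = k * lpair n (a, b)"
  by (simp_all add: lpair_def algebra_simps)

lemma pos_hull_empty: "pos_hull {} = {(0, 0)}"
  by (auto simp: pos_hull_def)

lemma pos_hull_single:
  "w \<in> pos_hull {e} \<longleftrightarrow> (\<exists>a\<ge>0. w = (a * of_int (fst e), a * of_int (snd e)))"
proof
  assume "w \<in> pos_hull {e}"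
  then show "\<exists>a\<ge>0. w = (a * of_int (fst e), a * of_int (snd e))" by (auto simp: pos_hull_def)
next
  assume "\<exists>a\<ge>0. w = (a * of_int (fst e), a * of_int (snd e))"
  then obtain a where "a \<ge> 0" "w = (a * of_int (fst e), a * of_int (snd e))" by blast
  then show "w \<in> pos_hull {e}" unfolding pos_hull_def mem_Collect_eq
    by (intro exI[of _ "\<lambda>_. a"]) simp
qed

lemma pos_hull_pair:
  assumes "e \<noteq> f"
  shows "w \<in> pos_hull {e, f} \<longleftrightarrow> (\<exists>a b. a \<ge> 0 \<and> b \<ge> 0 \<and>
    w = (a * of_int (fst e) + b * of_int (fst f), a * of_int (snd e) + b * of_int (snd f)))"
proof
  assume "w \<in> pos_hull {e, f}"
  then obtain a where "\<forall>v\<in>{e, f}. 0 \<le> a v"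
    "w = (\<Sum>v\<in>{e, f}. a v * of_int (fst v), \<Sum>v\<in>{e, f}. a v * of_int (snd v))"
    unfolding pos_hull_def by blast
  then show "\<exists>a b. a \<ge> 0 \<and> b \<ge> 0 \<and>
    w = (a * of_int (fst e) + b * of_int (fst f), a * of_int (snd e) + b * of_int (snd f))"
    using assms by (intro exI[of _ "a e"] exI[of _ "a f"]) simp
next
  assume "\<exists>a b. a \<ge> 0 \<and> b \<ge> 0 \<and>
    w = (a * of_int (fst e) + b * of_int (fst f), a * of_int (snd e) + b * of_int (snd f))"
  then obtain a b where "a \<ge> 0" "b \<ge> 0"
    "w = (a * of_int (fst e) + b * of_int (fst f), a * of_int (snd e) + b * of_int (snd f))" by blast
  then show "w \<in> pos_hull {e, f}" unfolding pos_hull_def mem_Collect_eq using assms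
    by (intro exI[of _ "\<lambda>v. if v = e then a else b"]) auto
qed

lemma dual_monoid_pos_hull:
  assumes "finite S"
  shows "dual_monoid (pos_hull S) = {u. \<forall>n\<in>S. 0 \<le> lpair n u}"
proof (intro Set.set_eqI iffI)
  fix u assume u: "u \<in> dual_monoid (pos_hull S)"
  have "0 \<le> lpair n u" if n: "n \<in> S" for n
  proof -
    have "latt_pt n \<in> pos_hull S"
      unfolding pos_hull_def mem_Collect_eq latt_pt_def
      using assms n by (intro exI[of _ "\<lambda>v. if v = n then 1 else 0"])
        (auto simp: if_distrib[of "\<lambda>x. x * _"] cong: if_cong)
    then have "0 \<le> qpair (latt_pt n) u" using u by (simp add: dual_monoid_def)
    also have "qpair (latt_pt n) u = of_int (lpair n u)" by (simp add: qpair_def latt_pt_def lpair_def)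
    finally show ?thesis by simp
  qed
  then show "u \<in> {u. \<forall>n\<in>S. 0 \<le> lpair n u}" by blast
next
  fix u assume u: "u \<in> {u. \<forall>n\<in>S. 0 \<le> lpair n u}"
  show "u \<in> dual_monoid (pos_hull S)"
    unfolding dual_monoid_def mem_Collect_eq
  proof
    fix w assume "w \<in> pos_hull S"
    then obtain a where a: "\<forall>v\<in>S. 0 \<le> a v"
      "w = (\<Sum>v\<in>S. a v * of_int (fst v), \<Sum>v\<in>S. a v * of_int (snd v))"
      unfolding pos_hull_def by blast
    have "qpair w u = (\<Sum>v\<in>S. a v * of_int (lpair v u))"
      unfolding a(2) qpair_def lpair_def by (simp add: sum_distrib_left sum.distrib distrib_left mult_ac)
    also have "\<dots> \<ge> 0" using a(1) u by (intro sum_nonneg) simp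
    finally show "0 \<le> qpair w u" .
  qed
qed

lemma qpair_latt_pt: "qpair (latt_pt n) u = of_int (lpair n u)"
  by (simp add: qpair_def latt_pt_def lpair_def)

text \<open>Cramer's rule.\<close>

lemma det2_expand:
  assumes "det2 e f = 1"
  shows "fst n = det2 n f * fst e + det2 e n * fst f" "snd n = det2 n f * snd e + det2 e n * snd f"
proof -
  have "det2 n f * fst e + det2 e n * fst f = det2 e f * fst n"
    "det2 n f * snd e + det2 e n * snd f = det2 e f * snd n"
    by (simp_all add: det2_def algebra_simps)
  then show "fst n = det2 n f * fst e + det2 e n * fst f" "snd n = det2 n f * snd e + det2 e n * snd f"
    using assms by simp_all
qed

lemma det2_coeff:
  assumes "latt_pt n = (a * of_int (fst e) + b * of_int (fst f), a * of_int (snd e) + b * of_int (snd f))"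
  shows "of_int (det2 n m) = a * of_int (det2 e m) + b * of_int (det2 f m)"
  using assms by (simp add: det2_def latt_pt_def algebra_simps)

lemma latt_pt_pair_iff:
  assumes "det2 e f = 1"
  shows "latt_pt n \<in> pos_hull {e, f} \<longleftrightarrow> det2 n f \<ge> 0 \<and> det2 e n \<ge> 0"
proof -
  have ef: "e \<noteq> f" using assms by auto
  show ?thesis
  proof
    assume "latt_pt n \<in> pos_hull {e, f}"
    then obtain a b where ab: "a \<ge> 0" "b \<ge> 0" and
      n: "latt_pt n = (a * of_int (fst e) + b * of_int (fst f), a * of_int (snd e) + b * of_int (snd f))"
      unfolding pos_hull_pair[OF ef] by blast
    have "of_int (det2 n f) = a" using det2_coeff[OF n, of f] assms by simp
    moreover have "of_int (det2 n e) = - b" using det2_coeff[OF n, of e] assms det2_swap[of f e] by simp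
    ultimately have "(0::rat) \<le> of_int (det2 n f)" "(0::rat) \<le> of_int (- det2 n e)"
      using ab by simp_all
    then show "det2 n f \<ge> 0 \<and> det2 e n \<ge> 0" using det2_swap[of n e] by simp
  next
    assume *: "det2 n f \<ge> 0 \<and> det2 e n \<ge> 0"
    have "latt_pt n = (of_int (det2 n f) * of_int (fst e) + of_int (det2 e n) * of_int (fst f),
        of_int (det2 n f) * of_int (snd e) + of_int (det2 e n) * of_int (snd f))"
      unfolding latt_pt_def
      by (subst det2_expand(1)[OF assms], subst det2_expand(2)[OF assms]) simp
    then show "latt_pt n \<in> pos_hull {e, f}"
      unfolding pos_hull_pair[OF ef] using * by (intro exI conjI) auto
  qed
qed

lemma latt_pt_single_det: "latt_pt n \<in> pos_hull {e} \<Longrightarrow> det2 e n = 0"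
proof -
  assume "latt_pt n \<in> pos_hull {e}"
  then obtain a where "latt_pt n = (a * of_int (fst e), a * of_int (snd e))"
    unfolding pos_hull_single by blast
  then have "of_int (det2 e n) = (0::rat)" by (simp add: latt_pt_def det2_def)
  then show ?thesis by simp
qed

lemma latt_pt_self: "latt_pt e \<in> pos_hull {e}"
  unfolding pos_hull_single latt_pt_def by (intro exI[of _ 1]) simp

lemma latt_pt_single_iff:
  assumes "det2 e g = 1"
  shows "latt_pt n \<in> pos_hull {e} \<longleftrightarrow> (\<exists>k::nat. n = (int k * fst e, int k * snd e))"
proof
  assume n: "latt_pt n \<in> pos_hull {e}"
  then obtain a where a: "a \<ge> 0" "latt_pt n = (a * of_int (fst e) + 0 * of_int (fst g), a * of_int (snd e) + 0 * of_int (snd g))"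
    unfolding pos_hull_single by auto
  have "of_int (det2 n g) = a" using det2_coeff[OF a(2), of g] assms by simp
  then have "det2 n g \<ge> 0" using a(1) by (metis of_int_0_le_iff)
  moreover have "fst n = det2 n g * fst e" "snd n = det2 n g * snd e"
    using det2_expand[OF assms, of n] latt_pt_single_det[OF n] by simp_all
  ultimately show "\<exists>k::nat. n = (int k * fst e, int k * snd e)"
    by (intro exI[of _ "nat (det2 n g)"]) (simp add: prod_eq_iff)
next
  assume "\<exists>k::nat. n = (int k * fst e, int k * snd e)"
  then obtain k :: nat where "n = (int k * fst e, int k * snd e)" by blast
  then show "latt_pt n \<in> pos_hull {e}"
    unfolding pos_hull_single latt_pt_def by (intro exI[of _ "of_nat k"]) simp
qed

text \<open>The determinant conditions make both vectors primitive: \<open>k\<close> divides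
  \<open>det2 n m = 1\<close>.\<close>

lemma primitive_multiple_eq:
  assumes "det2 e g = 1" "det2 n m = 1" "n = (k * fst e, k * snd e)" "k \<ge> 0"
  shows "n = e"
proof -
  have "det2 n m = k * det2 e m" unfolding assms(3) det2_def by (simp add: algebra_simps)
  then have "k dvd 1" using assms(2) by (metis dvd_triv_left)
  then have "k = 1" using assms(4) by (simp add: zdvd1_eq)
  then show ?thesis using assms(3) by simp
qed

lemma ray_gen_eq:
  assumes "det2 e g = 1"
  shows "ray_gen (pos_hull {e}) = e"
  unfolding ray_gen_def
proof (rule the_equality)
  show eq: "{n. latt_pt n \<in> pos_hull {e}} = range (\<lambda>k::nat. (int k * fst e, int k * snd e))"
    unfolding latt_pt_single_iff[OF assms] by auto
  fix v assume v: "{n. latt_pt n \<in> pos_hull {e}} = range (\<lambda>k::nat. (int k * fst v, int k * snd v))"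
  have "v = (int 1 * fst v, int 1 * snd v)" by simp
  then have "v \<in> {n. latt_pt n \<in> pos_hull {e}}" unfolding v by (rule range_eqI)
  then obtain k :: nat where k: "v = (int k * fst e, int k * snd e)" unfolding eq by auto
  have "e \<in> {n. latt_pt n \<in> pos_hull {e}}" using latt_pt_self by simp
  then obtain j :: nat where j: "e = (int j * fst v, int j * snd v)" unfolding v by auto
  have "det2 e g = int j * det2 v g"
    by (subst j) (simp add: det2_def algebra_simps)
  then have "det2 v g dvd 1" "det2 v g \<noteq> 0" using assms by (metis dvd_triv_right, auto)
  moreover have "det2 v g = int k" using assms unfolding k det2_def by (simp add: algebra_simps)
  ultimately have "int k = 1" by simp
  then show "v = e" using k by simp
qed

text \<open>Expressing the unit vectors in the basis gives an integral inverse matrix, so the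
  determinant divides 1.\<close>

lemma lattice_basis_det:
  assumes "lattice_basis e f"
  shows "det2 e f = 1 \<or> det2 e f = - 1"
proof -
  have ex: "\<exists>a b. n = (a * fst e + b * fst f, a * snd e + b * snd f)" for n
  proof -
    have "\<exists>!p. (case p of (a, b) \<Rightarrow> n = (a * fst e + b * fst f, a * snd e + b * snd f))"
      using assms unfolding lattice_basis_def by blast
    then obtain p where "case p of (a, b) \<Rightarrow> n = (a * fst e + b * fst f, a * snd e + b * snd f)"
      by (rule ex1E)
    then show ?thesis by (cases p) auto
  qed
  obtain a b c d where "(1, 0) = (a * fst e + b * fst f, a * snd e + b * snd f)"
    "(0, 1) = (c * fst e + d * fst f, c * snd e + d * snd f)"
    using ex[of "(1, 0)"] ex[of "(0, 1)"] by blast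
  then have 1: "a * fst e + b * fst f = 1" "a * snd e + b * snd f = 0"
    "c * fst e + d * fst f = 0" "c * snd e + d * snd f = 1" by simp_all
  have "(a * d - b * c) * det2 e f =
      (a * fst e + b * fst f) * (c * snd e + d * snd f) - (a * snd e + b * snd f) * (c * fst e + d * fst f)"
    by (simp add: det2_def algebra_simps)
  then have "(a * d - b * c) * det2 e f = 1" unfolding 1 by simp
  then have "det2 e f dvd 1" by (metis dvd_triv_right)
  then show ?thesis by auto
qed

section \<open>From the fan to its cyclic sequence of rays\<close>

locale complete_smooth_fan =
  fixes \<Sigma> :: "(rat \<times> rat) set set"
  assumes complete: "complete_fan \<Sigma>" and smooth: "smooth_fan \<Sigma>"
begin

text \<open>A basis of determinant -1 is swapped, so full cones are always listed counterclockwise.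
  For a ray, \<open>g\<close> is the witness that \<open>e\<close> is primitive.\<close>

lemma cone_cases:
  assumes "\<sigma> \<in> \<Sigma>"
  obtains (zero) "\<sigma> = pos_hull {}"
    | (ray) e g where "det2 e g = 1" "\<sigma> = pos_hull {e}"
    | (full) e f where "det2 e f = 1" "\<sigma> = pos_hull {e, f}"
proof -
  obtain e f S where *: "lattice_basis e f" "S \<subseteq> {e, f}" "\<sigma> = pos_hull S"
    using smooth assms unfolding smooth_fan_def by blast
  have neg: "det2 x (- y) = - det2 x y" for x y by (simp add: det2_def)
  have unit: "\<exists>g. det2 x g = 1" if "det2 x y = 1 \<or> det2 x y = - 1" for x y
    using that neg[of x y] by fastforce
  have d: "det2 e f = 1 \<or> det2 e f = - 1" "det2 f e = 1 \<or> det2 f e = - 1"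
    using lattice_basis_det[OF *(1)] det2_swap[of e f] by auto
  consider "S = {}" | "S = {e}" | "S = {f}" | "S = {e, f}" using *(2) by blast
  then show ?thesis
  proof cases
    case 1 then show ?thesis using zero *(3) by simp
  next
    case 2 then show ?thesis using ray *(3) unit[OF d(1)] by blast
  next
    case 3 then show ?thesis using ray *(3) unit[OF d(2)] by blast
  next
    case 4
    then have "\<sigma> = pos_hull {e, f}" "\<sigma> = pos_hull {f, e}" using *(3) by (simp_all add: insert_commute)
    then show ?thesis using full d det2_swap[of e f] by fastforce
  qed
qed

lemma face_mem: "\<sigma> \<in> \<Sigma> \<Longrightarrow> face_of_cone \<tau> \<sigma> \<Longrightarrow> \<tau> \<in> \<Sigma>"
  using complete unfolding complete_fan_def fan_def by blast

lemma Int_face: "\<sigma> \<in> \<Sigma> \<Longrightarrow> \<tau> \<in> \<Sigma> \<Longrightarrow> face_of_cone (\<sigma> \<inter> \<tau>) \<sigma>"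
  using complete unfolding complete_fan_def fan_def by blast

text \<open>\<open>u\<close> is the supporting form that cuts the ray out of the cone.\<close>

lemma ray_of_cone:
  assumes cone: "pos_hull {e, f} \<in> \<Sigma>" and u: "lpair e u = 0" "lpair f u = 1"
  shows "pos_hull {e} \<in> \<Sigma>"
proof -
  have ef: "e \<noteq> f" using u by auto
  have dual: "u \<in> dual_monoid (pos_hull {e, f})" using u by (simp add: dual_monoid_pos_hull)
  have q: "qpair (a * of_int (fst e) + b * of_int (fst f), a * of_int (snd e) + b * of_int (snd f)) u = b" for a b
  proof -
    have "qpair (a * of_int (fst e) + b * of_int (fst f), a * of_int (snd e) + b * of_int (snd f)) u
      = a * of_int (lpair e u) + b * of_int (lpair f u)"
      by (simp add: qpair_def lpair_def algebra_simps)
    then show ?thesis using u by simp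
  qed
  have "pos_hull {e} = {w \<in> pos_hull {e, f}. qpair w u = 0}"
  proof (intro Set.set_eqI iffI)
    fix w assume "w \<in> pos_hull {e}"
    then obtain a where "a \<ge> 0" "w = (a * of_int (fst e) + 0 * of_int (fst f), a * of_int (snd e) + 0 * of_int (snd f))"
      unfolding pos_hull_single by auto
    then show "w \<in> {w \<in> pos_hull {e, f}. qpair w u = 0}"
      using q unfolding pos_hull_pair[OF ef] by blast
  next
    fix w assume "w \<in> {w \<in> pos_hull {e, f}. qpair w u = 0}"
    then obtain a b where *: "a \<ge> 0" "b \<ge> 0" "qpair w u = 0"
      "w = (a * of_int (fst e) + b * of_int (fst f), a * of_int (snd e) + b * of_int (snd f))"
      unfolding pos_hull_pair[OF ef] by blast
    then have "b = 0" using q by simp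
    then show "w \<in> pos_hull {e}" using * unfolding pos_hull_single by auto
  qed
  then show ?thesis using face_mem[OF cone] dual unfolding face_of_cone_def by blast
qed

lemma ray_of_full_cone:
  assumes "det2 e f = 1" "pos_hull {e, f} \<in> \<Sigma>"
  shows "pos_hull {e} \<in> \<Sigma>" "pos_hull {f} \<in> \<Sigma>"
proof -
  show "pos_hull {e} \<in> \<Sigma>"
    by (rule ray_of_cone[OF assms(2), of "(- snd e, fst e)"]) (use assms(1) in \<open>simp_all add: lpair_def det2_def algebra_simps\<close>)
  have "pos_hull {f, e} \<in> \<Sigma>" using assms(2) by (simp add: insert_commute)
  then show "pos_hull {f} \<in> \<Sigma>"
    by (rule ray_of_cone[of _ _ "(snd f, - fst f)"]) (use assms(1) in \<open>simp_all add: lpair_def det2_def algebra_simps\<close>)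
qed

lemma zero_of_ray:
  assumes "det2 e g = 1" "pos_hull {e} \<in> \<Sigma>"
  shows "pos_hull {} \<in> \<Sigma>"
proof -
  let ?u = "(snd g, - fst g)"
  have lu: "lpair n ?u = det2 n g" for n by (simp add: lpair_def det2_def)
  have dual: "?u \<in> dual_monoid (pos_hull {e})"
    using assms(1) by (simp add: dual_monoid_pos_hull lu)
  have q: "qpair (a * of_int (fst e), a * of_int (snd e)) ?u = a" for a
  proof -
    have "qpair (a * of_int (fst e), a * of_int (snd e)) ?u = a * of_int (det2 e g)"
      by (simp add: qpair_def det2_def algebra_simps)
    then show ?thesis using assms(1) by simp
  qed
  have "pos_hull {} = {w \<in> pos_hull {e}. qpair w ?u = 0}"
  proof (intro Set.set_eqI iffI)
    fix w assume "w \<in> pos_hull {}"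
    then have w: "w = (0 * of_int (fst e), 0 * of_int (snd e))" by (simp add: pos_hull_empty)
    then have "w \<in> pos_hull {e}" unfolding pos_hull_single by blast
    then show "w \<in> {w \<in> pos_hull {e}. qpair w ?u = 0}" using q[of 0] w by simp
  next
    fix w assume "w \<in> {w \<in> pos_hull {e}. qpair w ?u = 0}"
    then obtain a where *: "w = (a * of_int (fst e), a * of_int (snd e))" "qpair w ?u = 0"
      unfolding pos_hull_single by blast
    then have "a = 0" using q by simp
    then show "w \<in> pos_hull {}" using * by (simp add: pos_hull_empty)
  qed
  then show ?thesis using face_mem[OF assms(2)] dual unfolding face_of_cone_def by blast
qed

text \<open>The ray meets the cone in a face. If \<open>n\<close> were interior, the form supporting
  that face would vanish on both generators, which would then both lie on the ray of
  \<open>n\<close>.\<close>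

lemma ray_in_full_cone:
  assumes ef: "det2 e f = 1" "pos_hull {e, f} \<in> \<Sigma>" and n: "det2 n m = 1" "pos_hull {n} \<in> \<Sigma>"
    and mem: "latt_pt n \<in> pos_hull {e, f}"
  shows "n = e \<or> n = f"
proof -
  have ne: "e \<noteq> f" using ef(1) by auto
  define a b where "a = det2 n f" and "b = det2 e n"
  have ab: "a \<ge> 0" "b \<ge> 0" using mem unfolding latt_pt_pair_iff[OF ef(1)] by (auto simp: a_def b_def)
  have nn: "fst n = a * fst e + b * fst f" "snd n = a * snd e + b * snd f"
    using det2_expand[OF ef(1), of n] by (simp_all add: a_def b_def)
  obtain u where u: "u \<in> dual_monoid (pos_hull {e, f})"
    "pos_hull {e, f} \<inter> pos_hull {n} = {w \<in> pos_hull {e, f}. qpair w u = 0}"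
    using Int_face[OF ef(2) n(2)] unfolding face_of_cone_def by blast
  have lu: "lpair e u \<ge> 0" "lpair f u \<ge> 0" using u(1) by (simp_all add: dual_monoid_pos_hull)
  have "latt_pt n \<in> pos_hull {e, f} \<inter> pos_hull {n}" using mem latt_pt_self by blast
  then have "lpair n u = 0" unfolding u(2) by (simp add: qpair_latt_pt)
  moreover have "lpair n u = a * lpair e u + b * lpair f u" unfolding lpair_def nn by (simp add: algebra_simps)
  ultimately have sum0: "a * lpair e u = 0" "b * lpair f u = 0"
    using mult_nonneg_nonneg[OF ab(1) lu(1)] mult_nonneg_nonneg[OF ab(2) lu(2)] by linarith+
  have face: "det2 n x = 0" if x: "x = e \<or> x = f" "lpair x u = 0" for x
  proof -
    have "latt_pt x \<in> pos_hull {e, f}"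
      using x(1) ef(1) by (auto simp: latt_pt_pair_iff[OF ef(1)])
    then have "latt_pt x \<in> {w \<in> pos_hull {e, f}. qpair w u = 0}" using x(2) by (simp add: qpair_latt_pt)
    then have "latt_pt x \<in> pos_hull {n}" using u(2) by blast
    then show ?thesis by (rule latt_pt_single_det)
  qed
  show ?thesis
  proof (cases "a = 0 \<or> b = 0")
    case True
    then consider "b = 0" | "a = 0" by blast
    then show ?thesis
    proof cases
      case 1
      then have "n = (a * fst e, a * snd e)" using nn by (simp add: prod_eq_iff)
      then show ?thesis using primitive_multiple_eq[OF ef(1) n(1) _ ab(1)] by blast
    next
      case 2
      then have "n = (b * fst f, b * snd f)" using nn by (simp add: prod_eq_iff)
      moreover have "det2 f (- e) = 1" using ef(1) by (simp add: det2_def algebra_simps)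
      ultimately show ?thesis using primitive_multiple_eq[OF _ n(1) _ ab(2)] by blast
    qed
  next
    case False
    then have "lpair e u = 0" "lpair f u = 0" using sum0 by auto
    then have "a = 0" using face[of f] by (simp add: a_def)
    then show ?thesis using False by blast
  qed
qed

text \<open>Completeness is used through points just counterclockwise of \<open>e\<close>: one of
  the finitely many cones contains infinitely many of them, and in the limit it contains
  \<open>e\<close>.\<close>

lemma ccw_cone_exists:
  assumes e: "det2 e g = 1" "pos_hull {e} \<in> \<Sigma>"
  obtains f where "det2 e f = 1" "pos_hull {e, f} \<in> \<Sigma>"
proof -
  \<comment> \<open>The direction of \<open>w n\<close> tends to that of \<open>e\<close> from the
    counterclockwise side as \<open>n\<close> grows.\<close>
  define w where "w n = (int n * fst e + fst g, int n * snd e + snd g)" for n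
  have det: "det2 (w n) x = int n * det2 e x + det2 g x" "det2 x (w n) = int n * det2 x e + det2 x g" for n x
    by (simp_all add: w_def det2_def algebra_simps)
  have fin: "finite \<Sigma>" and cov: "\<Union>\<Sigma> = UNIV"
    using complete unfolding complete_fan_def fan_def by blast+
  have "\<forall>n. \<exists>\<sigma>. \<sigma> \<in> \<Sigma> \<and> latt_pt (w n) \<in> \<sigma>" using cov by blast
  then obtain c where c: "\<And>n. c n \<in> \<Sigma>" "\<And>n. latt_pt (w n) \<in> c n" by metis
  have "finite (range c)" using c(1) fin by (meson finite_subset image_subsetI)
  then obtain n0 where "infinite {n \<in> UNIV. c n = c n0}"
    using pigeonhole_infinite[of UNIV c] by blast
  then have inf: "infinite {n. c n = c n0}" by simp
  define \<sigma> where "\<sigma> = c n0"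
  have big: "\<exists>n>N. latt_pt (w n) \<in> \<sigma>" for N
  proof -
    obtain n where "n > N" "c n = c n0" using inf unfolding infinite_nat_iff_unbounded by blast
    then show ?thesis using c(2)[of n] unfolding \<sigma>_def by metis
  qed
  have "\<sigma> \<in> \<Sigma>" unfolding \<sigma>_def by (rule c(1))
  then show ?thesis
  proof (cases rule: cone_cases)
    case zero
    obtain n where "latt_pt (w n) \<in> \<sigma>" using big by blast
    then have "w n = (0, 0)" unfolding zero pos_hull_empty latt_pt_def by (simp add: prod_eq_iff)
    then have "det2 e (w n) = 0" by (simp add: det2_def)
    then show ?thesis using det(2)[of e n] e(1) by simp
  next
    case (ray p q)
    obtain n where n: "latt_pt (w n) \<in> \<sigma>" using big by blast
    obtain n' where n': "n' > n" "latt_pt (w n') \<in> \<sigma>" using big by blast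
    obtain k where k: "w n = (int k * fst p, int k * snd p)"
      using n unfolding ray(2) latt_pt_single_iff[OF ray(1)] by blast
    obtain k' where k': "w n' = (int k' * fst p, int k' * snd p)"
      using n'(2) unfolding ray(2) latt_pt_single_iff[OF ray(1)] by blast
    have "det2 (w n) (w n') = 0" unfolding k k' by (simp add: det2_def)
    moreover have "det2 (w n) (w n') = int n - int n'"
      unfolding det using e(1) det2_swap[of e g] by simp
    ultimately show ?thesis using n'(1) by simp
  next
    case (full p q)
    \<comment> \<open>A linear function of \<open>n\<close> that is nonnegative for arbitrarily
      large \<open>n\<close> has nonnegative slope. This carries the inequalities of the cone from
      \<open>w n\<close> over to \<open>e\<close>.\<close>
    have pos: "y \<ge> 0" if freq: "\<forall>N. \<exists>n>N. int n * y + z \<ge> 0" for y z :: int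
    proof (rule ccontr)
      assume "\<not> y \<ge> 0"
      then have y: "y \<le> - 1" by simp
      obtain n where n: "n > nat \<bar>z\<bar>" "int n * y + z \<ge> 0" using freq by blast
      have "int n * y \<le> int n * (- 1)" using y by (intro mult_left_mono) auto
      then show False using n by linarith
    qed
    have ge: "det2 (w n) q \<ge> 0 \<and> det2 p (w n) \<ge> 0" if "latt_pt (w n) \<in> \<sigma>" for n
      using that unfolding full(2) latt_pt_pair_iff[OF full(1)] by blast
    have "det2 e q \<ge> 0" by (rule pos[of _ "det2 g q"]) (use big ge in \<open>unfold det, blast\<close>)
    moreover have "det2 p e \<ge> 0" by (rule pos[of _ "det2 p g"]) (use big ge in \<open>unfold det, blast\<close>)
    ultimately have "latt_pt e \<in> pos_hull {p, q}" unfolding latt_pt_pair_iff[OF full(1)] by blast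
    then have "e = p \<or> e = q"
      using ray_in_full_cone[OF full(1) _ e] \<open>\<sigma> \<in> \<Sigma>\<close> full(2) by blast
    \<comment> \<open>The cone lies counterclockwise of \<open>e\<close>, because it contains some
      \<open>w n\<close>; hence \<open>e\<close> is its first generator.\<close>
    moreover have "e \<noteq> q"
    proof
      assume "e = q"
      obtain n where "latt_pt (w n) \<in> \<sigma>" using big by blast
      then have "det2 (w n) e \<ge> 0" using ge \<open>e = q\<close> by blast
      then show False using det(1)[of n e] e(1) det2_swap[of e g] by simp
    qed
    ultimately show ?thesis using that full \<open>\<sigma> \<in> \<Sigma>\<close> by blast
  qed
qed

lemma raysE:
  assumes "\<rho> \<in> rays \<Sigma>"
  obtains g where "det2 (ray_gen \<rho>) g = 1" "\<rho> = pos_hull {ray_gen \<rho>}" "\<rho> \<in> \<Sigma>"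
proof -
  obtain v where v: "\<rho> \<in> \<Sigma>" "v \<noteq> (0, 0)" "\<rho> = pos_hull {v}" using assms unfolding rays_def by blast
  from v(1) show ?thesis
  proof (cases rule: cone_cases)
    case zero
    then have "latt_pt v \<in> pos_hull {}" using latt_pt_self[of v] v(3) by simp
    then show ?thesis using v(2) by (simp add: pos_hull_empty latt_pt_def prod_eq_iff)
  next
    case (ray e g)
    then show ?thesis using that[of g] ray_gen_eq[OF ray(1)] v(1) by simp
  next
    case (full e f)
    have "latt_pt e \<in> pos_hull {v}" "latt_pt f \<in> pos_hull {v}"
      using full v(3) latt_pt_pair_iff[OF full(1)] by (auto simp: full(1))
    then obtain a b where a: "latt_pt e = (a * of_int (fst v), a * of_int (snd v))"
      and b: "latt_pt f = (b * of_int (fst v), b * of_int (snd v))"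
      unfolding pos_hull_single by blast
    have "of_int (det2 e f) = (0::rat)" using a b by (simp add: latt_pt_def det2_def)
    then show ?thesis using full(1) by simp
  qed
qed

lemma ray_mem_rays: "det2 e g = 1 \<Longrightarrow> pos_hull {e} \<in> \<Sigma> \<Longrightarrow> pos_hull {e} \<in> rays \<Sigma>"
  unfolding rays_def mem_Collect_eq by (intro conjI exI[of _ e]) (auto simp: det2_def)

lemma rays_nonempty: "rays \<Sigma> \<noteq> {}"
proof -
  have "\<Union>\<Sigma> = UNIV" using complete unfolding complete_fan_def by blast
  then obtain \<sigma> where s: "\<sigma> \<in> \<Sigma>" "latt_pt (1, 0) \<in> \<sigma>" by blast
  from s(1) show ?thesis
  proof (cases rule: cone_cases)
    case zero
    then show ?thesis using s(2) by (simp add: pos_hull_empty latt_pt_def)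
  next
    case (ray e g)
    then show ?thesis using ray_mem_rays s(1) by blast
  next
    case (full e f)
    moreover have "det2 e f = 1" by fact
    ultimately show ?thesis using ray_of_full_cone(1)[OF full(1)] ray_mem_rays s(1) by blast
  qed
qed

end

text \<open>The indices run over the natural numbers, periodically.\<close>

locale fan_cycle =
  fixes \<Sigma> :: "(rat \<times> rat) set set" and l :: nat and \<nu> :: "nat \<Rightarrow> latt"
  assumes periodic: "\<nu> i = \<nu> j \<longleftrightarrow> i mod l = j mod l"
    and det_Suc: "det2 (\<nu> i) (\<nu> (Suc i)) = 1"
    and cones: "\<Sigma> = insert (pos_hull {}) (range (\<lambda>i. pos_hull {\<nu> i}) \<union> range (\<lambda>i. pos_hull {\<nu> i, \<nu> (Suc i)}))"
    and no_ray: "det2 (\<nu> k) (\<nu> (Suc i)) \<ge> 0 \<Longrightarrow> det2 (\<nu> i) (\<nu> k) \<ge> 0 \<Longrightarrow> \<nu> k = \<nu> i \<or> \<nu> k = \<nu> (Suc i)"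
    and nonneg_ray: "\<exists>i. lpair (\<nu> i) u \<ge> 0"

context complete_smooth_fan
begin

text \<open>Otherwise the ray numbered after \<open>j\<close> would have its angle strictly between
  those of \<open>j\<close> and \<open>k\<close>, hence lie inside their cone, against
  \<open>ray_in_full_cone\<close>.\<close>

lemma next_ray:
  assumes num: "ccw_numbering \<Sigma> l \<rho>" and jk: "j < l" "k < l"
    and det: "det2 (ray_gen (\<rho> j)) (ray_gen (\<rho> k)) = 1"
    and cone: "pos_hull {ray_gen (\<rho> j), ray_gen (\<rho> k)} \<in> \<Sigma>"
  shows "k = Suc j mod l"
proof (rule ccontr)
  define n where "n i = ray_gen (\<rho> i)" for i
  obtain \<theta> r :: "nat \<Rightarrow> real" where bij: "bij_betw \<rho> {..<l} (rays \<Sigma>)" and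
    r: "\<And>i. i < l \<Longrightarrow> r i > 0 \<and> of_int (fst (n i)) = r i * cos (\<theta> i) \<and> of_int (snd (n i)) = r i * sin (\<theta> i)"
    and mono: "\<And>i j. i < j \<Longrightarrow> j < l \<Longrightarrow> \<theta> i < \<theta> j"
    and wrap: "\<And>i. i < l \<Longrightarrow> \<theta> i < \<theta> 0 + 2 * pi"
    using num unfolding ccw_numbering_def n_def by metis
  have ray: "\<rho> i = pos_hull {n i}" "\<rho> i \<in> \<Sigma>" "\<exists>g. det2 (n i) g = 1" if "i < l" for i
  proof -
    have "\<rho> i \<in> rays \<Sigma>" using bij that unfolding bij_betw_def by blast
    then show "\<rho> i = pos_hull {n i}" "\<rho> i \<in> \<Sigma>" "\<exists>g. det2 (n i) g = 1"
      unfolding n_def using raysE by blast+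
  qed
  have inj: "i = i'" if "i < l" "i' < l" "n i = n i'" for i i'
    using bij ray(1) that unfolding bij_betw_def inj_on_def by auto
  have sin: "of_int (det2 (n i) (n i')) = (r i * r i') * sin (\<theta> i' - \<theta> i)" if "i < l" "i' < l" for i i'
  proof -
    have "of_int (det2 (n i) (n i')) = of_int (fst (n i)) * of_int (snd (n i')) - of_int (snd (n i)) * (of_int (fst (n i')) :: real)"
      by (simp add: det2_def)
    also have "\<dots> = (r i * r i') * (sin (\<theta> i') * cos (\<theta> i) - cos (\<theta> i') * sin (\<theta> i))"
      using r[OF that(1)] r[OF that(2)] by (simp add: algebra_simps)
    finally show ?thesis by (simp add: sin_diff)
  qed
  have pos: "det2 (n i) (n i') > 0" if "i < l" "i' < l" "sin (\<theta> i' - \<theta> i) > 0" for i i'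
  proof -
    have "r i * r i' > 0" using r that by simp
    then have "(0::real) < of_int (det2 (n i) (n i'))" unfolding sin[OF that(1,2)] using that(3) by simp
    then show ?thesis by simp
  qed
  have sin_jk: "sin (\<theta> k - \<theta> j) > 0"
  proof -
    have "r j * r k > 0" using r jk by simp
    moreover have "(r j * r k) * sin (\<theta> k - \<theta> j) = 1" using sin[OF jk] det by (simp add: n_def)
    ultimately show ?thesis by (metis zero_less_mult_pos zero_less_one)
  qed
  assume no: "k \<noteq> Suc j mod l"
  define m where "m = Suc j mod l"
  have m: "m < l" "m \<noteq> k" using jk no by (auto simp: m_def)
  have kj: "k \<noteq> j" using det by auto
  \<comment> \<open>Within one turn a positive sine means less than half a turn; this is how
    \<open>det2\<close> being positive bounds the angle.\<close>
  have lt_pi: "x < pi" if "0 < x" "x < 2 * pi" "sin x > 0" for x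
    using that sin_le_zero[of x] by force
  have "sin (\<theta> m - \<theta> j) > 0 \<and> sin (\<theta> k - \<theta> m) > 0"
  proof (cases "Suc j < l")
    case True
    then have mj: "m = Suc j" by (simp add: m_def)
    have t1: "\<theta> j < \<theta> m" using mono[of j m] m(1) mj by simp
    show ?thesis
    proof (cases "j < k")
      case True
      then have "m < k" using mj m(2) by simp
      then have t2: "\<theta> m < \<theta> k" using mono jk by blast
      have "\<theta> 0 \<le> \<theta> j" using mono[of 0 j] jk by (cases "j = 0") auto
      then have "\<theta> k - \<theta> j < 2 * pi" using wrap[OF jk(2)] by simp
      then have "\<theta> k - \<theta> j < pi" using lt_pi[of "\<theta> k - \<theta> j"] t1 t2 sin_jk by simp
      then show ?thesis using t1 t2 by (auto intro!: sin_gt_zero)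
    next
      case False
      \<comment> \<open>Seen from \<open>j\<close>, the ray \<open>k\<close> comes only after the
        numbering has wrapped around, hence the added full turn.\<close>
      then have "\<theta> k < \<theta> j" using mono jk kj by simp
      moreover have "\<theta> 0 \<le> \<theta> k" using mono[of 0 k] jk by (cases "k = 0") auto
      moreover have s: "sin (\<theta> k + 2 * pi - \<theta> j) > 0" using sin_jk sin_periodic[of "\<theta> k - \<theta> j"] by (simp add: algebra_simps)
      ultimately have "\<theta> k + 2 * pi - \<theta> j < pi"
        using wrap[OF jk(1)] by (intro lt_pi) simp_all
      moreover have "\<theta> m < \<theta> k + 2 * pi" using wrap[OF m(1)] \<open>\<theta> 0 \<le> \<theta> k\<close> by simp
      ultimately have "sin (\<theta> m - \<theta> j) > 0" "sin (\<theta> k + 2 * pi - \<theta> m) > 0"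
        using t1 by (auto intro!: sin_gt_zero)
      then show ?thesis using sin_periodic[of "\<theta> k - \<theta> m"] by (simp add: algebra_simps)
    qed
  next
    case False
    then have j: "Suc j = l" using jk by simp
    then have m0: "m = 0" by (simp add: m_def)
    have k0: "0 < k" "k < j" using m(2) m0 kj jk j by auto
    have t: "\<theta> 0 < \<theta> k" "\<theta> k < \<theta> j" using mono[of 0 k] mono[of k j] k0 jk by auto
    have w: "\<theta> j < \<theta> 0 + 2 * pi" by (rule wrap[OF jk(1)])
    have s: "sin (\<theta> k + 2 * pi - \<theta> j) > 0" using sin_jk sin_periodic[of "\<theta> k - \<theta> j"] by (simp add: algebra_simps)
    have "\<theta> k + 2 * pi - \<theta> j < pi" by (rule lt_pi) (use t w s in simp_all)
    then have "sin (\<theta> 0 + 2 * pi - \<theta> j) > 0" "sin (\<theta> k - \<theta> 0) > 0"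
      using t w by (auto intro!: sin_gt_zero)
    then show ?thesis using sin_periodic[of "\<theta> 0 - \<theta> j"] unfolding m0 by (simp add: algebra_simps)
  qed
  then have d: "det2 (n j) (n m) > 0" "det2 (n m) (n k) > 0" using pos jk m by blast+
  then have mem: "latt_pt (n m) \<in> pos_hull {n j, n k}"
    using latt_pt_pair_iff[of "n j" "n k" "n m"] det by (simp add: n_def)
  obtain g where g: "det2 (n m) g = 1" using ray(3)[OF m(1)] by blast
  have "n m = n j \<or> n m = n k"
    by (rule ray_in_full_cone[OF _ _ g]) (use det cone ray[OF m(1)] mem in \<open>auto simp: n_def\<close>)
  then show False using d by auto
qed

lemma fan_cycle_ray_gen:
  assumes num: "ccw_numbering \<Sigma> l \<rho>"
  shows "0 < l" "fan_cycle \<Sigma> l (\<lambda>i. ray_gen (\<rho> (i mod l)))"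
proof -
  have bij: "bij_betw \<rho> {..<l} (rays \<Sigma>)" using num unfolding ccw_numbering_def by blast
  show l: "0 < l" using bij rays_nonempty unfolding bij_betw_def by auto
  define n where "n i = ray_gen (\<rho> i)" for i
  have ray: "\<rho> i = pos_hull {n i}" "pos_hull {n i} \<in> \<Sigma>" "\<exists>g. det2 (n i) g = 1" if "i < l" for i
  proof -
    have "\<rho> i \<in> rays \<Sigma>" using bij that unfolding bij_betw_def by blast
    then show "\<rho> i = pos_hull {n i}" "pos_hull {n i} \<in> \<Sigma>" "\<exists>g. det2 (n i) g = 1"
      unfolding n_def by (metis raysE)+
  qed
  have index: "\<exists>i<l. e = n i" if e: "det2 e g = 1" "pos_hull {e} \<in> \<Sigma>" for e g
  proof -
    have "pos_hull {e} \<in> \<rho> ` {..<l}" using ray_mem_rays[OF e] bij unfolding bij_betw_def by simp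
    then obtain i where "i < l" "\<rho> i = pos_hull {e}" by auto
    then show ?thesis using ray_gen_eq[OF e(1)] unfolding n_def by metis
  qed
  \<comment> \<open>The cone on the counterclockwise side of ray \<open>i\<close> exists by
    completeness, and the numbering has to place its other ray next.\<close>
  have nxt: "det2 (n i) (n (Suc i mod l)) = 1 \<and> pos_hull {n i, n (Suc i mod l)} \<in> \<Sigma>" if i: "i < l" for i
  proof -
    obtain g where g: "det2 (n i) g = 1" using ray(3)[OF i] by blast
    obtain f where f: "det2 (n i) f = 1" "pos_hull {n i, f} \<in> \<Sigma>" by (rule ccw_cone_exists[OF g ray(2)[OF i]])
    have "det2 f (- n i) = 1" using f(1) by (simp add: det2_def algebra_simps)
    then obtain k where k: "k < l" "f = n k" using index ray_of_full_cone(2)[OF f] by blast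
    have "k = Suc i mod l" using next_ray[OF num i k(1)] f k(2) unfolding n_def by blast
    then show ?thesis using f k(2) by simp
  qed
  have sucmod: "Suc i mod l = Suc (i mod l) mod l" for i by (simp add: mod_Suc_eq)
  show "fan_cycle \<Sigma> l (\<lambda>i. ray_gen (\<rho> (i mod l)))"
    unfolding n_def[symmetric]
  proof
    fix i j
    have "\<rho> (i mod l) = \<rho> (j mod l) \<Longrightarrow> i mod l = j mod l"
      using bij l unfolding bij_betw_def inj_on_def by simp
    then show "n (i mod l) = n (j mod l) \<longleftrightarrow> i mod l = j mod l"
      using ray(1)[of "i mod l"] ray(1)[of "j mod l"] l by auto
  next
    fix i
    show "det2 (n (i mod l)) (n (Suc i mod l)) = 1" using nxt[of "i mod l"] l sucmod by simp
  next
    show "\<Sigma> = insert (pos_hull {}) (range (\<lambda>i. pos_hull {n (i mod l)}) \<union>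
        range (\<lambda>i. pos_hull {n (i mod l), n (Suc i mod l)}))" (is "_ = ?R")
    proof (intro subset_antisym subsetI)
      fix \<sigma> assume \<sigma>: "\<sigma> \<in> \<Sigma>"
      then show "\<sigma> \<in> ?R"
      proof (cases rule: cone_cases)
        case zero then show ?thesis by simp
      next
        case (ray e g)
        then obtain i where "i < l" "e = n i" using index \<sigma> by blast
        then have "\<sigma> = pos_hull {n (i mod l)}" using ray(2) by simp
        then show ?thesis by blast
      next
        case (full e f)
        have ef: "pos_hull {e, f} \<in> \<Sigma>" using \<sigma> full(2) by simp
        have "det2 f (- e) = 1" using full(1) by (simp add: det2_def algebra_simps)
        then obtain k where k: "k < l" "f = n k" using index ray_of_full_cone(2)[OF full(1) ef] by blast
        obtain i where i: "i < l" "e = n i" using index[OF full(1)] ray_of_full_cone(1)[OF full(1) ef] by blast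
        have "k = Suc i mod l" using next_ray[OF num i(1) k(1)] full(1) ef i(2) k(2) unfolding n_def by blast
        then have "\<sigma> = pos_hull {n (i mod l), n (Suc i mod l)}" using full(2) i k by simp
        then show ?thesis by blast
      qed
    next
      fix \<sigma> assume "\<sigma> \<in> ?R"
      then consider "\<sigma> = pos_hull {}" | i where "\<sigma> = pos_hull {n (i mod l)}"
        | i where "\<sigma> = pos_hull {n (i mod l), n (Suc i mod l)}" by blast
      then show "\<sigma> \<in> \<Sigma>"
      proof cases
        case 1
        obtain g where "det2 (n 0) g = 1" using ray(3)[OF l] by blast
        then show ?thesis using zero_of_ray ray(2)[OF l] 1 by blast
      next
        case 2 then show ?thesis using ray(2) l by simp
      next
        case (3 i) then show ?thesis using nxt[of "i mod l"] l sucmod[of i] by simp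
      qed
    qed
  next
    fix k i
    assume *: "det2 (n (k mod l)) (n (Suc i mod l)) \<ge> 0" "det2 (n (i mod l)) (n (k mod l)) \<ge> 0"
    have kl: "k mod l < l" using l by simp
    obtain g where g: "det2 (n (k mod l)) g = 1" using ray(3)[OF kl] by blast
    have d: "det2 (n (i mod l)) (n (Suc i mod l)) = 1" "pos_hull {n (i mod l), n (Suc i mod l)} \<in> \<Sigma>"
      using nxt[of "i mod l"] l sucmod by simp_all
    show "n (k mod l) = n (i mod l) \<or> n (k mod l) = n (Suc i mod l)"
      by (rule ray_in_full_cone[OF d g ray(2)[OF kl]]) (use * latt_pt_pair_iff[OF d(1)] in blast)
  next
    fix u
    show "\<exists>i. lpair (n (i mod l)) u \<ge> 0"
    proof (rule ccontr)
      assume "\<not> ?thesis"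
      then have neg: "lpair (n i) u < 0" if "i < l" for i using that by (metis mod_less not_le)
      \<comment> \<open>Read as a point of N through its coordinates, \<open>u\<close> lies in some
        cone, so the positive number \<open>lpair u u\<close> would be a nonnegative combination of
        negative values.\<close>
      have "\<Union>\<Sigma> = UNIV" using complete unfolding complete_fan_def by blast
      then obtain \<sigma> where s: "\<sigma> \<in> \<Sigma>" "latt_pt u \<in> \<sigma>" by blast
      have u: "lpair u u \<ge> 0" by (simp add: lpair_def)
      have u0: "u \<noteq> (0, 0)" using neg[OF l] by (auto simp: lpair_def)
      then have u1: "lpair u u > 0" by (auto simp: lpair_def prod_eq_iff sum_squares_gt_zero_iff)
      from s(1) show False
      proof (cases rule: cone_cases)
        case zero
        then show ?thesis using s(2) u0 by (simp add: pos_hull_empty latt_pt_def prod_eq_iff)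
      next
        case (ray e g)
        obtain i where i: "i < l" "e = n i" using index ray s(1) by blast
        obtain k :: nat where "u = (int k * fst e, int k * snd e)"
          using s(2) unfolding ray(2) latt_pt_single_iff[OF ray(1)] by blast
        then have "lpair u u = int k * lpair e u" by (simp add: lpair_def algebra_simps)
        moreover have "int k * lpair e u \<le> 0" using neg[OF i(1)] i(2) by (intro mult_nonneg_nonpos) auto
        ultimately show ?thesis using u1 by simp
      next
        case (full e f)
        have ef: "pos_hull {e, f} \<in> \<Sigma>" using s(1) full(2) by simp
        have "det2 f (- e) = 1" using full(1) by (simp add: det2_def algebra_simps)
        then obtain k where k: "k < l" "f = n k" using index ray_of_full_cone(2)[OF full(1) ef] by blast
        obtain i where i: "i < l" "e = n i" using index[OF full(1)] ray_of_full_cone(1)[OF full(1) ef] by blast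
        have ge: "det2 u f \<ge> 0" "det2 e u \<ge> 0"
          using s(2) unfolding full(2) latt_pt_pair_iff[OF full(1)] by blast+
        have "lpair u u = det2 u f * lpair e u + det2 e u * lpair f u"
        proof -
          have "lpair u v = det2 u f * lpair e v + det2 e u * lpair f v" for v
            unfolding lpair_def
            by (subst (1) det2_expand(1)[OF full(1), of u], subst (1) det2_expand(2)[OF full(1), of u])
              (simp add: algebra_simps)
          then show ?thesis .
        qed
        moreover have "det2 u f * lpair e u \<le> 0" "det2 e u * lpair f u \<le> 0"
          using ge neg[OF i(1)] neg[OF k(1)] i(2) k(2) by (auto intro!: mult_nonneg_nonpos)
        ultimately show ?thesis using u1 by simp
      qed
    qed
  qed
qed

end

text \<open>Here \<open>(a, b)\<close> and \<open>(c, d)\<close> are the coordinates of the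
  generators of one cone in the basis given by another. The hypotheses exclude that a generator of
  either lies in the other; \<open>p\<close> and \<open>q\<close> are the values of a separating
  form on the basis.\<close>

lemma separating_weights:
  fixes a b c d :: int
  assumes "a * d - b * c = 1" "\<not> (a \<ge> 0 \<and> b \<ge> 0)" "\<not> (c \<ge> 0 \<and> d \<ge> 0)" "\<not> (d \<ge> 0 \<and> b \<le> 0)"
  obtains p q where "p > 0" "q > 0" "p * a + q * b < 0" "p * c + q * d < 0"
proof -
  consider "b < 0" "d < 0" | "a < 0" "c < 0" | "b \<ge> 0" "a < 0" "c \<ge> 0" "d < 0" using assms(2-4) by linarith
  then show ?thesis
  proof cases
    case 1
    let ?q = "\<bar>a\<bar> + \<bar>c\<bar> + 1"
    have "?q * b \<le> ?q * (- 1)" "?q * d \<le> ?q * (- 1)" using 1 by (intro mult_left_mono; simp)+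
    then have "1 * a + ?q * b < 0" "1 * c + ?q * d < 0" by simp_all linarith+
    then show ?thesis using that[of 1 ?q] by simp
  next
    case 2
    let ?q = "\<bar>b\<bar> + \<bar>d\<bar> + 1"
    have "?q * a \<le> ?q * (- 1)" "?q * c \<le> ?q * (- 1)" using 2 by (intro mult_left_mono; simp)+
    then have "?q * a + 1 * b < 0" "?q * c + 1 * d < 0" by simp_all linarith+
    then show ?thesis using that[of ?q 1] by simp
  next
    \<comment> \<open>The remaining position is solved by the form that takes the value -1 on both
      generators; the earlier cases put a large weight on a coordinate that is negative
      twice.\<close>
    case 3
    have "(b - d) * a + (c - a) * b = - (a * d - b * c)" "(b - d) * c + (c - a) * d = - (a * d - b * c)"
      by (simp_all add: algebra_simps)
    then show ?thesis using that[of "b - d" "c - a"] assms(1) 3 by simp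
  qed
qed

section \<open>Separation of maximal cones and sign changes of a degree\<close>

context fan_cycle
begin

definition S :: "nat \<Rightarrow> latt set" where
  "S i = {\<nu> i, \<nu> (Suc i)}"

lemma periodic_Suc: "\<nu> i = \<nu> j \<longleftrightarrow> \<nu> (Suc i) = \<nu> (Suc j)"
proof -
  have "i mod l = j mod l" if *: "Suc i mod l = Suc j mod l"
  proof (cases "l = 0")
    case True then show ?thesis using * by simp
  next
    case False
    then have "(Suc i + (l - 1)) mod l = (Suc j + (l - 1)) mod l" using * by (metis mod_add_left_eq)
    then show ?thesis using False by simp
  qed
  moreover have "Suc i mod l = Suc j mod l" if "i mod l = j mod l" using that by (metis mod_Suc_eq)
  ultimately show ?thesis unfolding periodic by blast
qed

text \<open>The dual basis of the generators of a maximal cone.\<close>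

definition w1 :: "nat \<Rightarrow> latt" where "w1 i = (snd (\<nu> (Suc i)), - fst (\<nu> (Suc i)))"
definition w2 :: "nat \<Rightarrow> latt" where "w2 i = (- snd (\<nu> i), fst (\<nu> i))"

lemma lpair_w: "lpair n (w1 i) = det2 n (\<nu> (Suc i))" "lpair n (w2 i) = det2 (\<nu> i) n"
  by (simp_all add: w1_def w2_def lpair_def det2_def)

lemma lpair_w_simps [simp]: "lpair (\<nu> i) (w1 i) = 1" "lpair (\<nu> (Suc i)) (w1 i) = 0"
  "lpair (\<nu> i) (w2 i) = 0" "lpair (\<nu> (Suc i)) (w2 i) = 1"
  by (simp_all add: lpair_w det_Suc)

text \<open>For adjacent cones a dual basis vector vanishing on the shared ray separates; otherwise
  \<open>separating_weights\<close> applies. Strictness off the common rays is what makes the charts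
  glue along the chart of the common face.\<close>

lemma separation:
  assumes "\<nu> i \<noteq> \<nu> j"
  obtains m where "\<And>n. n \<in> S i \<Longrightarrow> lpair n m \<ge> 0" "\<And>n. n \<in> S i \<Longrightarrow> n \<notin> S j \<Longrightarrow> lpair n m > 0"
    "\<And>n. n \<in> S j \<Longrightarrow> lpair n m \<le> 0" "\<And>n. n \<in> S j \<Longrightarrow> n \<notin> S i \<Longrightarrow> lpair n m < 0"
proof -
  consider "\<nu> (Suc i) = \<nu> j" | "\<nu> (Suc j) = \<nu> i" | "\<nu> (Suc i) \<noteq> \<nu> j" "\<nu> (Suc j) \<noteq> \<nu> i" by blast
  then show ?thesis
  proof cases
    case 1
    show ?thesis
      by (rule that[of "w1 i"]) (auto simp: S_def lpair_w 1 det_Suc det2_swap[of "\<nu> (Suc j)" "\<nu> j"]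
          det_Suc[of i, unfolded 1])
  next
    case 2
    show ?thesis
      by (rule that[of "w2 i"]) (auto simp: S_def lpair_w 2 det_Suc det2_swap[of "\<nu> i" "\<nu> j"]
          det_Suc[of j, unfolded 2])
  next
    case 3
    define a b c d where "a = det2 (\<nu> j) (\<nu> (Suc i))" and "b = det2 (\<nu> i) (\<nu> j)"
      and "c = det2 (\<nu> (Suc j)) (\<nu> (Suc i))" and "d = det2 (\<nu> i) (\<nu> (Suc j))"
    have ne: "\<nu> (Suc i) \<noteq> \<nu> (Suc j)" using assms periodic_Suc by blast
    have "a * d - b * c = det2 (\<nu> i) (\<nu> (Suc i)) * det2 (\<nu> j) (\<nu> (Suc j))"
      unfolding a_def b_def c_def d_def det2_def by (simp add: algebra_simps)
    then have det: "a * d - b * c = 1" by (simp add: det_Suc)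
    have n1: "\<not> (a \<ge> 0 \<and> b \<ge> 0)" using no_ray[of j i] assms 3 unfolding a_def b_def by auto
    have n2: "\<not> (c \<ge> 0 \<and> d \<ge> 0)" using no_ray[of "Suc j" i] ne 3 unfolding c_def d_def by auto
    have n3: "\<not> (d \<ge> 0 \<and> b \<le> 0)"
      using no_ray[of i j] assms 3 det2_swap[of "\<nu> j" "\<nu> i"] unfolding b_def d_def by auto
    obtain p q where pq: "p > 0" "q > 0" "p * a + q * b < 0" "p * c + q * d < 0"
      using separating_weights[OF det n1 n2 n3] .
    let ?m = "(p * fst (w1 i), p * snd (w1 i)) + (q * fst (w2 i), q * snd (w2 i))"
    have m: "lpair n ?m = p * det2 n (\<nu> (Suc i)) + q * det2 (\<nu> i) n" for n
      unfolding lpair_w[symmetric] by (simp only: lpair_simps prod.collapse)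
    have "lpair (\<nu> i) ?m > 0" "lpair (\<nu> (Suc i)) ?m > 0" "lpair (\<nu> j) ?m < 0" "lpair (\<nu> (Suc j)) ?m < 0"
      unfolding m using pq det_Suc[of i] by (simp_all add: a_def b_def c_def d_def)
    then show ?thesis by (intro that[of ?m]) (auto simp: S_def)
  qed
qed

text \<open>A form separating the two cones would be both nonnegative and nonpositive on the rotated
  vector, hence zero there. As the coefficients at \<open>\<nu> i\<close> and \<open>\<nu> j\<close>
  are positive, these rays would belong to both cones.\<close>

lemma sign_change_unique:
  assumes "lpair (\<nu> i) u \<ge> 0" "lpair (\<nu> (Suc i)) u < 0" "lpair (\<nu> j) u \<ge> 0" "lpair (\<nu> (Suc j)) u < 0"
  shows "\<nu> i = \<nu> j"
proof (rule ccontr)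
  assume ne: "\<nu> i \<noteq> \<nu> j"
  obtain m where m: "\<And>n. n \<in> S i \<Longrightarrow> lpair n m \<ge> 0" "\<And>n. n \<in> S i \<Longrightarrow> n \<notin> S j \<Longrightarrow> lpair n m > 0"
    "\<And>n. n \<in> S j \<Longrightarrow> lpair n m \<le> 0" "\<And>n. n \<in> S j \<Longrightarrow> n \<notin> S i \<Longrightarrow> lpair n m < 0"
    using separation[OF ne] by metis
  \<comment> \<open>The rotation of u by a right angle lies in both cones.\<close>
  have rot: "- lpair (\<nu> k) u * lpair (\<nu> (Suc k)) m + lpair (\<nu> (Suc k)) u * lpair (\<nu> k) m =
      lpair (snd u, - fst u) m" for k
  proof -
    have "- lpair (\<nu> k) u * lpair (\<nu> (Suc k)) m + lpair (\<nu> (Suc k)) u * lpair (\<nu> k) m =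
      det2 (\<nu> k) (\<nu> (Suc k)) * lpair (snd u, - fst u) m"
      unfolding lpair_def det2_def by (simp add: algebra_simps)
    then show ?thesis by (simp add: det_Suc)
  qed
  have in_S: "\<nu> k \<in> S k" "\<nu> (Suc k) \<in> S k" for k by (simp_all add: S_def)
  have i: "lpair (\<nu> i) u * lpair (\<nu> (Suc i)) m \<ge> 0" "lpair (\<nu> (Suc i)) u * lpair (\<nu> i) m \<le> 0"
    using m(1)[OF in_S(1)[of i]] m(1)[OF in_S(2)[of i]] assms(1,2) by (simp_all add: mult_nonpos_nonneg)
  have j: "lpair (\<nu> j) u * lpair (\<nu> (Suc j)) m \<le> 0" "lpair (\<nu> (Suc j)) u * lpair (\<nu> j) m \<ge> 0"
    using m(3)[OF in_S(1)[of j]] m(3)[OF in_S(2)[of j]] assms(3,4)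
    by (simp_all add: mult_nonneg_nonpos mult_nonpos_nonpos)
  have "lpair (\<nu> (Suc i)) u * lpair (\<nu> i) m = 0" "lpair (\<nu> (Suc j)) u * lpair (\<nu> j) m = 0"
    using rot[of i] rot[of j] i j by linarith+
  then have "lpair (\<nu> i) m = 0" "lpair (\<nu> j) m = 0" using assms(2,4) by simp_all
  then have "\<nu> i \<in> S j" "\<nu> j \<in> S i" using m(2)[OF in_S(1)[of i]] m(4)[OF in_S(1)[of j]] by auto
  then have "\<nu> i = \<nu> (Suc j)" using ne by (auto simp: S_def)
  then show False using assms(1,4) by simp
qed

text \<open>Supplies the ray at which the numbering will start. If u never drops below zero, any
  nonnegative ray will do.\<close>

lemma start_index:
  obtains s where "lpair (\<nu> s) u \<ge> 0"
    "\<And>i. lpair (\<nu> i) u \<ge> 0 \<Longrightarrow> lpair (\<nu> (Suc i)) u < 0 \<Longrightarrow> \<nu> i = \<nu> s"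
proof (cases "\<exists>i. lpair (\<nu> i) u \<ge> 0 \<and> lpair (\<nu> (Suc i)) u < 0")
  case True
  then obtain s where s: "lpair (\<nu> s) u \<ge> 0" "lpair (\<nu> (Suc s)) u < 0" by blast
  then show ?thesis using that[OF s(1)] sign_change_unique[OF _ _ s] by blast
next
  case False
  then show ?thesis using that nonneg_ray[of u] by blast
qed

lemma shift: "fan_cycle \<Sigma> l (\<lambda>i. \<nu> (i + s))" if l: "0 < l"
proof -
  have shiftback: "\<exists>k. \<nu> j = \<nu> (k + s) \<and> \<nu> (Suc j) = \<nu> (Suc (k + s))" for j
  proof -
    have "(j + (l - s mod l) + s) mod l = (j + (l - s mod l) + s mod l) mod l" by (simp add: mod_add_right_eq)
    also have "j + (l - s mod l) + s mod l = j + l" using mod_less_divisor[OF l, of s] by linarith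
    finally have "\<nu> (j + (l - s mod l) + s) = \<nu> j" unfolding periodic by simp
    then show ?thesis using periodic_Suc by metis
  qed
  have modeq: "(i + s) mod l = (j + s) mod l \<longleftrightarrow> i mod l = j mod l" for i j
  proof -
    have "\<nu> (i + s) = \<nu> (j + s) \<longleftrightarrow> \<nu> i = \<nu> j"
      by (induction s) (use periodic_Suc in auto)
    then show ?thesis unfolding periodic .
  qed
  show ?thesis
  proof
    fix i j show "\<nu> (i + s) = \<nu> (j + s) \<longleftrightarrow> i mod l = j mod l" unfolding periodic by (rule modeq)
  next
    fix i show "det2 (\<nu> (i + s)) (\<nu> (Suc i + s)) = 1" using det_Suc[of "i + s"] by simp
  next
    have "range (\<lambda>i. pos_hull {\<nu> (i + s)}) = range (\<lambda>i. pos_hull {\<nu> i})"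
      "range (\<lambda>i. pos_hull {\<nu> (i + s), \<nu> (Suc i + s)}) = range (\<lambda>i. pos_hull {\<nu> i, \<nu> (Suc i)})"
      using shiftback by (auto simp: image_def) metis+
    then show "\<Sigma> = insert (pos_hull {}) (range (\<lambda>i. pos_hull {\<nu> (i + s)}) \<union> range (\<lambda>i. pos_hull {\<nu> (i + s), \<nu> (Suc i + s)}))"
      using cones by simp
  next
    fix k i assume "det2 (\<nu> (k + s)) (\<nu> (Suc i + s)) \<ge> 0" "det2 (\<nu> (i + s)) (\<nu> (k + s)) \<ge> 0"
    then show "\<nu> (k + s) = \<nu> (i + s) \<or> \<nu> (k + s) = \<nu> (Suc i + s)" using no_ray[of "k + s" "i + s"] by simp
  next
    fix u
    obtain i where "lpair (\<nu> i) u \<ge> 0" using nonneg_ray by blast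
    then show "\<exists>i. lpair (\<nu> (i + s)) u \<ge> 0" using shiftback[of i] by metis
  qed
qed

end

section \<open>Charts of the toric surface\<close>

definition dual :: "latt set \<Rightarrow> latt set" where
  "dual T = {u. \<forall>n\<in>T. 0 \<le> lpair n u}"

definition chart :: "latt set \<Rightarrow> ratfun set" where
  "chart T = lspan (dual T)"

lemma dual_add: "u \<in> dual T \<Longrightarrow> v \<in> dual T \<Longrightarrow> u + v \<in> dual T"
  by (auto simp: dual_def lpair_simps)

lemma dual_0 [simp]: "0 \<in> dual T"
  by (simp add: dual_def lpair_simps)

lemma dual_mono: "T \<subseteq> T' \<Longrightarrow> dual T' \<subseteq> dual T"
  by (auto simp: dual_def)

lemma chart_mono: "T \<subseteq> T' \<Longrightarrow> chart T' \<subseteq> chart T"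
  unfolding chart_def by (intro lspan_mono dual_mono)

lemma chart_ring_pos_hull: "finite T \<Longrightarrow> chart_ring (pos_hull T) = chart T"
  unfolding chart_ring_lspan chart_def dual_def by (simp add: dual_monoid_pos_hull)

lemma lspan_subring:
  assumes "0 \<in> T" "\<And>u v. u \<in> T \<Longrightarrow> v \<in> T \<Longrightarrow> u + v \<in> T"
  shows "is_subring (lspan T)"
  unfolding is_subring_def
  using lspan_chi[OF assms(1)] lspan_diff lspan_mult[of _ T _ T T] assms(2) by (auto simp: chi_0)

lemma chart_subring: "is_subring (chart T)"
  unfolding chart_def by (rule lspan_subring) (auto intro: dual_add)

lemma chart_ring_subring: "is_subring (chart_ring \<sigma>)"
  unfolding chart_ring_lspan
proof (rule lspan_subring)
  show "0 \<in> dual_monoid \<sigma>" by (simp add: dual_monoid_def qpair_def)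
  fix u v assume "u \<in> dual_monoid \<sigma>" "v \<in> dual_monoid \<sigma>"
  moreover have "qpair w (u + v) = qpair w u + qpair w v" for w by (simp add: qpair_def algebra_simps)
  ultimately show "u + v \<in> dual_monoid \<sigma>" by (simp add: dual_monoid_def)
qed

lemma chi_mem_chart: "u \<in> dual T \<Longrightarrow> chi u \<in> chart T"
  unfolding chart_def by (rule lspan_chi)

lemma rconst_mem_chart: "rconst c \<in> chart T"
  using lspan_term[of 0 "dual T" c] by (simp add: chart_def)

definition scale :: "nat \<Rightarrow> latt \<Rightarrow> latt" where
  "scale k u = (int k * fst u, int k * snd u)"

lemma scale_simps: "scale 0 u = 0" "scale (Suc k) u = u + scale k u"
  "lpair n (scale k u) = int k * lpair n u" "scale (j + k) u = scale j u + scale k u"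
  by (simp_all add: scale_def lpair_def algebra_simps zero_prod_def plus_prod_def)

lemma chi_scale: "chi (scale k u) = chi u ^ k"
  by (induction k) (simp_all add: scale_simps chi_add)

lemma scale_closed:
  assumes "0 \<in> M" "\<And>u v. u \<in> M \<Longrightarrow> v \<in> M \<Longrightarrow> u + v \<in> M" "u \<in> M"
  shows "scale k u \<in> M"
  by (induction k) (simp_all add: scale_simps assms)

text \<open>\<open>chi m\<close> vanishes along the divisors of the rays in \<open>T'\<close> that
  are missing from \<open>T\<close>, so its powers cancel the poles of \<open>b\<close>
  there.\<close>

lemma extend_to_chart:
  assumes T': "finite T'" and m: "\<And>n. n \<in> T' \<Longrightarrow> lpair n m \<ge> 0" "\<And>n. n \<in> T' \<Longrightarrow> n \<notin> T \<Longrightarrow> lpair n m > 0"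
    and b: "b \<in> chart T"
  obtains N where "chi m ^ N * b \<in> chart T'"
proof -
  have mT: "chi m ^ k \<in> chart T'" for k
    using m(1) by (intro is_subring_power[OF chart_subring] chi_mem_chart) (simp add: dual_def)
  from b have "\<exists>N. chi m ^ N * b \<in> chart T'"
    unfolding chart_def
  proof (induction rule: lspan_induct)
    case zero
    show ?case by (intro exI[of _ 0]) simp
  next
    case (monom c v)
    \<comment> \<open>At least the pole order of the monomial along every ray of
      \<open>T'\<close>.\<close>
    define N where "N = (\<Sum>n\<in>T'. nat \<bar>lpair n v\<bar>)"
    have "scale N m + v \<in> dual T'"
      unfolding dual_def mem_Collect_eq
    proof
      fix n assume n: "n \<in> T'"
      show "0 \<le> lpair n (scale N m + v)"
      proof (cases "n \<in> T")
        case True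
        then show ?thesis using monom m(1)[OF n] by (simp add: scale_simps lpair_simps dual_def)
      next
        case False
        have "nat \<bar>lpair n v\<bar> \<le> N" unfolding N_def by (rule member_le_sum[OF n _ T']) simp
        then have "\<bar>lpair n v\<bar> \<le> int N * 1" by simp
        also have "\<dots> \<le> int N * lpair n m" using m(2)[OF n False] by (intro mult_left_mono) auto
        finally show ?thesis by (simp add: scale_simps lpair_simps)
      qed
    qed
    then have "rconst c * chi (scale N m + v) \<in> lspan (dual T')" by (rule lspan_term)
    then show ?case by (intro exI[of _ N]) (simp add: chi_add chi_scale mult_ac)
  next
    case (add f g)
    then obtain N N' where N: "chi m ^ N * f \<in> lspan (dual T')" "chi m ^ N' * g \<in> lspan (dual T')" by blast
    have "chi m ^ N' * (chi m ^ N * f) + chi m ^ N * (chi m ^ N' * g) \<in> chart T'"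
      using N unfolding chart_def[symmetric]
      by (rule is_subring_add[OF chart_subring is_subring_mult[OF chart_subring mT] is_subring_mult[OF chart_subring mT]])
    then show ?case unfolding chart_def
      by (intro exI[of _ "N' + N"]) (simp add: power_add algebra_simps)
  qed
  then show ?thesis using that by blast
qed

lemma lspan_Int:
  assumes "f \<in> lspan A" "f \<in> lspan B"
  shows "f \<in> lspan (A \<inter> B)"
proof -
  have "f \<in> lspan ((A \<inter> B) \<union> (A - B))" by (rule lspan_monoD[OF assms(1)]) blast
  then obtain g h where gh: "g \<in> lspan (A \<inter> B)" "h \<in> lspan (A - B)" "f = g + h" by (rule lspan_union)
  have "g \<in> lspan B" by (rule lspan_monoD[OF gh(1)]) blast
  then have "f - g \<in> lspan B" by (rule lspan_diff[OF assms(2)])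
  then have "h \<in> lspan B" using gh(3) by simp
  then have "h = 0" by (rule lspan_disjoint[OF gh(2)]) blast
  then show ?thesis using gh by simp
qed

text \<open>The prime ideal of the generic point of the smallest torus orbit of the chart.\<close>

definition orbit_ideal :: "latt set \<Rightarrow> ratfun set" where
  "orbit_ideal T = lspan {u \<in> dual T. \<exists>n\<in>T. lpair n u > 0}"

text \<open>Modulo this ideal only exponents in \<open>F\<close>, orthogonal to all rays of
  \<open>T\<close>, survive, and \<open>F\<close> is closed under addition. So the quotient is a
  ring of Laurent polynomials, a domain.\<close>

lemma orbit_ideal_prime: "is_prime (chart T) (orbit_ideal T)"
proof -
  define F where "F = {u. \<forall>n\<in>T. lpair n u = 0}"
  define H where "H = {u \<in> dual T. \<exists>n\<in>T. lpair n u > 0}"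
  have dual: "dual T = F \<union> H" unfolding dual_def F_def H_def by force
  have disj: "F \<inter> H = {}" unfolding F_def H_def by force
  have FF: "u + v \<in> F" if "u \<in> F" "v \<in> F" for u v using that by (simp add: F_def lpair_simps)
  have TH: "u + v \<in> H" if u: "u \<in> dual T" and v: "v \<in> H" for u v
  proof -
    obtain n where n: "n \<in> T" "lpair n v > 0" using v unfolding H_def by blast
    then have "lpair n (u + v) > 0" using u by (simp add: dual_def lpair_simps add_nonneg_pos)
    then show ?thesis using n u v unfolding H_def by (auto intro: dual_add)
  qed
  have P: "orbit_ideal T = lspan H" unfolding orbit_ideal_def H_def ..
  have ideal: "is_ideal (chart T) (lspan H)"
    unfolding is_ideal_def
  proof (intro conjI ballI)
    show "lspan H \<subseteq> chart T" unfolding chart_def by (rule lspan_mono) (simp add: dual)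
    fix a b assume "a \<in> chart T" "b \<in> lspan H"
    then show "a * b \<in> lspan H" unfolding chart_def using lspan_mult[OF _ _ TH] by blast
  qed (auto intro: lspan_add)
  have split: "\<exists>g h. g \<in> lspan F \<and> h \<in> lspan H \<and> f = g + h" if "f \<in> chart T" for f
  proof -
    have "f \<in> lspan (F \<union> H)" using that unfolding chart_def dual .
    then show ?thesis by (rule lspan_union) blast
  qed
  show ?thesis
    unfolding P is_prime_def
  proof (intro conjI ballI impI ideal)
    have "(0::latt) \<notin> H" by (simp add: H_def lpair_simps)
    then show "1 \<notin> lspan H" using chi_mem_lspan_iff[of 0 H] by simp
  next
    fix a b assume a: "a \<in> chart T" and b: "b \<in> chart T" and ab: "a * b \<in> lspan H"
    obtain g h where gh: "g \<in> lspan F" "h \<in> lspan H" "a = g + h" using split[OF a] by blast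
    obtain g' h' where gh': "g' \<in> lspan F" "h' \<in> lspan H" "b = g' + h'" using split[OF b] by blast
    have gc: "g \<in> chart T"
      unfolding chart_def by (rule lspan_monoD[OF gh(1)]) (simp add: dual)
    have "b * h \<in> lspan H" "g * h' \<in> lspan H" using ideal b gc gh(2) gh'(2) unfolding is_ideal_def by blast+
    then have "a * b - (b * h + g * h') \<in> lspan H" using ab by (intro lspan_diff lspan_add)
    moreover have "a * b - (b * h + g * h') = g * g'" unfolding gh(3) gh'(3) by (simp add: algebra_simps)
    ultimately have "g * g' \<in> lspan H" by simp
    moreover have "g * g' \<in> lspan F" by (rule lspan_mult[OF gh(1) gh'(1)]) (rule FF)
    ultimately have "g * g' = 0" using lspan_disjoint disj by blast
    then have "g = 0 \<or> g' = 0" by simp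
    then show "a \<in> lspan H \<or> b \<in> lspan H" using gh gh' by auto
  qed
qed

text \<open>The order of \<open>chi m\<close> along the divisor is \<open>lpair n m\<close>. A
  denominator \<open>s\<close> outside the prime has a nonzero part \<open>g\<close> of order 0, so
  \<open>chi m * s\<close> keeps a term of that order.\<close>

lemma chi_mem_divisor_ring:
  assumes "chi m \<in> localization (chart {n}) (orbit_ideal {n})"
  shows "lpair n m \<ge> 0"
proof (rule ccontr)
  assume neg: "\<not> lpair n m \<ge> 0"
  define F where "F = {u. lpair n u = 0}"
  define H where "H = {u. lpair n u > 0}"
  have D: "dual {n} = F \<union> H" unfolding dual_def F_def H_def by force
  have P: "orbit_ideal {n} = lspan H" unfolding orbit_ideal_def H_def dual_def by (rule arg_cong[of _ _ lspan]) auto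
  obtain s where s: "s \<in> chart {n}" "s \<notin> lspan H" "s * chi m \<in> chart {n}"
    using assms[unfolded localization_iff[OF orbit_ideal_prime]] unfolding P by blast
  have "s \<in> lspan (F \<union> H)" using s(1) unfolding chart_def D .
  then obtain g h where gh: "g \<in> lspan F" "h \<in> lspan H" "s = g + h" by (rule lspan_union)
  let ?K = "{u. lpair n u > lpair n m}"
  have "chi m * s \<in> lspan ?K"
    by (rule lspan_monoD[of _ "dual {n}"]) (use s(3) neg in \<open>auto simp: chart_def dual_def mult.commute\<close>)
  moreover have "chi m * h \<in> lspan ?K"
    by (rule lspan_term_mult[OF gh(2)]) (simp add: H_def lpair_simps)
  ultimately have "chi m * s - chi m * h \<in> lspan ?K" by (rule lspan_diff)
  then have "chi m * g \<in> lspan ?K" unfolding gh(3) by (simp add: algebra_simps)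
  moreover have "chi m * g \<in> lspan {u. lpair n u = lpair n m}"
    by (rule lspan_term_mult[OF gh(1)]) (simp add: F_def lpair_simps)
  ultimately have "chi m * g = 0" by (rule lspan_disjoint) auto
  then have "s = h" using gh(3) by simp
  then show False using gh(2) s(2) by simp
qed

text \<open>By the quotient rule, regularity at a point needs testing on the chart ring
  only.\<close>

lemma tstalk_localI:
  assumes A: "is_subring A" and x: "x \<in> loc_points A" and D: "derivation D" "\<And>a. a \<in> A \<Longrightarrow> D a \<in> x"
  shows "D \<in> tstalk x"
proof (rule tstalkI[OF D(1)])
  fix g assume g: "g \<in> x"
  obtain P where P: "is_prime A P" "x = localization A P" by (rule loc_pointsE[OF x])
  obtain s where s: "s \<in> A" "s \<notin> P" "s \<noteq> 0" "s * g \<in> A"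
    using g unfolding P(2) localization_iff[OF P(1)] by blast
  have inv: "inverse s \<in> x" using localization_unit_iff[OF A P(1) s(1)] s(2) P(2) by blast
  note sub = loc_points_subring[OF A x]
  have "D g = inverse s * (D (s * g) - g * D s)"
    using s(3) by (simp add: derivation_times[OF D(1)])
  moreover have "inverse s * (D (s * g) - g * D s) \<in> x"
    by (rule is_subring_mult[OF sub inv is_subring_diff[OF sub D(2)[OF s(4)] is_subring_mult[OF sub g D(2)[OF s(1)]]]])
  ultimately show "D g \<in> x" by simp
qed

lemma TV_points_subring:
  assumes "x \<in> TV_points \<Sigma>"
  shows "is_subring x"
proof -
  obtain \<sigma> P where "x = localization (chart_ring \<sigma>) P" "P \<in> Spec (chart_ring \<sigma>)"
    using assms unfolding TV_points_def by blast
  then show ?thesis using localization_subring[OF chart_ring_subring] Spec_iff[OF chart_ring_subring] by blast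
qed

text \<open>The domain of a rational function: on each chart it is the complement of the zero locus
  of its ideal of denominators.\<close>

lemma openin_TV_contains: "openin (TV \<Sigma>) {x \<in> TV_points \<Sigma>. g \<in> x}"
  unfolding openin_TV TV_open_def
proof (intro conjI ballI)
  fix \<sigma> assume \<sigma>: "\<sigma> \<in> \<Sigma>"
  let ?A = "chart_ring \<sigma>" and ?I = "{a \<in> chart_ring \<sigma>. a * g \<in> chart_ring \<sigma>}"
  have eq: "P \<in> Spec ?A \<and> localization ?A P \<in> {x \<in> TV_points \<Sigma>. g \<in> x} \<longleftrightarrow> P \<in> Spec ?A \<and> \<not> ?I \<subseteq> P" for P
  proof (cases "P \<in> Spec ?A")
    case True
    then have P: "is_prime ?A P" using Spec_iff[OF chart_ring_subring] by blast
    have "localization ?A P \<in> TV_points \<Sigma>" using True \<sigma> unfolding TV_points_def by blast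
    moreover have "g \<in> localization ?A P \<longleftrightarrow> \<not> ?I \<subseteq> P"
      unfolding localization_iff[OF P]
    proof
      assume "\<not> ?I \<subseteq> P"
      then obtain s where s: "s \<in> ?A" "s * g \<in> ?A" "s \<notin> P" by blast
      moreover have "s \<noteq> 0" using s(3) prime_mem_0[OF P] by metis
      ultimately show "\<exists>s\<in>?A - P. s \<noteq> 0 \<and> s * g \<in> ?A" by blast
    qed blast
    ultimately show ?thesis using True by blast
  qed simp
  have "{P \<in> Spec ?A. localization ?A P \<in> {x \<in> TV_points \<Sigma>. g \<in> x}} = {P \<in> Spec ?A. \<not> ?I \<subseteq> P}"
    by (rule Collect_cong) (rule eq)
  moreover have "?I \<subseteq> ?A" by blast
  ultimately show "Spec_open ?A {P \<in> Spec ?A. localization ?A P \<in> {x \<in> TV_points \<Sigma>. g \<in> x}}"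
    unfolding Spec_open_def by blast
qed blast

text \<open>A germ at a point is a function on a smaller open set, namely \<open>U\<close> cut down
  to its domain; so acting on sections and acting on stalks amount to the same.\<close>

lemma tangent_sheaf_iff:
  assumes U: "openin (TV \<Sigma>) U"
  shows "D \<in> tangent_sheaf \<Sigma> U \<longleftrightarrow> derivation D \<and> (\<forall>x\<in>U. D \<in> tstalk x)"
proof
  assume D: "D \<in> tangent_sheaf \<Sigma> U"
  then have der: "derivation D" by (simp add: tangent_sheaf_def)
  have "D \<in> tstalk x" if x: "x \<in> U" for x
  proof (rule tstalkI[OF der])
    fix g assume g: "g \<in> x"
    let ?V = "U \<inter> {y \<in> TV_points \<Sigma>. g \<in> y}"
    have V: "openin (TV \<Sigma>) ?V" by (rule openin_Int[OF U openin_TV_contains])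
    have xV: "x \<in> ?V" using x g openin_subset[OF U] topspace_TV by auto
    then have "D ` TV_functions ?V \<subseteq> TV_functions ?V" using D V unfolding tangent_sheaf_def by blast
    moreover have "g \<in> TV_functions ?V" unfolding TV_functions_def by blast
    ultimately have "D g \<in> TV_functions ?V" by blast
    then show "D g \<in> x" using xV unfolding TV_functions_def by blast
  qed
  then show "derivation D \<and> (\<forall>x\<in>U. D \<in> tstalk x)" using der by blast
next
  assume "derivation D \<and> (\<forall>x\<in>U. D \<in> tstalk x)"
  then show "D \<in> tangent_sheaf \<Sigma> U"
    unfolding tangent_sheaf_def TV_functions_def using tstalk_apply by blast
qed

section \<open>Gluing of the charts\<close>

context fan_cycle
begin

lemma S_subset_cases:
  assumes "T \<subseteq> S i"
  shows "T = {} \<or> T = {\<nu> i} \<or> T = {\<nu> (Suc i)} \<or> T = S i"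
  using assms unfolding S_def by blast

lemma pos_hull_mem: "T \<subseteq> S i \<Longrightarrow> pos_hull T \<in> \<Sigma>"
  using S_subset_cases[of T i] unfolding cones S_def by blast

lemma finite_S [simp]: "finite (S i)"
  by (simp add: S_def)

lemma \<nu>_in_S [simp]: "\<nu> i \<in> S i" "\<nu> (Suc i) \<in> S i"
  by (simp_all add: S_def)

lemma finite_sub_S: "T \<subseteq> S i \<Longrightarrow> finite T"
  using finite_subset finite_S by blast

lemma w_expand: "u = (lpair (\<nu> i) u * fst (w1 i) + lpair (\<nu> (Suc i)) u * fst (w2 i),
    lpair (\<nu> i) u * snd (w1 i) + lpair (\<nu> (Suc i)) u * snd (w2 i))"
proof -
  have "lpair (\<nu> i) u * fst (w1 i) + lpair (\<nu> (Suc i)) u * fst (w2 i) = det2 (\<nu> i) (\<nu> (Suc i)) * fst u"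
    "lpair (\<nu> i) u * snd (w1 i) + lpair (\<nu> (Suc i)) u * snd (w2 i) = det2 (\<nu> i) (\<nu> (Suc i)) * snd u"
    by (simp_all add: w1_def w2_def lpair_def det2_def algebra_simps)
  then show ?thesis by (simp add: det_Suc)
qed

text \<open>Properties stable under addition of exponents need checking on the dual basis only, with
  the negative of a basis vector where that coordinate may be negative.\<close>

lemma generated:
  assumes M: "0 \<in> M" "\<And>u v. u \<in> M \<Longrightarrow> v \<in> M \<Longrightarrow> u + v \<in> M"
    and "lpair (\<nu> i) u \<ge> 0 \<and> w1 i \<in> M \<or> - w1 i \<in> M \<and> w1 i \<in> M"
    and "lpair (\<nu> (Suc i)) u \<ge> 0 \<and> w2 i \<in> M \<or> - w2 i \<in> M \<and> w2 i \<in> M"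
  shows "u \<in> M"
proof -
  have mult: "(a * fst w, a * snd w) \<in> M" if "a \<ge> 0 \<and> w \<in> M \<or> - w \<in> M \<and> w \<in> M" for a w
  proof (cases "a \<ge> 0")
    case True
    then have "(a * fst w, a * snd w) = scale (nat a) w" by (simp add: scale_def)
    then show ?thesis using scale_closed[of M w] M that by metis
  next
    case False
    then have "(a * fst w, a * snd w) = scale (nat (- a)) (- w)" by (simp add: scale_def)
    then show ?thesis using scale_closed[of M "- w"] M that False by metis
  qed
  have "u = (lpair (\<nu> i) u * fst (w1 i), lpair (\<nu> i) u * snd (w1 i)) +
      (lpair (\<nu> (Suc i)) u * fst (w2 i), lpair (\<nu> (Suc i)) u * snd (w2 i))"
    unfolding plus_prod_def using w_expand[of u i] by simp
  then show ?thesis using M(2)[OF mult[OF assms(3)] mult[OF assms(4)]] by simp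
qed

text \<open>\<open>chi m\<close> is a unit at \<open>x\<close>, and its powers clear the
  denominators of \<open>chart T\<close> over \<open>chart T'\<close>; so
  \<open>localization_change_ring\<close> applies.\<close>

lemma loc_points_change_chart:
  assumes x: "x \<in> loc_points (chart T)" "chart T' \<subseteq> x" and T': "finite T'"
    and m: "\<And>n. n \<in> T' \<Longrightarrow> lpair n m \<ge> 0" "\<And>n. n \<in> T' \<Longrightarrow> n \<notin> T \<Longrightarrow> lpair n m > 0" "chi (- m) \<in> x"
  shows "x \<in> loc_points (chart T')"
proof -
  obtain Q where Q: "is_prime (chart T) Q" "x = localization (chart T) Q" using x(1) by (rule loc_pointsE)
  have sub: "is_subring x" by (rule loc_points_subring[OF chart_subring x(1)])
  have mT: "chi m ^ N \<in> chart T'" for N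
    using m(1) by (intro is_subring_power[OF chart_subring] chi_mem_chart) (simp add: dual_def)
  have inv: "inverse (chi m ^ N) \<in> x" for N
    unfolding power_inverse[symmetric] chi_uminus[symmetric] by (rule is_subring_power[OF sub m(3)])
  have "\<exists>s\<in>chart T'. s \<noteq> 0 \<and> inverse s \<in> x \<and> s * b \<in> chart T'" if b: "b \<in> chart T" for b
  proof -
    obtain N where "chi m ^ N * b \<in> chart T'" by (rule extend_to_chart[OF T' m(1,2) b])
    then show ?thesis using mT inv by (intro bexI[of _ "chi m ^ N"]) simp_all
  qed
  note * = localization_change_ring[OF chart_subring chart_subring Q(1) x(2)[unfolded Q(2)] this[unfolded Q(2)]]
  show ?thesis unfolding loc_points_def Q(2) using * by blast
qed

lemma sub_chart_points:
  assumes T: "T \<subseteq> S i"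
  shows "loc_points (chart T) \<subseteq> loc_points (chart (S i))"
proof
  fix x assume x: "x \<in> loc_points (chart T)"
  \<comment> \<open>The form supporting the face \<open>T\<close>: its character is invertible
    exactly on the smaller chart.\<close>
  obtain m where m: "\<And>n. n \<in> S i \<Longrightarrow> lpair n m \<ge> 0" "\<And>n. n \<in> S i \<Longrightarrow> n \<notin> T \<Longrightarrow> lpair n m > 0"
    "\<And>n. n \<in> T \<Longrightarrow> lpair n m = 0"
  proof -
    have ne: "\<nu> i \<noteq> \<nu> (Suc i)" using det_Suc[of i] by auto
    consider "T = {}" | "T = {\<nu> i}" | "T = {\<nu> (Suc i)}" | "T = S i" using S_subset_cases[OF T] by blast
    then show ?thesis
    proof cases
      case 1 then show ?thesis by (intro that[of "w1 i + w2 i"]) (auto simp: S_def lpair_simps)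
    next
      case 2 then show ?thesis by (intro that[of "w2 i"]) (auto simp: S_def)
    next
      case 3 then show ?thesis by (intro that[of "w1 i"]) (auto simp: S_def)
    next
      case 4 then show ?thesis by (intro that[of 0]) (auto simp: lpair_simps)
    qed
  qed
  have cx: "chart T \<subseteq> x" by (rule loc_points_superset[OF chart_subring x])
  then have "chi (- m) \<in> x" using chi_mem_chart[of "- m" T] m(3) by (auto simp: dual_def lpair_simps)
  then show "x \<in> loc_points (chart (S i))"
    using cx chart_mono[OF T] by (intro loc_points_change_chart[OF x _ finite_S m(1,2)]) auto
qed

lemma TV_points_eq: "TV_points \<Sigma> = (\<Union>i. loc_points (chart (S i)))"
proof (intro subset_antisym subsetI)
  fix x assume "x \<in> TV_points \<Sigma>"
  then obtain \<sigma> P where *: "\<sigma> \<in> \<Sigma>" "x = localization (chart_ring \<sigma>) P" "P \<in> Spec (chart_ring \<sigma>)"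
    unfolding TV_points_def by blast
  have "\<exists>i T. T \<subseteq> S i \<and> \<sigma> = pos_hull T" using *(1) unfolding cones S_def by blast
  then obtain i T where T: "T \<subseteq> S i" "\<sigma> = pos_hull T" by blast
  have cr: "chart_ring \<sigma> = chart T" using chart_ring_pos_hull[OF finite_sub_S[OF T(1)]] T(2) by simp
  have "x \<in> loc_points (chart T)"
    using *(2,3) Spec_iff[OF chart_subring] unfolding cr loc_points_def by blast
  then show "x \<in> (\<Union>i. loc_points (chart (S i)))" using sub_chart_points[OF T(1)] by blast
next
  fix x assume "x \<in> (\<Union>i. loc_points (chart (S i)))"
  then obtain i P where P: "is_prime (chart (S i)) P" "x = localization (chart (S i)) P"
    unfolding loc_points_def by blast
  have cr: "chart_ring (pos_hull (S i)) = chart (S i)" by (rule chart_ring_pos_hull[OF finite_S])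
  have "P \<in> Spec (chart_ring (pos_hull (S i)))" using P(1) Spec_iff[OF chart_subring] unfolding cr by blast
  then show "x \<in> TV_points \<Sigma>"
    using pos_hull_mem[of "S i" i] P(2) unfolding TV_points_def cr[symmetric] by blast
qed

text \<open>Separatedness: if the functions of chart \<open>i\<close> are regular at a point of
  chart \<open>j\<close>, the character of a separating form and its inverse both lie in the local
  ring.\<close>

lemma chart_points_iff: "x \<in> loc_points (chart (S i)) \<longleftrightarrow> x \<in> TV_points \<Sigma> \<and> chart (S i) \<subseteq> x"
proof
  assume "x \<in> loc_points (chart (S i))"
  then show "x \<in> TV_points \<Sigma> \<and> chart (S i) \<subseteq> x"
    using TV_points_eq loc_points_superset[OF chart_subring] by blast
next
  assume x: "x \<in> TV_points \<Sigma> \<and> chart (S i) \<subseteq> x"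
  then obtain j where j: "x \<in> loc_points (chart (S j))" unfolding TV_points_eq by blast
  show "x \<in> loc_points (chart (S i))"
  proof (cases "\<nu> i = \<nu> j")
    case True
    then have "S i = S j" using periodic_Suc unfolding S_def by metis
    then show ?thesis using j by simp
  next
    case False
    obtain m where m: "\<And>n. n \<in> S i \<Longrightarrow> lpair n m \<ge> 0" "\<And>n. n \<in> S i \<Longrightarrow> n \<notin> S j \<Longrightarrow> lpair n m > 0"
      "\<And>n. n \<in> S j \<Longrightarrow> lpair n m \<le> 0"
      using separation[OF False] by metis
    have "chi (- m) \<in> x"
      using loc_points_superset[OF chart_subring j] chi_mem_chart[of "- m" "S j"] m(3) by (auto simp: dual_def lpair_simps)
    then show ?thesis using x by (intro loc_points_change_chart[OF j _ finite_S m(1,2)]) auto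
  qed
qed

text \<open>At a common point the separating character is invertible, and with its inverse the
  functions of chart \<open>i\<close> produce all those of the chart of the common face.\<close>

lemma chart_points_Int:
  assumes "x \<in> loc_points (chart (S i))" "x \<in> loc_points (chart (S j))"
  shows "x \<in> loc_points (chart (S i \<inter> S j))"
proof (cases "\<nu> i = \<nu> j")
  case True
  then have "S i = S j" using periodic_Suc unfolding S_def by metis
  then show ?thesis using assms by simp
next
  case False
  obtain m where m: "\<And>n. n \<in> S i \<Longrightarrow> lpair n m \<ge> 0" "\<And>n. n \<in> S i \<Longrightarrow> n \<notin> S j \<Longrightarrow> lpair n m > 0"
    "\<And>n. n \<in> S j \<Longrightarrow> lpair n m \<le> 0"
    using separation[OF False] by metis
  have sub: "is_subring x" by (rule loc_points_subring[OF chart_subring assms(1)])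
  have cx: "chart (S i) \<subseteq> x" "chart (S j) \<subseteq> x"
    using assms loc_points_superset[OF chart_subring] by blast+
  have mj: "inverse (chi m) \<in> x"
    using cx(2) chi_mem_chart[of "- m" "S j"] m(3) unfolding chi_uminus[symmetric] by (auto simp: dual_def lpair_simps)
  have sub_x: "chart (S i \<inter> S j) \<subseteq> x"
  proof
    fix b assume b: "b \<in> chart (S i \<inter> S j)"
    obtain N where N: "chi m ^ N * b \<in> chart (S i)"
      by (rule extend_to_chart[OF finite_S m(1) _ b]) (use m(2) in auto)
    have "inverse (chi m) ^ N * (chi m ^ N * b) \<in> x"
      by (rule is_subring_mult[OF sub is_subring_power[OF sub mj]]) (use N cx(1) in blast)
    moreover have "inverse (chi m) ^ N * (chi m ^ N * b) = b"
      by (simp add: mult.assoc[symmetric] power_mult_distrib[symmetric])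
    ultimately show "b \<in> x" by simp
  qed
  \<comment> \<open>The common face has no ray outside \<open>S i\<close>, so the trivial character
    can take the place of \<open>m\<close>.\<close>
  show ?thesis
    by (rule loc_points_change_chart[OF assms(1) sub_x, of 0])
      (use is_subring_1[OF sub] in \<open>auto simp: lpair_simps\<close>)
qed

text \<open>By the product rule, the exponents whose characters are regular at \<open>x\<close> and
  mapped into \<open>x\<close> are closed under addition; so at most four characters need
  testing.\<close>

lemma tstalk_chartI:
  assumes T: "T \<subseteq> S i" and x: "x \<in> loc_points (chart T)" and D: "derivation D"
    "\<And>g. g \<in> {w1 i, - w1 i, w2 i, - w2 i} \<Longrightarrow> g \<in> dual T \<Longrightarrow> D (chi g) \<in> x"
  shows "D \<in> tstalk x"
proof -
  define H where "H = {g \<in> {w1 i, - w1 i, w2 i, - w2 i}. g \<in> dual T}"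
  note sub = loc_points_subring[OF chart_subring x]
  have cx: "chart T \<subseteq> x" by (rule loc_points_superset[OF chart_subring x])
  define M where "M = {u. chi u \<in> x \<and> D (chi u) \<in> x}"
  have M: "0 \<in> M" "\<And>u v. u \<in> M \<Longrightarrow> v \<in> M \<Longrightarrow> u + v \<in> M"
    unfolding M_def using is_subring_add[OF sub] is_subring_mult[OF sub]
    by (simp_all add: is_subring_1[OF sub] is_subring_0[OF sub] derivation_1[OF D(1)] chi_add derivation_times[OF D(1)])
  have HM: "g \<in> M" if "g \<in> H" for g
    using that D(2) cx chi_mem_chart unfolding H_def M_def by blast
  have in_H: "w1 i \<in> H" "w2 i \<in> H" "\<nu> i \<notin> T \<Longrightarrow> - w1 i \<in> H" "\<nu> (Suc i) \<notin> T \<Longrightarrow> - w2 i \<in> H"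
    using S_subset_cases[OF T] by (auto simp: H_def dual_def lpair_simps S_def)
  have "u \<in> M" if u: "u \<in> dual T" for u
  proof (rule generated[OF M, of i])
    show "lpair (\<nu> i) u \<ge> 0 \<and> w1 i \<in> M \<or> - w1 i \<in> M \<and> w1 i \<in> M"
      using HM in_H u unfolding dual_def by blast
    show "lpair (\<nu> (Suc i)) u \<ge> 0 \<and> w2 i \<in> M \<or> - w2 i \<in> M \<and> w2 i \<in> M"
      using HM in_H u unfolding dual_def by blast
  qed
  then have chiD: "D (chi u) \<in> x" if "u \<in> dual T" for u using that unfolding M_def by blast
  have "D a \<in> x" if "a \<in> chart T" for a
    using that unfolding chart_def
  proof (induction rule: lspan_induct)
    case zero then show ?case by (simp add: derivation_0[OF D(1)] is_subring_0[OF sub])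
  next
    case (monom c u)
    then show ?case unfolding derivation_rconst_mult[OF D(1)]
      using is_subring_mult[OF sub _ chiD] cx rconst_mem_chart by blast
  next
    case (add f g) then show ?case by (simp add: derivation_plus[OF D(1)] is_subring_add[OF sub])
  qed
  then show ?thesis using tstalk_localI[OF chart_subring x D(1)] by blast
qed

lemma chart_generators:
  assumes "T \<subseteq> S i"
  obtains G where "affine_chart (chart T) G"
proof -
  define H where "H = {g \<in> {w1 i, - w1 i, w2 i, - w2 i}. g \<in> dual T}"
  have "affine_chart (chart T) (chi ` H)"
  proof
    show "is_subring (chart T)" by (rule chart_subring)
    show "finite (chi ` H)" by (simp add: H_def)
    show "chi ` H \<subseteq> chart T" unfolding H_def using chi_mem_chart by auto
    fix x D assume x: "x \<in> loc_points (chart T)" and D: "derivation D" "D ` chi ` H \<subseteq> x"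
    show "D \<in> tstalk x"
      by (rule tstalk_chartI[OF assms x D(1)]) (use D(2) in \<open>auto simp: H_def\<close>)
  qed
  then show ?thesis by (rule that)
qed

text \<open>Replaces an arbitrary neighbourhood by the locus where one function is invertible, as
  the affine vanishing lemmas require.\<close>

lemma open_neighbourhood:
  assumes T: "T \<subseteq> S i" and U: "openin (TV \<Sigma>) U" "x \<in> U" "x \<in> loc_points (chart T)"
  obtains f where "f \<in> chart T" "f \<noteq> 0" "inverse f \<in> x" "\<And>z. z \<in> loc_points (chart T) \<Longrightarrow> inverse f \<in> z \<Longrightarrow> z \<in> U"
proof -
  have cr: "chart_ring (pos_hull T) = chart T" by (rule chart_ring_pos_hull[OF finite_sub_S[OF T]])
  have "Spec_open (chart T) {P \<in> Spec (chart T). localization (chart T) P \<in> U}"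
    using U(1) pos_hull_mem[OF T] unfolding openin_TV TV_open_def cr[symmetric] by blast
  then obtain I where I: "I \<subseteq> chart T" "{P \<in> Spec (chart T). localization (chart T) P \<in> U} = {P \<in> Spec (chart T). \<not> I \<subseteq> P}"
    unfolding Spec_open_def by blast
  have mem: "localization (chart T) P \<in> U \<longleftrightarrow> \<not> I \<subseteq> P" if "is_prime (chart T) P" for P
    using I(2) that Spec_iff[OF chart_subring] by blast
  obtain P where P: "is_prime (chart T) P" "x = localization (chart T) P" by (rule loc_pointsE[OF U(3)])
  obtain f where f: "f \<in> I" "f \<notin> P" using mem[OF P(1)] U(2) P(2) by blast
  have fc: "f \<in> chart T" using f(1) I(1) by blast
  show ?thesis
  proof (rule that[OF fc])
    show "f \<noteq> 0" "inverse f \<in> x" using localization_unit_iff[OF chart_subring P(1) fc] f(2) P(2) by blast+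
    fix z assume z: "z \<in> loc_points (chart T)" "inverse f \<in> z"
    obtain Q where Q: "is_prime (chart T) Q" "z = localization (chart T) Q" by (rule loc_pointsE[OF z(1)])
    have "f \<notin> Q" using localization_unit_iff[OF chart_subring Q(1) fc] z(2) Q(2) \<open>f \<noteq> 0\<close> by blast
    then show "z \<in> U" using mem[OF Q(1)] f(1) Q(2) by blast
  qed
qed

text \<open>The means by which generic points of the torus and of its divisors are found in
  arbitrary neighbourhoods.\<close>

lemma open_generization:
  assumes U: "openin (TV \<Sigma>) U" and PQ: "is_prime (chart (S i)) P" "is_prime (chart (S i)) Q" "Q \<subseteq> P"
    and "localization (chart (S i)) P \<in> U"
  shows "localization (chart (S i)) Q \<in> U"
proof -
  have x: "localization (chart (S i)) P \<in> loc_points (chart (S i))" using PQ(1) unfolding loc_points_def by blast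
  obtain f where f: "f \<in> chart (S i)" "f \<noteq> 0" "inverse f \<in> localization (chart (S i)) P"
    "\<And>z. z \<in> loc_points (chart (S i)) \<Longrightarrow> inverse f \<in> z \<Longrightarrow> z \<in> U"
    using open_neighbourhood[OF subset_refl U assms(5) x] by metis
  have "f \<notin> P" using localization_unit_iff[OF chart_subring PQ(1) f(1)] f(2,3) by blast
  then have "inverse f \<in> localization (chart (S i)) Q"
    using localization_unit_iff[OF chart_subring PQ(2) f(1)] PQ(3) by blast
  moreover have "localization (chart (S i)) Q \<in> loc_points (chart (S i))" using PQ(2) unfolding loc_points_def by blast
  ultimately show ?thesis using f(4) by blast
qed

text \<open>The two characters \<open>w1 i\<close> and \<open>w2 i\<close> generate the chart ring
  over the constants, so the chart is an intersection of two domains of rational functions.\<close>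

lemma principal_open: "openin (TV \<Sigma>) {z \<in> loc_points (chart (S i)). g \<in> z}"
proof -
  have sub: "chart (S i) \<subseteq> z" if z: "is_subring z" "\<forall>c. rconst c \<in> z" "chi (w1 i) \<in> z" "chi (w2 i) \<in> z" for z
  proof
    fix f assume "f \<in> chart (S i)"
    then show "f \<in> z" unfolding chart_def
    proof (induction rule: lspan_induct)
      case (monom c u)
      have "u \<in> {u. chi u \<in> z}"
      proof (rule generated[of _ i])
        show "0 \<in> {u. chi u \<in> z}" using is_subring_1[OF z(1)] by simp
        show "u + v \<in> {u. chi u \<in> z}" if "u \<in> {u. chi u \<in> z}" "v \<in> {u. chi u \<in> z}" for u v
          using that is_subring_mult[OF z(1)] by (simp add: chi_add)
        show "lpair (\<nu> i) u \<ge> 0 \<and> w1 i \<in> {u. chi u \<in> z} \<or> - w1 i \<in> {u. chi u \<in> z} \<and> w1 i \<in> {u. chi u \<in> z}"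
          "lpair (\<nu> (Suc i)) u \<ge> 0 \<and> w2 i \<in> {u. chi u \<in> z} \<or> - w2 i \<in> {u. chi u \<in> z} \<and> w2 i \<in> {u. chi u \<in> z}"
          using monom z(3,4) by (simp_all add: dual_def)
      qed
      then show ?case using z(2) is_subring_mult[OF z(1)] by simp
    qed (use is_subring_0[OF z(1)] is_subring_add[OF z(1)] in auto)
  qed
  have TV: "is_subring z \<and> (\<forall>c. rconst c \<in> z)" if z: "z \<in> TV_points \<Sigma>" for z
  proof -
    obtain j where "z \<in> loc_points (chart (S j))" using z unfolding TV_points_eq by blast
    then have "chart (S j) \<subseteq> z" by (rule loc_points_superset[OF chart_subring])
    then show ?thesis using TV_points_subring[OF z] rconst_mem_chart by blast
  qed
  have w: "chi (w1 i) \<in> chart (S i)" "chi (w2 i) \<in> chart (S i)"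
    by (auto intro!: chi_mem_chart simp: dual_def S_def)
  have eq: "{z \<in> loc_points (chart (S i)). g \<in> z} =
      ({z \<in> TV_points \<Sigma>. chi (w1 i) \<in> z} \<inter> {z \<in> TV_points \<Sigma>. chi (w2 i) \<in> z}) \<inter> {z \<in> TV_points \<Sigma>. g \<in> z}"
    (is "?L = ?R")
  proof (intro subset_antisym subsetI)
    fix z assume "z \<in> ?L"
    then show "z \<in> ?R" using w unfolding chart_points_iff by blast
  next
    fix z assume "z \<in> ?R"
    then have z: "z \<in> TV_points \<Sigma>" "chi (w1 i) \<in> z" "chi (w2 i) \<in> z" "g \<in> z" by blast+
    then show "z \<in> ?L" unfolding chart_points_iff using sub[of z] TV[OF z(1)] by blast
  qed
  show ?thesis unfolding eq by (intro openin_Int openin_TV_contains)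
qed

lemma chart_open: "openin (TV \<Sigma>) (loc_points (chart (S i)))"
proof -
  have "loc_points (chart (S i)) = {z \<in> loc_points (chart (S i)). 1 \<in> z}"
    using loc_points_subring[OF chart_subring] is_subring_1 by blast
  then show ?thesis using principal_open[of i 1] by simp
qed

end

section \<open>Cech cochains of the tangent sheaf\<close>

abbreviation tcochains where "tcochains \<Sigma> n \<equiv> cochains (TV \<Sigma>) (tangent_sheaf \<Sigma>) n"
abbreviation tcocycles where "tcocycles \<Sigma> n \<equiv> cocycles (TV \<Sigma>) (tangent_sheaf \<Sigma>) n"
abbreviation tcoboundaries where "tcoboundaries \<Sigma> n \<equiv> coboundaries (TV \<Sigma>) (tangent_sheaf \<Sigma>) n"
abbreviation tclass where "tclass \<Sigma> n \<equiv> cohom_class (TV \<Sigma>) (tangent_sheaf \<Sigma>) n"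

definition open_cover :: "(rat \<times> rat) set set \<Rightarrow> (ratfun set \<Rightarrow> ratfun set set) \<Rightarrow> bool" where
  "open_cover \<Sigma> U \<longleftrightarrow> (\<forall>x\<in>TV_points \<Sigma>. openin (TV \<Sigma>) (U x) \<and> x \<in> U x)"

lemma open_coverD: "open_cover \<Sigma> U \<Longrightarrow> x \<in> TV_points \<Sigma> \<Longrightarrow> openin (TV \<Sigma>) (U x)"
  "open_cover \<Sigma> U \<Longrightarrow> x \<in> TV_points \<Sigma> \<Longrightarrow> x \<in> U x"
  by (simp_all add: open_cover_def)

definition section_on :: "(ratfun set \<Rightarrow> ratfun set set) \<Rightarrow> ratfun set list \<Rightarrow> (ratfun \<Rightarrow> ratfun) \<Rightarrow> bool" where
  "section_on U xs D \<longleftrightarrow> derivation D \<and> (\<forall>z. (\<forall>x\<in>set xs. z \<in> U x) \<longrightarrow> D \<in> tstalk z)"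

lemma section_onD: "section_on U xs D \<Longrightarrow> (\<And>x. x \<in> set xs \<Longrightarrow> z \<in> U x) \<Longrightarrow> D \<in> tstalk z"
  by (simp add: section_on_def)

lemma cochains_iff:
  "c \<in> tcochains \<Sigma> n \<longleftrightarrow> (\<exists>U. open_cover \<Sigma> U \<and>
     (\<forall>xs. length xs = Suc n \<and> set xs \<subseteq> TV_points \<Sigma> \<longrightarrow> section_on U xs (c xs)))"
proof -
  have "c xs \<in> tangent_sheaf \<Sigma> (\<Inter>x\<in>set xs. U x) \<longleftrightarrow> section_on U xs (c xs)"
    if U: "open_cover \<Sigma> U" and xs: "length xs = Suc n \<and> set xs \<subseteq> TV_points \<Sigma>" for U xs
  proof -
    have "set xs \<noteq> {}" using xs by auto
    then have "openin (TV \<Sigma>) (\<Inter>x\<in>set xs. U x)"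
      by (intro openin_INT2) (use xs open_coverD(1)[OF U] in auto)
    then show ?thesis unfolding tangent_sheaf_iff[OF \<open>openin _ _\<close>] section_on_def by auto
  qed
  then show ?thesis
    unfolding cochains_def topspace_TV open_cover_def[symmetric] mem_Collect_eq by (metis (no_types, lifting))
qed

lemma section_on_mono:
  assumes "section_on U xs D" "\<And>x. x \<in> set xs \<Longrightarrow> V x \<subseteq> U x"
  shows "section_on V xs D"
  using assms unfolding section_on_def by blast

lemma cover_point_subring:
  assumes U: "open_cover \<Sigma> U" and "x \<in> TV_points \<Sigma>" "z \<in> U x"
  shows "is_subring z"
  using openin_subset[OF open_coverD(1)[OF U assms(2)]] assms(3) TV_points_subring topspace_TV by blast

lemma section_on_diff:
  assumes U: "open_cover \<Sigma> U" and xs: "xs \<noteq> []" "set xs \<subseteq> TV_points \<Sigma>"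
    and "section_on U xs D" "section_on U xs E"
  shows "section_on U xs (D - E)"
proof -
  have "is_subring z" if "\<forall>x\<in>set xs. z \<in> U x" for z
    using cover_point_subring[OF U, of "hd xs" z] xs that by (metis hd_in_set subsetD)
  then show ?thesis using assms(4,5) unfolding section_on_def by (auto intro: derivation_diff tstalk_diff)
qed

lemma open_cover_Int: "open_cover \<Sigma> U \<Longrightarrow> open_cover \<Sigma> V \<Longrightarrow> open_cover \<Sigma> (\<lambda>x. U x \<inter> V x)"
  by (simp add: open_cover_def openin_Int)

lemma cochains_diff:
  assumes "c \<in> tcochains \<Sigma> n" "d \<in> tcochains \<Sigma> n"
  shows "c - d \<in> tcochains \<Sigma> n"
proof -
  obtain U where U: "open_cover \<Sigma> U" "\<And>xs. length xs = Suc n \<and> set xs \<subseteq> TV_points \<Sigma> \<Longrightarrow> section_on U xs (c xs)"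
    using assms(1) unfolding cochains_iff by blast
  obtain V where V: "open_cover \<Sigma> V" "\<And>xs. length xs = Suc n \<and> set xs \<subseteq> TV_points \<Sigma> \<Longrightarrow> section_on V xs (d xs)"
    using assms(2) unfolding cochains_iff by blast
  note UV = open_cover_Int[OF U(1) V(1)]
  have "section_on (\<lambda>x. U x \<inter> V x) xs ((c - d) xs)" if xs: "length xs = Suc n \<and> set xs \<subseteq> TV_points \<Sigma>" for xs
  proof -
    have "section_on (\<lambda>x. U x \<inter> V x) xs (c xs)" by (rule section_on_mono[OF U(2)[OF xs]]) blast
    moreover have "section_on (\<lambda>x. U x \<inter> V x) xs (d xs)" by (rule section_on_mono[OF V(2)[OF xs]]) blast
    moreover have "xs \<noteq> []" using xs by auto
    ultimately show ?thesis using section_on_diff[OF UV] xs by simp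
  qed
  then show ?thesis using UV unfolding cochains_iff by blast
qed

lemma cech_diff_diff: "cech_diff (c - d) xs = cech_diff c xs - cech_diff d xs"
  unfolding cech_diff_def sum_subtractf[symmetric] by (rule sum.cong) auto

lemma cech_diff_0 [simp]: "cech_diff 0 xs = 0"
  using cech_diff_diff[of 0 0 xs] by (simp only: diff_self)

lemma cochains_0: "0 \<in> tcochains \<Sigma> n"
  unfolding cochains_iff
proof (intro exI[of _ "\<lambda>_. TV_points \<Sigma>"] conjI allI impI)
  show "open_cover \<Sigma> (\<lambda>_. TV_points \<Sigma>)"
    unfolding open_cover_def using openin_topspace[of "TV \<Sigma>"] by (simp add: topspace_TV)
  fix xs :: "ratfun set list" assume "length xs = Suc n \<and> set xs \<subseteq> TV_points \<Sigma>"
  then have "hd xs \<in> set xs" by (cases xs) auto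
  then show "section_on (\<lambda>_. TV_points \<Sigma>) xs (0 xs)"
    unfolding section_on_def using tstalk_0 TV_points_subring by auto
qed

lemma cocycles_0: "0 \<in> tcocycles \<Sigma> n"
  unfolding cocycles_def by (simp add: cochains_0)

lemma coboundaries_0: "0 \<in> tcoboundaries \<Sigma> (Suc n)"
  using cochains_0 by (auto intro!: bexI[of _ 0])

lemma coboundaries_diff:
  assumes "c \<in> tcoboundaries \<Sigma> (Suc n)" "d \<in> tcoboundaries \<Sigma> (Suc n)"
  shows "c - d \<in> tcoboundaries \<Sigma> (Suc n)"
proof -
  obtain a where a: "a \<in> tcochains \<Sigma> n"
    "\<forall>xs. length xs = n + 2 \<and> set xs \<subseteq> topspace (TV \<Sigma>) \<longrightarrow> c xs = cech_diff a xs"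
    using assms(1) by auto
  obtain b where b: "b \<in> tcochains \<Sigma> n"
    "\<forall>xs. length xs = n + 2 \<and> set xs \<subseteq> topspace (TV \<Sigma>) \<longrightarrow> d xs = cech_diff b xs"
    using assms(2) by auto
  have "c - d \<in> tcochains \<Sigma> (Suc n)" using assms by (intro cochains_diff) auto
  then show ?thesis
    using cochains_diff[OF a(1) b(1)] a(2) b(2) by (auto simp: cech_diff_diff intro!: bexI[of _ "a - b"])
qed

lemma coboundaries_add:
  assumes "c \<in> tcoboundaries \<Sigma> (Suc n)" "d \<in> tcoboundaries \<Sigma> (Suc n)"
  shows "c + d \<in> tcoboundaries \<Sigma> (Suc n)"
  using coboundaries_diff[OF assms(1) coboundaries_diff[OF coboundaries_0 assms(2)]] by simp

lemma class_eq_iff: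
  assumes c: "c \<in> tcocycles \<Sigma> (Suc n)" and d: "d \<in> tcocycles \<Sigma> (Suc n)"
  shows "tclass \<Sigma> (Suc n) c = tclass \<Sigma> (Suc n) d \<longleftrightarrow> c - d \<in> tcoboundaries \<Sigma> (Suc n)"
proof
  assume eq: "tclass \<Sigma> (Suc n) c = tclass \<Sigma> (Suc n) d"
  have "c - c \<in> tcoboundaries \<Sigma> (Suc n)" unfolding diff_self by (rule coboundaries_0)
  then have "c \<in> tclass \<Sigma> (Suc n) c" using c unfolding cohom_class_def by blast
  then have "c \<in> tclass \<Sigma> (Suc n) d" by (simp only: eq)
  then show "c - d \<in> tcoboundaries \<Sigma> (Suc n)" unfolding cohom_class_def mem_Collect_eq by (rule conjunct2)
next
  assume cd: "c - d \<in> tcoboundaries \<Sigma> (Suc n)"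
  have "e - c \<in> tcoboundaries \<Sigma> (Suc n) \<longleftrightarrow> e - d \<in> tcoboundaries \<Sigma> (Suc n)" for e
  proof
    assume "e - c \<in> tcoboundaries \<Sigma> (Suc n)"
    from coboundaries_add[OF this cd] show "e - d \<in> tcoboundaries \<Sigma> (Suc n)"
      by (simp only: diff_add_cancel add_diff_eq)
  next
    assume "e - d \<in> tcoboundaries \<Sigma> (Suc n)"
    from coboundaries_diff[OF this cd] show "e - c \<in> tcoboundaries \<Sigma> (Suc n)"
      by (simp only: diff_diff_eq2 diff_add_cancel)
  qed
  then show "tclass \<Sigma> (Suc n) c = tclass \<Sigma> (Suc n) d"
    unfolding cohom_class_def by (intro Collect_cong conj_cong refl)
qed

lemma cech_diff_pair: "cech_diff b [x, y] = b [y] - b [x]"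
  by (simp add: cech_diff_def numeral_2_eq_2 lessThan_Suc)

lemma cech_diff_triple: "cech_diff b [x, y, z] = b [y, z] - b [x, z] + b [x, y]"
  by (simp add: cech_diff_def numeral_3_eq_3 lessThan_Suc)

lemma cech_diff_quadruple: "cech_diff b [p, x, y, z] = b [x, y, z] - b [p, y, z] + b [p, x, z] - b [p, x, y]"
  by (simp add: cech_diff_def lessThan_Suc)

lemma length_Suc_0_E:
  assumes "length xs = Suc 0" obtains x where "xs = [x]"
  using assms by (cases xs) auto

lemma length_2_E:
  assumes "length xs = 2" obtains x y where "xs = [x, y]"
  using assms by (auto simp: numeral_2_eq_2 length_Suc_conv)

lemma length_3_E:
  assumes "length xs = 3" obtains x y z where "xs = [x, y, z]"
  using assms by (auto simp: numeral_3_eq_3 length_Suc_conv)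

section \<open>Generic points and the regularity of homogeneous fields\<close>

context fan_cycle
begin

abbreviation X where "X i \<equiv> loc_points (chart (S i))"

lemma X_TV: "x \<in> X i \<Longrightarrow> x \<in> TV_points \<Sigma>"
  unfolding chart_points_iff by blast

lemma X_subring: "x \<in> X i \<Longrightarrow> is_subring x"
  by (rule loc_points_subring[OF chart_subring])

lemma zero_prime: "is_prime (chart T) {0}"
  using is_subring_0[OF chart_subring, of T] by (simp add: is_prime_def is_ideal_def)

definition generic_point :: "ratfun set" where
  "generic_point = localization (chart {}) {0}"

lemma generic_point_mem:
  assumes U: "openin (TV \<Sigma>) U" "x \<in> U"
  shows "generic_point \<in> U"
proof -
  have "x \<in> TV_points \<Sigma>" using openin_subset[OF U(1)] U(2) topspace_TV by blast
  then obtain i where "x \<in> X i" unfolding TV_points_eq by blast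
  then obtain P where P: "is_prime (chart (S i)) P" "x = localization (chart (S i)) P" by (rule loc_pointsE)
  have "localization (chart (S i)) {0} \<in> U"
    by (rule open_generization[OF U(1) P(1) zero_prime]) (use prime_mem_0[OF P(1)] P(2) U(2) in auto)
  \<comment> \<open>Every chart contains the torus, so the zero ideals of all charts define one and
    the same point.\<close>
  moreover have "localization (chart {}) {0} = localization (chart (S i)) (chart (S i) \<inter> {0})"
  proof (rule localization_subring_eq(2)[OF chart_subring chart_subring zero_prime chart_mono])
    fix b assume b: "b \<in> chart {}"
    obtain N where N: "chi (w1 i + w2 i) ^ N * b \<in> chart (S i)"
      by (rule extend_to_chart[OF finite_S _ _ b]) (auto simp: S_def lpair_simps)
    have "chi (w1 i + w2 i) ^ N \<in> chart (S i)"
      by (intro is_subring_power[OF chart_subring] chi_mem_chart) (auto simp: dual_def S_def lpair_simps)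
    then show "\<exists>s\<in>chart (S i) - {0}. s * b \<in> chart (S i)"
      using N by (intro bexI[of _ "chi (w1 i + w2 i) ^ N"]) auto
  qed simp
  moreover have "chart (S i) \<inter> {0} = {0}" using is_subring_0[OF chart_subring] by blast
  ultimately show ?thesis unfolding generic_point_def by simp
qed

text \<open>The generic point lies in every intersection of neighbourhoods, so regularity there
  already says that \<open>D\<close> is a derivation.\<close>

lemma section_onI:
  assumes U: "open_cover \<Sigma> U" and xs: "xs \<noteq> []" "set xs \<subseteq> TV_points \<Sigma>"
    and D: "\<And>z. (\<And>x. x \<in> set xs \<Longrightarrow> z \<in> U x) \<Longrightarrow> D \<in> tstalk z"
  shows "section_on U xs D"
proof -
  have "generic_point \<in> U x" if "x \<in> set xs" for x
    using generic_point_mem open_coverD[OF U] xs that by blast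
  then have "D \<in> tstalk generic_point" by (rule D)
  then show ?thesis using D tstalk_derivation unfolding section_on_def by blast
qed

text \<open>Whether the field of degree u given by n has no pole along the divisor of a ray.\<close>

definition regular :: "latt \<Rightarrow> latt \<Rightarrow> complex \<times> complex \<Rightarrow> bool" where
  "regular \<nu>' u n \<longleftrightarrow> lpair \<nu>' u \<ge> 0 \<or> n = 0 \<or>
     lpair \<nu>' u = - 1 \<and> (\<exists>c. n = (c * of_int (fst \<nu>'), c * of_int (snd \<nu>')))"

text \<open>The alternative \<open>chi (- w1 i) \<in> x\<close> says that the divisor of
  \<open>\<nu> i\<close> does not pass through \<open>x\<close>, and similarly for
  \<open>w2\<close>. Only divisors through \<open>x\<close> impose a condition.\<close>

lemma hder_tstalk:
  assumes x: "x \<in> X i"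
    and r1: "regular (\<nu> i) u n \<or> chi (- w1 i) \<in> x" and r2: "regular (\<nu> (Suc i)) u n \<or> chi (- w2 i) \<in> x"
  shows "hder u n \<in> tstalk x"
proof -
  have sub: "is_subring x" by (rule X_subring[OF x])
  have cx: "chart (S i) \<subseteq> x" by (rule loc_points_superset[OF chart_subring x])
  have w: "chi (w1 i) \<in> x" "chi (w2 i) \<in> x"
    using cx by (auto intro!: subsetD[OF cx] chi_mem_chart simp: dual_def S_def)
  have chi: "chi v \<in> x"
    if "lpair (\<nu> i) v \<ge> 0 \<or> chi (- w1 i) \<in> x" "lpair (\<nu> (Suc i)) v \<ge> 0 \<or> chi (- w2 i) \<in> x" for v
  proof -
    have "v \<in> {u. chi u \<in> x}"
      by (rule generated[of _ i]) (use that w is_subring_1[OF sub] is_subring_mult[OF sub] in \<open>auto simp: chi_add\<close>)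
    then show ?thesis by simp
  qed
  have np: "npair (c * of_int (fst m), c * of_int (snd m)) v = c * of_int (lpair m v)" for c m v
    by (simp add: npair_def lpair_def algebra_simps)
  have d1: "rconst (npair n (w1 i)) * chi (u + w1 i) \<in> x"
  proof (cases "npair n (w1 i) = 0")
    case True then show ?thesis by (simp add: is_subring_0[OF sub])
  next
    case False
    then have "n \<noteq> 0" by auto
    have "chi (u + w1 i) \<in> x"
    proof (rule chi)
      show "lpair (\<nu> i) (u + w1 i) \<ge> 0 \<or> chi (- w1 i) \<in> x"
        using r1 \<open>n \<noteq> 0\<close> by (auto simp: regular_def lpair_simps)
      \<comment> \<open>The case of value -1 cannot occur: \<open>n\<close> would be a multiple of
        \<open>\<nu> (Suc i)\<close>, whose pairing with \<open>w1 i\<close> vanishes, against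
        \<open>False\<close>.\<close>
      show "lpair (\<nu> (Suc i)) (u + w1 i) \<ge> 0 \<or> chi (- w2 i) \<in> x"
        using r2 \<open>n \<noteq> 0\<close> False by (auto simp: regular_def lpair_simps np)
    qed
    then show ?thesis using is_subring_mult[OF sub] cx rconst_mem_chart by blast
  qed
  have d2: "rconst (npair n (w2 i)) * chi (u + w2 i) \<in> x"
  proof (cases "npair n (w2 i) = 0")
    case True then show ?thesis by (simp add: is_subring_0[OF sub])
  next
    case False
    then have "n \<noteq> 0" by auto
    have "chi (u + w2 i) \<in> x"
    proof (rule chi)
      show "lpair (\<nu> (Suc i)) (u + w2 i) \<ge> 0 \<or> chi (- w2 i) \<in> x"
        using r2 \<open>n \<noteq> 0\<close> by (auto simp: regular_def lpair_simps)
      show "lpair (\<nu> i) (u + w2 i) \<ge> 0 \<or> chi (- w1 i) \<in> x"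
        using r1 \<open>n \<noteq> 0\<close> False by (auto simp: regular_def lpair_simps np)
    qed
    then show ?thesis using is_subring_mult[OF sub] cx rconst_mem_chart by blast
  qed
  have "- w1 i \<notin> dual (S i)" "- w2 i \<notin> dual (S i)" by (auto simp: dual_def S_def lpair_simps)
  then show ?thesis
    by (intro tstalk_chartI[OF subset_refl x derivation_hder]) (use d1 d2 in \<open>auto simp: hder_chi\<close>)
qed

lemma hder_tstalk_ray:
  assumes x: "x \<in> loc_points (chart {\<nu> i})" and r: "regular (\<nu> i) u n"
  shows "hder u n \<in> tstalk x"
proof (rule hder_tstalk)
  have sub: "{\<nu> i} \<subseteq> S i" by simp
  show "x \<in> X i" using sub_chart_points[OF sub] x by blast
  have "chi (- w2 i) \<in> chart {\<nu> i}" by (rule chi_mem_chart) (simp add: dual_def lpair_simps)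
  then show "regular (\<nu> (Suc i)) u n \<or> chi (- w2 i) \<in> x" using loc_points_superset[OF chart_subring x] by blast
qed (use r in blast)

lemma hder_tstalk_torus:
  assumes x: "x \<in> loc_points (chart {})"
  shows "hder u n \<in> tstalk x"
proof (rule hder_tstalk)
  show "x \<in> X 0" using sub_chart_points[of "{}" 0] x by blast
  have "chi v \<in> x" for v using loc_points_superset[OF chart_subring x] chi_mem_chart[of v "{}"] by (auto simp: dual_def)
  then show "regular (\<nu> 0) u n \<or> chi (- w1 0) \<in> x" "regular (\<nu> (Suc 0)) u n \<or> chi (- w2 0) \<in> x" by blast+
qed

section \<open>The obstruction space vanishes\<close>

text \<open>In every degree there is a ray along whose divisor all fields of this degree are regular.\<close>

lemma torus_field_decomposition:
  assumes l: "0 < l" and D: "\<And>z. z \<in> loc_points (chart {}) \<Longrightarrow> D \<in> tstalk z"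
  obtains t where "D = (\<Sum>k<l. t k)" "\<And>k z. k < l \<Longrightarrow> z \<in> loc_points (chart {\<nu> k}) \<Longrightarrow> t k \<in> tstalk z"
proof -
  define Dec where "Dec = {D. \<exists>t. D = (\<Sum>k<l. t k) \<and> (\<forall>k z. k < l \<longrightarrow> z \<in> loc_points (chart {\<nu> k}) \<longrightarrow> t k \<in> tstalk z)}"
  have sub: "is_subring z" if "z \<in> loc_points (chart {\<nu> k})" for z k
    using that by (rule loc_points_subring[OF chart_subring])
  have Dec_add: "D + E \<in> Dec" if DE: "D \<in> Dec" "E \<in> Dec" for D E
  proof -
    obtain t t' where "D = (\<Sum>k<l. t k)" "E = (\<Sum>k<l. t' k)"
      "\<forall>k z. k < l \<longrightarrow> z \<in> loc_points (chart {\<nu> k}) \<longrightarrow> t k \<in> tstalk z"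
      "\<forall>k z. k < l \<longrightarrow> z \<in> loc_points (chart {\<nu> k}) \<longrightarrow> t' k \<in> tstalk z"
      using DE unfolding Dec_def by blast
    then show ?thesis unfolding Dec_def mem_Collect_eq
      by (intro exI[of _ "\<lambda>k. t k + t' k"]) (simp add: sum.distrib tstalk_add sub)
  qed
  have Dec_0: "0 \<in> Dec" unfolding Dec_def mem_Collect_eq
    by (intro exI[of _ "\<lambda>_. 0"]) (simp add: tstalk_0 sub)
  have hder: "hder u n \<in> Dec" for u n
  proof -
    obtain j where j: "lpair (\<nu> j) u \<ge> 0" using nonneg_ray by blast
    define i where "i = j mod l"
    have i: "i < l" "lpair (\<nu> i) u \<ge> 0" using l j periodic[of i j] by (auto simp: i_def)
    have "hder u n = (\<Sum>k<l. if k = i then hder u n else 0)" using i(1) by simp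
    moreover have "(if k = i then hder u n else 0) \<in> tstalk z" if "z \<in> loc_points (chart {\<nu> k})" for k z
      using that hder_tstalk_ray[of z i u n] i(2) tstalk_0[OF sub] by (auto simp: regular_def)
    ultimately show ?thesis unfolding Dec_def mem_Collect_eq by (intro exI[of _ "\<lambda>k. if k = i then hder u n else 0"]) blast
  qed
  have fmul: "fmul f (hder 0 n) \<in> Dec" if "f \<in> chart {}" for f n
    using that unfolding chart_def
  proof (induction rule: lspan_induct)
    case zero
    have "fmul 0 (hder 0 n) = 0" by (rule ext) simp
    then show ?case using Dec_0 by (simp only:)
  next
    case (monom c u) then show ?case by (simp add: fmul_chi_hder hder)
  next
    case (add f g)
    have "fmul (f + g) (hder 0 n) = fmul f (hder 0 n) + fmul g (hder 0 n)"
      by (rule ext) (simp add: distrib_right)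
    then show ?case using Dec_add[OF add.IH] by (simp only:)
  qed
  have chi: "chi v \<in> chart {}" for v by (rule chi_mem_chart) (simp add: dual_def)
  have "generic_point \<in> loc_points (chart {})"
    unfolding generic_point_def loc_points_def using zero_prime by blast
  then have der: "derivation D" using D tstalk_derivation by blast
  \<comment> \<open>The coefficients with respect to the invariant basis are regular on the whole
    torus, hence Laurent polynomials.\<close>
  have coeff: "D (chi v) / chi v \<in> chart {}" for v
  proof -
    have "D (chi v) \<in> z" if z: "z \<in> loc_points (chart {})" for z
      using tstalk_apply[OF D[OF z]] loc_points_superset[OF chart_subring z] chi by blast
    then obtain N where "1 ^ N * D (chi v) \<in> chart {}"
      using Inter_loc_points[OF chart_subring is_subring_1[OF chart_subring], of "{}" "D (chi v)"] by metis
    then have "D (chi v) * chi (- v) \<in> chart {}" using is_subring_mult[OF chart_subring _ chi] by simp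
    then show ?thesis by (simp add: chi_uminus divide_inverse)
  qed
  have "D \<in> Dec"
    by (subst derivation_decompose[OF der]) (rule Dec_add[OF fmul[OF coeff] fmul[OF coeff]])
  then show ?thesis using that unfolding Dec_def by blast
qed

lemma S_Int_Suc: "S k \<inter> S (Suc k) = {\<nu> (Suc k)}"
proof -
  have "\<nu> k \<noteq> \<nu> (Suc k)" using det_Suc[of k] by auto
  \<comment> \<open>Otherwise the determinant of two consecutive rays would be both 1 and
    -1.\<close>
  moreover have "\<nu> k \<noteq> \<nu> (Suc (Suc k))"
    using det_Suc[of k] det_Suc[of "Suc k"] det2_swap[of "\<nu> k" "\<nu> (Suc k)"] by auto
  ultimately show ?thesis by (auto simp: S_def)
qed

lemma \<nu>_mod: "\<nu> (i mod l) = \<nu> i"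
  unfolding periodic by simp

lemma S_cong: "\<nu> i = \<nu> j \<Longrightarrow> S i = S j"
  using periodic_Suc unfolding S_def by metis

text \<open>\<open>affine_H2\<close> with denominators exchanged for neighbourhoods; the finer cover
  consists of the loci where the functions \<open>g x\<close> are invertible.\<close>

lemma cech_H2_local:
  assumes U: "open_cover \<Sigma> U"
    and b: "\<And>x y z w. x \<in> TV_points \<Sigma> \<Longrightarrow> y \<in> TV_points \<Sigma> \<Longrightarrow> z \<in> TV_points \<Sigma> \<Longrightarrow>
      w \<in> U x \<Longrightarrow> w \<in> U y \<Longrightarrow> w \<in> U z \<Longrightarrow> b x y + b y z - b x z \<in> tstalk w"
  shows "\<exists>a N. (\<forall>x\<in>X i. openin (TV \<Sigma>) (N x) \<and> x \<in> N x \<and> N x \<subseteq> X i) \<and>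
    (\<forall>x\<in>X i. \<forall>y\<in>X i. \<forall>w\<in>N x \<inter> N y. b x y - a y + a x \<in> tstalk w)"
proof -
  obtain G where "affine_chart (chart (S i)) G" by (rule chart_generators[OF subset_refl])
  then interpret chart_i: affine_chart "chart (S i)" G .
  have "\<exists>f. f \<in> chart (S i) \<and> f \<noteq> 0 \<and> inverse f \<in> x \<and> (\<forall>z\<in>X i. inverse f \<in> z \<longrightarrow> z \<in> U x)" if x: "x \<in> X i" for x
  proof -
    have TV: "x \<in> TV_points \<Sigma>" by (rule X_TV[OF x])
    show ?thesis by (rule open_neighbourhood[OF subset_refl open_coverD[OF U TV] x]) blast
  qed
  then obtain f where f: "\<And>x. x \<in> X i \<Longrightarrow> f x \<in> chart (S i) \<and> f x \<noteq> 0 \<and> inverse (f x) \<in> x \<and>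
      (\<forall>z\<in>X i. inverse (f x) \<in> z \<longrightarrow> z \<in> U x)" by metis
  have f1: "f x \<in> chart (S i) \<and> f x \<noteq> 0 \<and> inverse (f x) \<in> x" if "x \<in> X i" for x using f[OF that] by blast
  have b1: "b x y + b y z - b x z \<in> tstalk w"
    if "x \<in> X i" "y \<in> X i" "z \<in> X i" "w \<in> X i" "inverse (f x) \<in> w" "inverse (f y) \<in> w" "inverse (f z) \<in> w" for x y z w
    using b[of x y z w] that f X_TV by blast
  have "\<exists>a g. (\<forall>x\<in>X i. g x \<in> chart (S i) \<and> g x \<noteq> 0 \<and> inverse (g x) \<in> x) \<and>
    (\<forall>x\<in>X i. \<forall>y\<in>X i. \<forall>w\<in>X i. inverse (g x) \<in> w \<longrightarrow> inverse (g y) \<in> w \<longrightarrow> b x y - a y + a x \<in> tstalk w)"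
    by (rule chart_i.affine_H2[of f b, OF f1 b1]) blast+
  then obtain a g where ag: "\<forall>x\<in>X i. g x \<in> chart (S i) \<and> g x \<noteq> 0 \<and> inverse (g x) \<in> x"
    "\<forall>x\<in>X i. \<forall>y\<in>X i. \<forall>w\<in>X i. inverse (g x) \<in> w \<longrightarrow> inverse (g y) \<in> w \<longrightarrow> b x y - a y + a x \<in> tstalk w"
    by (elim exE conjE)
  define N where "N x = {z \<in> X i. inverse (g x) \<in> z}" for x
  have "\<forall>x\<in>X i. openin (TV \<Sigma>) (N x) \<and> x \<in> N x \<and> N x \<subseteq> X i"
    unfolding N_def using ag(1) principal_open by blast
  moreover have "\<forall>x\<in>X i. \<forall>y\<in>X i. \<forall>w\<in>N x \<inter> N y. b x y - a y + a x \<in> tstalk w"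
    unfolding N_def using ag(2) by blast
  ultimately show ?thesis by blast
qed

lemma cech_H1_local:
  assumes T: "T \<subseteq> S i"
    and N: "\<And>x. x \<in> loc_points (chart T) \<Longrightarrow> openin (TV \<Sigma>) (N x) \<and> x \<in> N x"
    and b: "\<And>x z. x \<in> loc_points (chart T) \<Longrightarrow> z \<in> loc_points (chart T) \<Longrightarrow> z \<in> N x \<Longrightarrow> b x - b z \<in> tstalk z"
  shows "\<exists>h. \<forall>z\<in>loc_points (chart T). b z - h \<in> tstalk z"
proof -
  obtain G where "affine_chart (chart T) G" by (rule chart_generators[OF T])
  then interpret chart_T: affine_chart "chart T" G .
  have "\<exists>f. f \<in> chart T \<and> f \<noteq> 0 \<and> inverse f \<in> x \<and> (\<forall>z\<in>loc_points (chart T). inverse f \<in> z \<longrightarrow> z \<in> N x)"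
    if x: "x \<in> loc_points (chart T)" for x
  proof -
    have Nx: "openin (TV \<Sigma>) (N x)" "x \<in> N x" using N[OF x] by blast+
    show ?thesis by (rule open_neighbourhood[OF T Nx x]) blast
  qed
  then obtain f where f: "\<And>x. x \<in> loc_points (chart T) \<Longrightarrow> f x \<in> chart T \<and> f x \<noteq> 0 \<and> inverse (f x) \<in> x \<and>
      (\<forall>z\<in>loc_points (chart T). inverse (f x) \<in> z \<longrightarrow> z \<in> N x)" by metis
  have f1: "f x \<in> chart T \<and> f x \<noteq> 0 \<and> inverse (f x) \<in> x" if "x \<in> loc_points (chart T)" for x using f[OF that] by blast
  have b1: "b x - b z \<in> tstalk z"
    if "x \<in> loc_points (chart T)" "z \<in> loc_points (chart T)" "inverse (f x) \<in> z" for x z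
    using b[of x z] that f by blast
  show ?thesis by (rule chart_T.affine_H1[of f b, OF f1 b1]) blast+
qed

text \<open>The \<open>a i\<close> are local solutions on the charts and \<open>h i j\<close> their
  difference on an overlap. Global fields \<open>\<eta> i\<close> are sought that make the corrected
  solutions agree modulo regular fields.\<close>

lemma toric_H2:
  assumes l: "0 < l"
    and h: "\<And>i j z. z \<in> X i \<Longrightarrow> z \<in> X j \<Longrightarrow> a i z - a j z - h i j \<in> tstalk z"
  obtains \<eta> where "\<And>i j z. i < l \<Longrightarrow> j < l \<Longrightarrow> z \<in> X i \<Longrightarrow> z \<in> X j \<Longrightarrow> (a i z - \<eta> i) - (a j z - \<eta> j) \<in> tstalk z"
proof -
  \<comment> \<open>The obstruction to closing up: on the torus the differences of the
    \<open>a k\<close> telescope around the cycle, so this sum is regular there.\<close>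
  define H where "H = (\<Sum>k<l. h k (Suc k mod l))"
  have torus: "loc_points (chart {}) \<subseteq> X i" for i by (rule sub_chart_points) simp
  have "H \<in> tstalk z" if z: "z \<in> loc_points (chart {})" for z
  proof -
    have sub: "is_subring z" by (rule loc_points_subring[OF chart_subring z])
    obtain m where m: "l = Suc m" using l by (cases l) auto
    have "(\<Sum>k<l. a k z - a (Suc k mod l) z) = (\<Sum>k<m. a k z - a (Suc k) z) + (a m z - a 0 z)"
      unfolding m by (simp add: mod_Suc)
    also have "\<dots> = 0" using sum_lessThan_telescope'[of "\<lambda>k. a k z" m] by simp
    finally have "H = - (\<Sum>k<l. a k z - a (Suc k mod l) z - h k (Suc k mod l))"
      unfolding H_def sum_subtractf by simp
    moreover have "(\<Sum>k<l. a k z - a (Suc k mod l) z - h k (Suc k mod l)) \<in> tstalk z"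
      by (intro tstalk_sum[OF sub] h) (use torus z in blast)+
    ultimately show ?thesis using tstalk_uminus[OF sub] by simp
  qed
  then obtain t where t: "H = (\<Sum>k<l. t k)"
    "\<And>k z. k < l \<Longrightarrow> z \<in> loc_points (chart {\<nu> k}) \<Longrightarrow> t k \<in> tstalk z"
    using torus_field_decomposition[OF l, of H] by metis
  \<comment> \<open>Chosen so that the error between consecutive charts is exactly
    \<open>t (Suc k)\<close>, which is regular along the shared ray. For the step back to chart 0
    this uses that \<open>H\<close> is the sum of all \<open>t k\<close>.\<close>
  define \<eta> where "\<eta> i = (\<Sum>k<i. t (Suc k) - h k (Suc k))" for i
  define e where "e i z = a i z - \<eta> i" for i z
  have closing: "h k (Suc k mod l) - \<eta> k + \<eta> (Suc k mod l) = t (Suc k mod l)" if k: "k < l" for k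
  proof (cases "Suc k < l")
    case True
    then show ?thesis by (simp add: \<eta>_def)
  next
    case False
    then have lk: "l = Suc k" using k by simp
    have "H = (\<Sum>j<k. h j (Suc j)) + h k 0" unfolding H_def lk by (simp add: mod_Suc)
    moreover have "H = t 0 + (\<Sum>j<k. t (Suc j))" unfolding t(1) lk by (rule sum.lessThan_Suc_shift)
    ultimately show ?thesis unfolding lk by (simp add: \<eta>_def sum_subtractf algebra_simps)
  qed
  have step: "e k z - e (Suc k mod l) z \<in> tstalk z" if k: "k < l" and z: "z \<in> X k" "z \<in> X (Suc k mod l)" for k z
  proof -
    have sub: "is_subring z" by (rule X_subring[OF z(1)])
    have "S (Suc k mod l) = S (Suc k)" by (rule S_cong) (rule \<nu>_mod)
    then have "z \<in> loc_points (chart {\<nu> (Suc k mod l)})"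
      using chart_points_Int[OF z] S_Int_Suc[of k] \<nu>_mod[of "Suc k"] by simp
    then have "t (Suc k mod l) \<in> tstalk z" using t(2) l by simp
    then have "(a k z - a (Suc k mod l) z - h k (Suc k mod l)) + t (Suc k mod l) \<in> tstalk z"
      using h[OF z] tstalk_add[OF sub] by blast
    moreover have "(a k z - a (Suc k mod l) z - h k (Suc k mod l)) + t (Suc k mod l) = e k z - e (Suc k mod l) z"
      unfolding closing[OF k, symmetric] e_def by (simp add: algebra_simps)
    ultimately show ?thesis by simp
  qed
  \<comment> \<open>Charts that are not adjacent meet in the torus only, and there they are linked
    through the chain of consecutive charts.\<close>
  have from_0: "e 0 z - e i z \<in> tstalk z" if z: "z \<in> loc_points (chart {})" and i: "i < l" for i z
    using i
  proof (induction i)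
    case 0 show ?case unfolding diff_self by (rule tstalk_0[OF loc_points_subring[OF chart_subring z]])
  next
    case (Suc i)
    have sub: "is_subring z" by (rule loc_points_subring[OF chart_subring z])
    have "e i z - e (Suc i) z \<in> tstalk z" using step[of i z] Suc.prems torus z by auto
    moreover have "e 0 z - e i z \<in> tstalk z" by (rule Suc.IH) (use Suc.prems in simp)
    ultimately have "(e 0 z - e i z) + (e i z - e (Suc i) z) \<in> tstalk z" using tstalk_add[OF sub] by blast
    then show ?case by (simp only: add_diff_eq diff_add_cancel)
  qed
  show ?thesis
  proof (rule that[of \<eta>])
    fix i j z assume ij: "i < l" "j < l" and z: "z \<in> X i" "z \<in> X j"
    have sub: "is_subring z" by (rule X_subring[OF z(1)])
    have idx: "k' = Suc k mod l" if "\<nu> (Suc k) = \<nu> k'" "k' < l" for k k' using that by (simp add: periodic)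
    consider "\<nu> i = \<nu> j" | "\<nu> (Suc i) = \<nu> j" | "\<nu> (Suc j) = \<nu> i" | "S i \<inter> S j = {}"
      using periodic_Suc[of i j] unfolding S_def by (cases "\<nu> i = \<nu> j"; force)
    then have "e i z - e j z \<in> tstalk z"
    proof cases
      case 1
      then have "i = j" using ij by (simp add: periodic)
      then show ?thesis using tstalk_0[OF sub] by (simp only: diff_self)
    next
      case 2
      then show ?thesis using step[OF ij(1) z(1)] z(2) idx[OF 2 ij(2)] by simp
    next
      case 3
      then have "e j z - e i z \<in> tstalk z" using step[OF ij(2) z(2)] z(1) idx[OF 3 ij(1)] by simp
      from tstalk_uminus[OF sub this] show ?thesis by simp
    next
      case 4
      then have z0: "z \<in> loc_points (chart {})" using chart_points_Int[OF z] by simp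
      from tstalk_diff[OF sub from_0[OF z0 ij(2)] from_0[OF z0 ij(1)]] show ?thesis by simp
    qed
    then show "(a i z - \<eta> i) - (a j z - \<eta> j) \<in> tstalk z" by (simp add: e_def)
  qed
qed

lemma cocycle2_coboundary:
  assumes l: "0 < l" and c: "c \<in> tcocycles \<Sigma> 2"
  shows "c \<in> tcoboundaries \<Sigma> (Suc 1)"
proof -
  have c2: "c \<in> tcochains \<Sigma> 2" and cyc: "\<And>xs. length xs = 4 \<Longrightarrow> set xs \<subseteq> TV_points \<Sigma> \<Longrightarrow> cech_diff c xs = 0"
    using c unfolding cocycles_def by (auto simp: topspace_TV)
  obtain U where U: "open_cover \<Sigma> U" "\<And>xs. length xs = Suc 2 \<and> set xs \<subseteq> TV_points \<Sigma> \<Longrightarrow> section_on U xs (c xs)"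
    using c2 unfolding cochains_iff by blast
  define p where "p = localization (chart (S 0)) {0}"
  have "p \<in> X 0" unfolding p_def loc_points_def using zero_prime by blast
  then have p: "p \<in> TV_points \<Sigma>" by (rule X_TV)
  \<comment> \<open>The cone over the base point \<open>p\<close>: \<open>c\<close> is the
    coboundary of \<open>b\<close>, but the values of \<open>b\<close> need not be regular near
    their two arguments.\<close>
  define b where "b x y = c [p, x, y]" for x y
  have cb: "c [x, y, z] = b y z - b x z + b x y"
    if "x \<in> TV_points \<Sigma>" "y \<in> TV_points \<Sigma>" "z \<in> TV_points \<Sigma>" for x y z
  proof -
    have "c [x, y, z] - b y z + b x z - b x y = 0"
      using cyc[of "[p, x, y, z]"] that p unfolding cech_diff_quadruple b_def by simp
    then show ?thesis by (simp add: algebra_simps)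
  qed
  have coc: "b x y + b y z - b x z \<in> tstalk w"
    if xyz: "x \<in> TV_points \<Sigma>" "y \<in> TV_points \<Sigma>" "z \<in> TV_points \<Sigma>" and w: "w \<in> U x" "w \<in> U y" "w \<in> U z" for x y z w
  proof -
    have "section_on U [x, y, z] (c [x, y, z])" using U(2)[of "[x, y, z]"] xyz by simp
    then have "c [x, y, z] \<in> tstalk w" by (rule section_onD) (use w in auto)
    moreover have "c [x, y, z] = b x y + b y z - b x z" unfolding cb[OF xyz] by (simp add: algebra_simps)
    ultimately show ?thesis by simp
  qed
  define Q where "Q i a N \<longleftrightarrow> (\<forall>x\<in>X i. openin (TV \<Sigma>) (N x) \<and> x \<in> N x \<and> N x \<subseteq> X i) \<and>
    (\<forall>x\<in>X i. \<forall>y\<in>X i. \<forall>w\<in>N x \<inter> N y. b x y - a y + a x \<in> tstalk w)"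
    for i :: nat and a :: "ratfun set \<Rightarrow> ratfun \<Rightarrow> ratfun" and N
  have "\<exists>a N. Q i a N" for i unfolding Q_def by (rule cech_H2_local[OF U(1) coc])
  then obtain a N where Q: "\<And>i. Q i (a i) (N i)" by metis
  have N: "openin (TV \<Sigma>) (N i x)" "x \<in> N i x" "N i x \<subseteq> X i" if "x \<in> X i" for i x
    using Q[of i] that unfolding Q_def by blast+
  have a: "b x y - a i y + a i x \<in> tstalk w" if "x \<in> X i" "y \<in> X i" "w \<in> N i x" "w \<in> N i y" for i x y w
    using Q[of i] that unfolding Q_def by blast
  \<comment> \<open>Both \<open>a i\<close> and \<open>a j\<close> solve the equation for the same
    \<open>b\<close>, so their difference is locally constant modulo regular fields.\<close>
  have "\<exists>h. \<forall>z\<in>loc_points (chart (S i \<inter> S j)). a i z - a j z - h \<in> tstalk z" for i j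
  proof (rule cech_H1_local[of _ i "\<lambda>x. N i x \<inter> N j x"])
    show "S i \<inter> S j \<subseteq> S i" by blast
    have sub: "z \<in> X i" "z \<in> X j" if "z \<in> loc_points (chart (S i \<inter> S j))" for z
      using sub_chart_points[of "S i \<inter> S j"] that by blast+
    show "openin (TV \<Sigma>) (N i x \<inter> N j x) \<and> x \<in> N i x \<inter> N j x" if "x \<in> loc_points (chart (S i \<inter> S j))" for x
      using N sub[OF that] by blast
    show "a i x - a j x - (a i z - a j z) \<in> tstalk z"
      if x: "x \<in> loc_points (chart (S i \<inter> S j))" and z: "z \<in> loc_points (chart (S i \<inter> S j))" "z \<in> N i x \<inter> N j x" for x z
    proof -
      have "b x z - a i z + a i x \<in> tstalk z" "b x z - a j z + a j x \<in> tstalk z"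
        using a sub[OF x] sub[OF z(1)] N z(2) by blast+
      from tstalk_diff[OF X_subring[OF sub(1)[OF z(1)]] this] show ?thesis by (simp add: algebra_simps)
    qed
  qed
  then obtain h where h: "\<And>i j z. z \<in> loc_points (chart (S i \<inter> S j)) \<Longrightarrow> a i z - a j z - h i j \<in> tstalk z" by metis
  obtain \<eta> where \<eta>: "\<And>i j z. i < l \<Longrightarrow> j < l \<Longrightarrow> z \<in> X i \<Longrightarrow> z \<in> X j \<Longrightarrow> (a i z - \<eta> i) - (a j z - \<eta> j) \<in> tstalk z"
    using toric_H2[OF l, of a h] h chart_points_Int by metis
  have "\<exists>i<l. x \<in> X i" if x: "x \<in> TV_points \<Sigma>" for x
  proof -
    obtain i where "x \<in> X i" using x unfolding TV_points_eq by blast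
    moreover have "S (i mod l) = S i" by (rule S_cong) (rule \<nu>_mod)
    ultimately show ?thesis using l by (intro exI[of _ "i mod l"]) simp
  qed
  then obtain \<iota> where \<iota>: "\<And>x. x \<in> TV_points \<Sigma> \<Longrightarrow> \<iota> x < l \<and> x \<in> X (\<iota> x)" by metis
  define A where "A x = a (\<iota> x) x - \<eta> (\<iota> x)" for x
  define W where "W x = N (\<iota> x) x \<inter> U x" for x
  \<comment> \<open>Subtracting the coboundary of \<open>A\<close> leaves the coboundary of
    \<open>b\<close> unchanged and makes all values regular.\<close>
  define E where "E xs = b (xs ! 0) (xs ! 1) - A (xs ! 1) + A (xs ! 0)" for xs
  have W: "open_cover \<Sigma> W"
    unfolding open_cover_def W_def using N \<iota> open_coverD[OF U(1)] by (auto intro!: openin_Int)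
  \<comment> \<open>The point \<open>w\<close> serves as an intermediate argument: from
    \<open>x\<close> to \<open>w\<close> the solution of the chart of \<open>x\<close> applies, from
    \<open>w\<close> to \<open>y\<close> that of the chart of \<open>y\<close>, and the two agree at
    \<open>w\<close> after correction by \<open>\<eta>\<close>.\<close>
  have key: "b x y - A y + A x \<in> tstalk w"
    if x: "x \<in> TV_points \<Sigma>" and y: "y \<in> TV_points \<Sigma>" and w: "w \<in> W x" "w \<in> W y" for x y w
  proof -
    define i j where "i = \<iota> x" and "j = \<iota> y"
    have ij: "i < l" "j < l" "x \<in> X i" "y \<in> X j" using \<iota> x y by (auto simp: i_def j_def)
    have wN: "w \<in> N i x" "w \<in> N j y" "w \<in> U x" "w \<in> U y" using w by (auto simp: W_def i_def j_def)
    have wX: "w \<in> X i" "w \<in> X j" using N(3) ij wN by blast+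
    have sub: "is_subring w" by (rule X_subring[OF wX(1)])
    have wTV: "w \<in> TV_points \<Sigma>" by (rule X_TV[OF wX(1)])
    have 1: "b x w + b w y - b x y \<in> tstalk w"
      by (rule coc[OF x wTV y wN(3) open_coverD(2)[OF U(1) wTV] wN(4)])
    have 2: "b x w - a i w + a i x \<in> tstalk w" by (rule a[OF ij(3) wX(1) wN(1) N(2)[OF wX(1)]])
    have 3: "b w y - a j y + a j w \<in> tstalk w" by (rule a[OF wX(2) ij(4) N(2)[OF wX(2)] wN(2)])
    have 4: "(a i w - \<eta> i) - (a j w - \<eta> j) \<in> tstalk w" by (rule \<eta>[OF ij(1,2) wX])
    have "((b x w - a i w + a i x) + (b w y - a j y + a j w)) + ((a i w - \<eta> i) - (a j w - \<eta> j))
        - (b x w + b w y - b x y) \<in> tstalk w"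
      by (rule tstalk_diff[OF sub tstalk_add[OF sub tstalk_add[OF sub 2 3] 4] 1])
    then show ?thesis unfolding A_def i_def[symmetric] j_def[symmetric] by (simp add: algebra_simps)
  qed
  have "E \<in> tcochains \<Sigma> 1"
    unfolding cochains_iff
  proof (intro exI[of _ W] conjI W allI impI)
    fix xs :: "ratfun set list" assume xs: "length xs = Suc 1 \<and> set xs \<subseteq> TV_points \<Sigma>"
    then have "length xs = 2" by simp
    then obtain x y where xy: "xs = [x, y]" by (rule length_2_E)
    show "section_on W xs (E xs)"
      by (rule section_onI[OF W]) (use xs key[of x y] in \<open>auto simp: xy E_def\<close>)
  qed
  moreover have "c xs = cech_diff E xs" if xs: "length xs = 1 + 2" "set xs \<subseteq> TV_points \<Sigma>" for xs
  proof -
    have "length xs = 3" using xs(1) by simp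
    then obtain x y z where xyz: "xs = [x, y, z]" by (rule length_3_E)
    then show ?thesis using cb[of x y z] xs(2) by (simp add: cech_diff_triple E_def algebra_simps)
  qed
  ultimately show ?thesis
    using c2 by (auto simp: topspace_TV numeral_2_eq_2 intro!: bexI[of _ E])
qed

lemma T2_trivial:
  assumes l: "0 < l"
  shows "T2 \<Sigma> = {tclass \<Sigma> 2 0}"
proof -
  have eq: "tclass \<Sigma> 2 c = tclass \<Sigma> 2 0" if c: "c \<in> tcocycles \<Sigma> 2" for c
  proof -
    have "c - 0 \<in> tcoboundaries \<Sigma> (Suc 1)" using cocycle2_coboundary[OF l c] by simp
    moreover have "c \<in> tcocycles \<Sigma> (Suc 1)" "0 \<in> tcocycles \<Sigma> (Suc 1)"
      using c cocycles_0 by (simp_all add: numeral_2_eq_2)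
    ultimately have "tclass \<Sigma> (Suc 1) c = tclass \<Sigma> (Suc 1) 0" using class_eq_iff by blast
    then show ?thesis by (simp add: numeral_2_eq_2)
  qed
  show ?thesis
    unfolding T2_def cohomology_def
  proof (intro subset_antisym subsetI)
    fix \<xi> assume "\<xi> \<in> tclass \<Sigma> 2 ` tcocycles \<Sigma> 2"
    then show "\<xi> \<in> {tclass \<Sigma> 2 0}" using eq by blast
  next
    fix \<xi> assume "\<xi> \<in> {tclass \<Sigma> 2 0}"
    then show "\<xi> \<in> tclass \<Sigma> 2 ` tcocycles \<Sigma> 2" using cocycles_0 by blast
  qed
qed

end

section \<open>The graded pieces of the deformation space\<close>

definition csc :: "complex \<Rightarrow> complex \<times> complex \<Rightarrow> complex \<times> complex" where
  "csc c n = (c * fst n, c * snd n)"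

definition cpt :: "latt \<Rightarrow> complex \<times> complex" where
  "cpt m = (of_int (fst m), of_int (snd m))"

lemma csc_0 [simp]: "csc 0 n = 0" "csc c 0 = 0"
  and csc_1 [simp]: "csc 1 n = n"
  and csc_csc: "csc c (csc d n) = csc (c * d) n"
  and csc_diff: "csc (c - d) n = csc c n - csc d n"
  and csc_uminus: "csc (- 1) n = - n"
  and csc_diff_right: "csc c (m - n) = csc c m - csc c n"
  by (simp_all add: csc_def prod_eq_iff algebra_simps)

lemma npair_csc_cpt: "npair (csc c (cpt m)) v = c * of_int (lpair m v)"
  by (simp add: npair_def csc_def cpt_def lpair_def algebra_simps)

lemma hder_csc: "hder u (csc c n) = fmul (rconst c) (hder u n)"
  using fmul_chi_hder[of c 0 u n] by (simp add: csc_def)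

lemma hder_sum: "hder u (\<Sum>k\<in>A. f k) = (\<Sum>k\<in>A. hder u (f k))"
  by (induction A rule: infinite_finite_induct) (simp_all add: hder_0 hder_add)

section \<open>Invariant divisors, fixed points and compatible families\<close>

context fan_cycle
begin

lemma periodic_add_l: "\<nu> (i + l) = \<nu> i"
  unfolding periodic by simp

lemma regular_alt: "regular \<nu>' u n \<longleftrightarrow> lpair \<nu>' u \<ge> 0 \<or> n = 0 \<or> lpair \<nu>' u = - 1 \<and> (\<exists>c. n = csc c (cpt \<nu>'))"
  by (simp add: regular_def csc_def cpt_def)

lemma regular_0 [simp]: "regular \<nu>' u 0"
  by (simp add: regular_def)

lemma regular_csc: "regular \<nu>' u n \<Longrightarrow> regular \<nu>' u (csc c n)"
  unfolding regular_alt by (metis csc_0(2) csc_csc)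

lemma regular_uminus: "regular \<nu>' u n \<Longrightarrow> regular \<nu>' u (- n)"
  using regular_csc[of \<nu>' u n "- 1"] by (simp add: csc_uminus)

text \<open>The generic point of the invariant divisor of the ray \<open>\<nu> i\<close>.\<close>

definition divisor_point :: "nat \<Rightarrow> ratfun set" where
  "divisor_point i = localization (chart {\<nu> i}) (orbit_ideal {\<nu> i})"

text \<open>The torus-fixed point of the chart, at which its two invariant divisors meet.\<close>

definition fixed_point :: "nat \<Rightarrow> ratfun set" where
  "fixed_point i = localization (chart (S i)) (orbit_ideal (S i))"

lemma fixed_point_X: "fixed_point i \<in> X i"
  unfolding fixed_point_def loc_points_def using orbit_ideal_prime by blast

lemma fixed_point_TV: "fixed_point i \<in> TV_points \<Sigma>"
  by (rule X_TV[OF fixed_point_X])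

lemma chi_not_mem_fixed_point: "chi (- w1 i) \<notin> fixed_point i" "chi (- w2 i) \<notin> fixed_point i"
proof -
  have w: "w1 i \<in> dual (S i)" "w2 i \<in> dual (S i)" by (simp_all add: dual_def S_def)
  have "w1 i \<in> {u \<in> dual (S i). \<exists>n\<in>S i. lpair n u > 0}"
    using w by (auto intro!: bexI[of _ "\<nu> i"])
  moreover have "w2 i \<in> {u \<in> dual (S i). \<exists>n\<in>S i. lpair n u > 0}"
    using w by (auto intro!: bexI[of _ "\<nu> (Suc i)"])
  ultimately have "chi (w1 i) \<in> orbit_ideal (S i)" "chi (w2 i) \<in> orbit_ideal (S i)"
    unfolding orbit_ideal_def by (simp_all only: chi_mem_lspan_iff)
  then show "chi (- w1 i) \<notin> fixed_point i" "chi (- w2 i) \<notin> fixed_point i"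
    using localization_unit_iff[OF chart_subring orbit_ideal_prime chi_mem_chart] w chi_nonzero
    unfolding fixed_point_def chi_uminus by metis+
qed

text \<open>\<open>w\<close> gives the equation of the divisor of \<open>\<nu> k\<close> on the
  chart. Since it vanishes at \<open>x\<close> and generates the prime of the divisor, the generic
  point of the divisor is a generization of \<open>x\<close>; \<open>m\<close> inverts the equation
  of the other divisor.\<close>

lemma divisor_point_mem_aux:
  assumes U: "openin (TV \<Sigma>) U" "x \<in> U" "x \<in> X i" and k: "\<nu> k \<in> S i"
    and w: "w \<in> dual (S i)" "chi (- w) \<notin> x" "\<And>v. v \<in> dual (S i) \<Longrightarrow> lpair (\<nu> k) v > 0 \<Longrightarrow> v - w \<in> dual (S i)"
    and m: "lpair (\<nu> k) m = 0" "\<And>n. n \<in> S i \<Longrightarrow> lpair n m \<ge> 0" "\<And>n. n \<in> S i \<Longrightarrow> n \<notin> {\<nu> k} \<Longrightarrow> lpair n m > 0"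
  shows "divisor_point k \<in> U"
proof -
  obtain P where P: "is_prime (chart (S i)) P" "x = localization (chart (S i)) P" by (rule loc_pointsE[OF U(3)])
  have wP: "chi w \<in> P"
    using localization_unit_iff[OF chart_subring P(1) chi_mem_chart[OF w(1)]] w(2) chi_nonzero
    unfolding P(2) chi_uminus by metis
  let ?Q = "orbit_ideal {\<nu> k}"
  have sub: "chart (S i) \<subseteq> chart {\<nu> k}" by (rule chart_mono) (use k in blast)
  have clear: "\<exists>s\<in>chart (S i) - ?Q. s * b \<in> chart (S i)" if b: "b \<in> chart {\<nu> k}" for b
  proof -
    obtain N where N: "chi m ^ N * b \<in> chart (S i)" by (rule extend_to_chart[OF finite_S m(2,3) b])
    have "chi m ^ N \<in> chart (S i)"
      using m(2) by (intro is_subring_power[OF chart_subring] chi_mem_chart) (simp add: dual_def)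
    moreover have "chi m ^ N \<notin> ?Q"
      unfolding chi_scale[symmetric] orbit_ideal_def chi_mem_lspan_iff by (simp add: scale_simps m(1))
    ultimately show ?thesis using N by blast
  qed
  note Q = localization_subring_eq[OF chart_subring chart_subring orbit_ideal_prime sub clear]
  have "chart (S i) \<inter> ?Q \<subseteq> P"
  proof
    fix f assume "f \<in> chart (S i) \<inter> ?Q"
    then have "f \<in> lspan (dual (S i) \<inter> {u \<in> dual {\<nu> k}. \<exists>n\<in>{\<nu> k}. lpair n u > 0})"
      unfolding chart_def orbit_ideal_def using lspan_Int by blast
    then show "f \<in> P"
    proof (induction rule: lspan_induct)
      case zero show ?case by (rule prime_mem_0[OF P(1)])
    next
      case (monom c v)
      then have "v - w \<in> dual (S i)" using w(3) by auto
      then have "rconst c * chi (v - w) \<in> chart (S i)" unfolding chart_def by (rule lspan_term)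
      then have "(rconst c * chi (v - w)) * chi w \<in> P"
        using P(1) wP unfolding is_prime_def is_ideal_def by blast
      then show ?case by (simp add: chi_diff)
    next
      case (add f g) then show ?case using P(1) unfolding is_prime_def is_ideal_def by blast
    qed
  qed
  then have "localization (chart (S i)) (chart (S i) \<inter> ?Q) \<in> U"
    using open_generization[OF U(1) P(1) Q(1)] U(2) P(2) by blast
  then show ?thesis unfolding divisor_point_def using Q(2) by simp
qed

lemma divisor_point_mem:
  assumes U: "openin (TV \<Sigma>) U" "x \<in> U" "x \<in> X i"
  shows "chi (- w1 i) \<notin> x \<Longrightarrow> divisor_point i \<in> U" "chi (- w2 i) \<notin> x \<Longrightarrow> divisor_point (Suc i) \<in> U"
proof -
  show "divisor_point i \<in> U" if "chi (- w1 i) \<notin> x"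
    by (rule divisor_point_mem_aux[OF U, of i "w1 i" "w2 i"]) (use that in \<open>auto simp: S_def dual_def lpair_simps\<close>)
  show "divisor_point (Suc i) \<in> U" if "chi (- w2 i) \<notin> x"
    by (rule divisor_point_mem_aux[OF U, of "Suc i" "w2 i" "w1 i"]) (use that in \<open>auto simp: S_def dual_def lpair_simps\<close>)
qed

lemma npair_expand: "n = csc (npair n (w1 i)) (cpt (\<nu> i)) + csc (npair n (w2 i)) (cpt (\<nu> (Suc i)))"
proof -
  have d: "of_int (fst (\<nu> i)) * of_int (snd (\<nu> (Suc i))) - of_int (snd (\<nu> i)) * of_int (fst (\<nu> (Suc i))) = (1::complex)"
    using arg_cong[OF det_Suc[of i], of "of_int :: int \<Rightarrow> complex"] by (simp add: det2_def)
  have "csc (npair n (w1 i)) (cpt (\<nu> i)) + csc (npair n (w2 i)) (cpt (\<nu> (Suc i))) =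
    csc (of_int (fst (\<nu> i)) * of_int (snd (\<nu> (Suc i))) - of_int (snd (\<nu> i)) * of_int (fst (\<nu> (Suc i)))) n"
    by (simp add: csc_def cpt_def npair_def w1_def w2_def prod_eq_iff algebra_simps)
  then show ?thesis unfolding d by simp
qed

text \<open>Converse of \<open>hder_tstalk_ray\<close>. The characters of \<open>w1 i\<close> and
  \<open>w2 i\<close> have order 1 and 0 along the divisor, so a nonzero pairing of \<open>n\<close>
  with \<open>w2 i\<close> forbids every pole, and one with \<open>w1 i\<close> allows order -1 at
  worst.\<close>

lemma tstalk_divisor_point:
  assumes "hder u n \<in> tstalk (divisor_point i)"
  shows "regular (\<nu> i) u n"
proof -
  let ?x = "divisor_point i"
  have sub: "is_subring ?x" unfolding divisor_point_def by (rule localization_subring[OF chart_subring orbit_ideal_prime])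
  have cx: "chart {\<nu> i} \<subseteq> ?x" unfolding divisor_point_def by (rule localization_superset[OF chart_subring orbit_ideal_prime])
  have order: "lpair (\<nu> i) (u + w) \<ge> 0" if w: "w \<in> dual {\<nu> i}" "npair n w \<noteq> 0" for w
  proof -
    have "chi w \<in> ?x" using cx chi_mem_chart[OF w(1)] by blast
    then have "rconst (npair n w) * chi (u + w) \<in> ?x" using tstalk_apply[OF assms] hder_chi by metis
    moreover have "rconst (1 / npair n w) \<in> ?x" using cx rconst_mem_chart by blast
    ultimately have "rconst (1 / npair n w) * (rconst (npair n w) * chi (u + w)) \<in> ?x"
      using is_subring_mult[OF sub] by blast
    moreover have "rconst (1 / npair n w) * (rconst (npair n w) * chi (u + w)) = chi (u + w)"
      using w(2) by (simp add: mult.assoc[symmetric] rconst_mult[symmetric])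
    ultimately show ?thesis using chi_mem_divisor_ring unfolding divisor_point_def by simp
  qed
  have 1: "lpair (\<nu> i) u \<ge> - 1" if "npair n (w1 i) \<noteq> 0" using order[OF _ that] by (simp add: dual_def lpair_simps)
  have 2: "lpair (\<nu> i) u \<ge> 0" if "npair n (w2 i) \<noteq> 0" using order[OF _ that] by (simp add: dual_def lpair_simps)
  show ?thesis
  proof (cases "lpair (\<nu> i) u \<ge> 0")
    case True then show ?thesis by (simp add: regular_def)
  next
    case False
    then have w2: "npair n (w2 i) = 0" using 2 by blast
    then have n: "n = csc (npair n (w1 i)) (cpt (\<nu> i))" using npair_expand[of n i] by simp
    show ?thesis
    proof (cases "npair n (w1 i) = 0")
      case True
      then have "n = 0" using n by (metis csc_0(1))
      then show ?thesis by simp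
    next
      case nz: False
      then have "lpair (\<nu> i) u = - 1" using 1 False by simp
      then show ?thesis unfolding regular_alt using n by blast
    qed
  qed
qed

text \<open>Families of homogeneous fields on the charts whose differences are regular on the overlaps.\<close>

definition compatible :: "latt \<Rightarrow> (nat \<Rightarrow> complex \<times> complex) \<Rightarrow> bool" where
  "compatible u m \<longleftrightarrow> (\<forall>i<l. regular (\<nu> (Suc i)) u (m (Suc i mod l) - m i))"

lemma compatible_tstalk:
  assumes m: "compatible u m" and ij: "i < l" "j < l" and z: "z \<in> X i" "z \<in> X j"
  shows "hder u (m j - m i) \<in> tstalk z"
proof -
  have sub: "is_subring z" by (rule X_subring[OF z(1)])
  have adj: "hder u (m j - m i) \<in> tstalk z"
    if adj: "\<nu> (Suc i) = \<nu> j" "i < l" "j < l" "z \<in> X i" "z \<in> X j" for i j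
  proof -
    have j: "j = Suc i mod l" using adj(1,3) by (simp add: periodic)
    have "S j = S (Suc i)" using S_cong adj(1) by metis
    then have "z \<in> loc_points (chart {\<nu> (Suc i)})" using chart_points_Int[OF adj(4,5)] S_Int_Suc[of i] by simp
    then show ?thesis using hder_tstalk_ray m adj(2) unfolding compatible_def j by blast
  qed
  consider "\<nu> i = \<nu> j" | "\<nu> (Suc i) = \<nu> j" | "\<nu> (Suc j) = \<nu> i" | "S i \<inter> S j = {}"
    using periodic_Suc[of i j] unfolding S_def by (cases "\<nu> i = \<nu> j"; force)
  then show ?thesis
  proof cases
    case 1
    then have "i = j" using ij by (simp add: periodic)
    then show ?thesis using tstalk_0[OF sub] by (simp only: diff_self hder_0)
  next
    case 2 then show ?thesis using adj ij z by blast
  next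
    case 3
    then have "hder u (m i - m j) \<in> tstalk z" using adj ij z by blast
    then have "0 - hder u (m i - m j) \<in> tstalk z" using tstalk_diff[OF sub tstalk_0[OF sub]] by blast
    then show ?thesis by (simp only: hder_0[of u, symmetric] hder_diff[symmetric] diff_0 minus_diff_eq)
  next
    case 4
    then have "z \<in> loc_points (chart {})" using chart_points_Int[OF z] by simp
    then show ?thesis by (rule hder_tstalk_torus)
  qed
qed

definition chart_index :: "ratfun set \<Rightarrow> nat" where
  "chart_index x = (SOME i. i < l \<and> x \<in> X i)"

lemma chart_index:
  assumes "0 < l" "x \<in> TV_points \<Sigma>"
  shows "chart_index x < l" "x \<in> X (chart_index x)"
proof -
  obtain i where "x \<in> X i" using assms(2) unfolding TV_points_eq by blast
  moreover have "S (i mod l) = S i" by (rule S_cong) (rule \<nu>_mod)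
  ultimately have "\<exists>i. i < l \<and> x \<in> X i" using assms(1) by (intro exI[of _ "i mod l"]) simp
  from someI_ex[OF this] show "chart_index x < l" "x \<in> X (chart_index x)"
    unfolding chart_index_def by blast+
qed

text \<open>The formal coboundary of the family, each point being assigned to one chart that
  contains it.\<close>

definition family_cocycle :: "latt \<Rightarrow> (nat \<Rightarrow> complex \<times> complex) \<Rightarrow> ratfun set list \<Rightarrow> ratfun \<Rightarrow> ratfun" where
  "family_cocycle u m xs = hder u (m (chart_index (xs ! 1)) - m (chart_index (xs ! 0)))"

lemma chart_cover:
  assumes l: "0 < l"
  shows "open_cover \<Sigma> (\<lambda>x. X (chart_index x))"
  unfolding open_cover_def using chart_open chart_index[OF l] by blast

lemma family_cocycle:
  assumes l: "0 < l" and m: "compatible u m"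
  shows "family_cocycle u m \<in> tcocycles \<Sigma> (Suc 0)"
proof -
  have "family_cocycle u m \<in> tcochains \<Sigma> (Suc 0)"
    unfolding cochains_iff
  proof (intro exI[of _ "\<lambda>x. X (chart_index x)"] conjI chart_cover[OF l] allI impI)
    fix xs :: "ratfun set list" assume xs: "length xs = Suc (Suc 0) \<and> set xs \<subseteq> TV_points \<Sigma>"
    then have "length xs = 2" by simp
    then obtain x y where xy: "xs = [x, y]" by (rule length_2_E)
    then have TV: "x \<in> TV_points \<Sigma>" "y \<in> TV_points \<Sigma>" using xs by simp_all
    show "section_on (\<lambda>x. X (chart_index x)) xs (family_cocycle u m xs)"
      unfolding section_on_def family_cocycle_def
      using compatible_tstalk[OF m chart_index(1)[OF l TV(1)] chart_index(1)[OF l TV(2)]] derivation_hder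
      by (simp add: xy)
  qed
  moreover have "cech_diff (family_cocycle u m) xs = 0" if xs: "length xs = Suc 0 + 2" for xs :: "ratfun set list"
  proof -
    have "length xs = 3" using xs by simp
    then obtain x y z where "xs = [x, y, z]" by (rule length_3_E)
    then show ?thesis
      by (simp only: cech_diff_triple family_cocycle_def hder_diff[symmetric] hder_add[symmetric])
        (simp add: hder_0)
  qed
  ultimately show ?thesis unfolding cocycles_def by blast
qed

text \<open>A base point \<open>p\<close> trivializes the cocycle formally: \<open>n x\<close> is
  read off from \<open>c [p, x]\<close>, and the cocycle condition determines the other
  values.\<close>

lemma homogeneous_cocycle:
  assumes c: "c \<in> tcocycles \<Sigma> (Suc 0)"
    and hom: "\<And>xs. length xs = 2 \<Longrightarrow> set xs \<subseteq> TV_points \<Sigma> \<Longrightarrow> homogeneous_derivation u (c xs)"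
  obtains U n where "open_cover \<Sigma> U"
    "\<And>x y. x \<in> TV_points \<Sigma> \<Longrightarrow> y \<in> TV_points \<Sigma> \<Longrightarrow> c [x, y] = hder u (n y - n x)"
    "\<And>x y z. x \<in> TV_points \<Sigma> \<Longrightarrow> y \<in> TV_points \<Sigma> \<Longrightarrow> z \<in> U x \<Longrightarrow> z \<in> U y \<Longrightarrow> hder u (n y - n x) \<in> tstalk z"
proof -
  have c1: "c \<in> tcochains \<Sigma> (Suc 0)" and cyc: "\<And>xs. length xs = 3 \<Longrightarrow> set xs \<subseteq> TV_points \<Sigma> \<Longrightarrow> cech_diff c xs = 0"
    using c unfolding cocycles_def by (auto simp: topspace_TV)
  obtain U where U: "open_cover \<Sigma> U" "\<And>xs. length xs = Suc (Suc 0) \<and> set xs \<subseteq> TV_points \<Sigma> \<Longrightarrow> section_on U xs (c xs)"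
    using c1 unfolding cochains_iff by blast
  define p where "p = fixed_point 0"
  have p: "p \<in> TV_points \<Sigma>" unfolding p_def by (rule fixed_point_TV)
  have "\<exists>n. c [p, x] = hder u n" if "x \<in> TV_points \<Sigma>" for x
  proof -
    have "homogeneous_derivation u (c [p, x])" by (rule hom) (use that p in simp_all)
    then obtain n where "c [p, x] = hder u n" by (rule homogeneous_imp_hder)
    then show ?thesis by blast
  qed
  then obtain n where n: "\<And>x. x \<in> TV_points \<Sigma> \<Longrightarrow> c [p, x] = hder u (n x)" by metis
  have cn: "c [x, y] = hder u (n y - n x)" if xy: "x \<in> TV_points \<Sigma>" "y \<in> TV_points \<Sigma>" for x y
  proof -
    have "c [x, y] - c [p, y] + c [p, x] = 0"
      using cyc[of "[p, x, y]"] xy p unfolding cech_diff_triple by simp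
    then have "c [x, y] = c [p, y] - c [p, x]" by (simp add: algebra_simps)
    then show ?thesis using n xy by (simp only: hder_diff)
  qed
  moreover have "hder u (n y - n x) \<in> tstalk z"
    if xy: "x \<in> TV_points \<Sigma>" "y \<in> TV_points \<Sigma>" and z: "z \<in> U x" "z \<in> U y" for x y z
  proof -
    have "section_on U [x, y] (c [x, y])" using U(2)[of "[x, y]"] xy by simp
    then have "c [x, y] \<in> tstalk z" by (rule section_onD) (use z in auto)
    then show ?thesis using cn[OF xy] by simp
  qed
  ultimately show ?thesis by (rule that[OF U(1)])
qed

text \<open>The conclusion says that the degree u part of \<open>E\<close> kills
  \<open>chi w\<close>. The exponents with this property form a group by the product rule, so it
  suffices to treat the dual basis.\<close>

lemma no_negative_component:
  assumes E: "derivation E" "\<And>x. x \<in> X i \<Longrightarrow> E \<in> tstalk x"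
    and neg: "lpair (\<nu> i) u < 0" "lpair (\<nu> (Suc i)) u < 0"
  shows "E (chi w) \<in> lspan (- {u + w})"
proof -
  have chart: "E (chi v) \<in> chart (S i)" if v: "v \<in> dual (S i)" for v
  proof -
    have "E (chi v) \<in> z" if z: "z \<in> X i" for z
      using tstalk_apply[OF E(2)[OF z]] loc_points_superset[OF chart_subring z] chi_mem_chart[OF v] by blast
    then obtain N where "1 ^ N * E (chi v) \<in> chart (S i)"
      using Inter_loc_points[OF chart_subring is_subring_1[OF chart_subring], of "S i" "E (chi v)"] by metis
    then show ?thesis by simp
  qed
  define M where "M = {w. E (chi w) \<in> lspan (- {u + w})}"
  have shift: "chi v * f \<in> lspan (- {u + (v + v')})" if "f \<in> lspan (- {u + v'})" for v v' f
    by (rule lspan_term_mult[OF that]) auto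
  have M0: "0 \<in> M" by (simp add: M_def derivation_1[OF E(1)])
  have M_add: "v + v' \<in> M" if "v \<in> M" "v' \<in> M" for v v'
  proof -
    have "chi v * E (chi v') + chi v' * E (chi v) \<in> lspan (- {u + (v + v')})"
      using shift[of "E (chi v')" v' v] shift[of "E (chi v)" v v'] that
      by (intro lspan_add) (simp_all add: M_def add.commute)
    then show ?thesis by (simp add: M_def chi_add derivation_times[OF E(1)])
  qed
  have M_uminus: "- v \<in> M" if "v \<in> M" for v
  proof -
    have "- (chi (- v - v) * E (chi v)) \<in> lspan (- {u + ((- v - v) + v)})"
      using shift[of "E (chi v)" v "- v - v"] that by (intro lspan_uminus) (simp add: M_def)
    moreover have "- (chi (- v - v) * E (chi v)) = E (chi (- v))"
      by (simp add: chi_diff chi_uminus derivation_inverse[OF E(1)] divide_inverse)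
    ultimately show ?thesis by (simp add: M_def)
  qed
  have gen: "v \<in> M" if v: "v \<in> dual (S i)" and n: "n \<in> S i" "lpair n (u + v) < 0" for v n
  proof -
    have "u + v \<notin> dual (S i)" using n unfolding dual_def by force
    then have "dual (S i) \<subseteq> - {u + v}" by blast
    then show ?thesis using chart[OF v] lspan_mono unfolding M_def chart_def by blast
  qed
  \<comment> \<open>\<open>w1 i\<close> vanishes on \<open>\<nu> (Suc i)\<close> and
    \<open>w2 i\<close> on \<open>\<nu> i\<close>, so adding either to u leaves one negative value,
    and a regular function has no such term.\<close>
  have w: "w1 i \<in> M" "w2 i \<in> M"
    by (rule gen[of _ "\<nu> (Suc i)"], use neg in \<open>auto simp: dual_def S_def lpair_simps\<close>)
      (rule gen[of _ "\<nu> i"], use neg in \<open>auto simp: dual_def S_def lpair_simps\<close>)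
  have "w \<in> M" by (rule generated[of _ i, OF M0 M_add]) (use w M_uminus in blast)+
  then show ?thesis by (simp add: M_def)
qed

end

section \<open>One graded piece, with the numbering rotated to suit the degree\<close>

locale fan_cycle_degree = fan_cycle +
  fixes u :: latt
  assumes l_pos: "0 < l" and start: "lpair (\<nu> 0) u \<ge> 0"
    "\<And>i. lpair (\<nu> i) u \<ge> 0 \<Longrightarrow> lpair (\<nu> (Suc i)) u < 0 \<Longrightarrow> \<nu> i = \<nu> 0"
begin

text \<open>The rays that will be counted. As indices are natural numbers, \<open>k + l - 1\<close>
  stands for the cyclic predecessor of \<open>k\<close>.\<close>

definition I :: "nat set" where
  "I = {k. k < l \<and> lpair (\<nu> k) u = - 1 \<and> lpair (\<nu> (Suc k)) u < 0 \<and> lpair (\<nu> (k + l - 1)) u < 0}"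

lemma I_cases:
  assumes "k \<in> I"
  obtains j where "k = Suc j" "Suc j < l" "lpair (\<nu> (Suc j)) u = - 1" "lpair (\<nu> (Suc (Suc j))) u < 0" "lpair (\<nu> j) u < 0"
proof -
  have "k \<noteq> 0"
  proof
    assume "k = 0"
    then show False using assms start(1) unfolding I_def by simp
  qed
  then obtain j where j: "k = Suc j" by (cases k) auto
  have "\<nu> (k + l - 1) = \<nu> j" unfolding periodic j by simp
  then show ?thesis using that[of j] assms j by (auto simp: I_def)
qed

lemma Suc_mem_I:
  assumes "Suc j < l" "lpair (\<nu> (Suc j)) u = - 1" "lpair (\<nu> (Suc (Suc j))) u < 0" "lpair (\<nu> j) u < 0"
  shows "Suc j \<in> I"
proof -
  have "\<nu> (Suc j + l - 1) = \<nu> j" unfolding periodic by simp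
  then show ?thesis using assms by (simp add: I_def)
qed

text \<open>The family with prescribed jumps across the divisors of the rays in I. Its values go back to
  zero across the divisor of the ray 0, where u is nonnegative, so this last jump is harmless.\<close>

definition family :: "(nat \<Rightarrow> complex) \<Rightarrow> nat \<Rightarrow> complex \<times> complex" where
  "family a j = (\<Sum>k\<in>I. if k \<le> j then csc (a k) (cpt (\<nu> k)) else 0)"

lemma finite_I: "finite I"
  by (simp add: I_def)

lemma family_jump:
  "family a (Suc j) - family a j = (if Suc j \<in> I then csc (a (Suc j)) (cpt (\<nu> (Suc j))) else 0)"
proof -
  have "family a (Suc j) - family a j = (\<Sum>k\<in>I. if k = Suc j then csc (a k) (cpt (\<nu> k)) else 0)"
    unfolding family_def sum_subtractf[symmetric] by (rule sum.cong) auto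
  then show ?thesis using finite_I by simp
qed

lemma family_compatible: "compatible u (family a)"
  unfolding compatible_def
proof (intro allI impI)
  fix i assume i: "i < l"
  show "regular (\<nu> (Suc i)) u (family a (Suc i mod l) - family a i)"
  proof (cases "Suc i < l")
    case True
    have "regular (\<nu> (Suc i)) u (csc c (cpt (\<nu> (Suc i))))" if "Suc i \<in> I" for c
      using that unfolding regular_alt I_def by blast
    then show ?thesis using True family_jump[of a i] by simp
  next
    case False
    then have "Suc i = l" using i by simp
    then have "\<nu> (Suc i) = \<nu> 0" unfolding periodic by simp
    then show ?thesis using start(1) by (simp add: regular_def)
  qed
qed

lemma family_diff: "family a j - family a' j = family (\<lambda>k. a k - a' k) j"
  unfolding family_def sum_subtractf[symmetric] by (rule sum.cong) (auto simp: csc_diff)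

lemma family_cocycle_diff:
  "family_cocycle u (family a) - family_cocycle u (family a') = family_cocycle u (family (\<lambda>k. a k - a' k))"
  by (rule ext) (simp add: family_cocycle_def hder_diff[symmetric] family_diff[symmetric] algebra_simps)

text \<open>A 0-cochain bounding the cocycle gives one regular field on each chart, and consecutive
  ones differ by the jump of the family. At a ray in \<open>I\<close> both adjacent charts have two
  negative rays, so neither field has a component of degree u to account for the jump.\<close>

lemma family_coboundary_zero:
  assumes cob: "family_cocycle u (family a) \<in> tcoboundaries \<Sigma> (Suc 0)" and k: "k \<in> I"
  shows "a k = 0"
proof -
  obtain b where b: "b \<in> tcochains \<Sigma> 0"
    "\<And>xs. length xs = 2 \<Longrightarrow> set xs \<subseteq> TV_points \<Sigma> \<Longrightarrow> family_cocycle u (family a) xs = cech_diff b xs"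
    using cob by (auto simp: topspace_TV)
  obtain V where V: "open_cover \<Sigma> V" "\<And>xs. length xs = Suc 0 \<and> set xs \<subseteq> TV_points \<Sigma> \<Longrightarrow> section_on V xs (b xs)"
    using b(1) unfolding cochains_iff by blast
  have bx: "b [x] \<in> tstalk x" if x: "x \<in> TV_points \<Sigma>" for x
  proof -
    have "section_on V [x] (b [x])" using V(2)[of "[x]"] x by simp
    then show ?thesis by (rule section_onD) (use open_coverD(2)[OF V(1) x] in simp)
  qed
  let ?m = "family a" and ?p = "fixed_point 0"
  \<comment> \<open>The field \<open>b [x]\<close> minus that of the family at \<open>x\<close> is
    the same for all points \<open>x\<close>; it is taken at \<open>?p\<close>, and adding the value
    of the family on chart \<open>i\<close> makes it regular there.\<close>
  define E where "E i = (b [?p] - hder u (?m (chart_index ?p))) + hder u (?m i)" for i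
  have E: "E i \<in> tstalk x" if i: "i < l" and x: "x \<in> X i" for i x
  proof -
    have TV: "x \<in> TV_points \<Sigma>" by (rule X_TV[OF x])
    have "hder u (?m (chart_index x) - ?m (chart_index ?p)) = b [x] - b [?p]"
      using b(2)[of "[?p, x]"] TV fixed_point_TV by (simp add: family_cocycle_def cech_diff_pair)
    then have "E i = b [x] + hder u (?m i - ?m (chart_index x))"
      unfolding E_def hder_diff by (simp add: algebra_simps)
    moreover have "hder u (?m i - ?m (chart_index x)) \<in> tstalk x"
      by (rule compatible_tstalk[OF family_compatible chart_index(1)[OF l_pos TV] i chart_index(2)[OF l_pos TV] x])
    ultimately show ?thesis using tstalk_add[OF X_subring[OF x] bx[OF TV]] by simp
  qed
  obtain j where j: "k = Suc j" "Suc j < l" "lpair (\<nu> (Suc j)) u = - 1" "lpair (\<nu> (Suc (Suc j))) u < 0" "lpair (\<nu> j) u < 0"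
    using k by (rule I_cases)
  have jl: "j < l" using j(2) by simp
  have der: "derivation (E i)" if "i < l" for i
    using E[OF that fixed_point_X] by (rule tstalk_derivation)
  \<comment> \<open>\<open>w1 (Suc j)\<close> pairs to 1 with the ray \<open>\<nu> (Suc j)\<close>,
    so evaluating the jump on its character returns \<open>a k\<close>.\<close>
  let ?w = "w1 (Suc j)"
  have "E (Suc j) (chi ?w) \<in> lspan (- {u + ?w})"
    by (rule no_negative_component[where i = "Suc j", OF der[OF j(2)] E[OF j(2)]]) (use j in simp_all)
  moreover have "E j (chi ?w) \<in> lspan (- {u + ?w})"
    by (rule no_negative_component[where i = j, OF der[OF jl] E[OF jl]]) (use j in simp_all)
  ultimately have "E (Suc j) (chi ?w) - E j (chi ?w) \<in> lspan (- {u + ?w})" by (rule lspan_diff)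
  moreover have "E (Suc j) (chi ?w) - E j (chi ?w) = hder u (?m (Suc j) - ?m j) (chi ?w)"
    unfolding E_def hder_diff by simp
  moreover have "hder u (?m (Suc j) - ?m j) (chi ?w) = rconst (a k) * chi (u + ?w)"
    using k j(1) unfolding family_jump hder_chi by (simp add: npair_csc_cpt)
  ultimately have "rconst (a k) * chi (u + ?w) \<in> lspan (- {u + ?w})" by simp
  moreover have "rconst (a k) * chi (u + ?w) \<in> lspan {u + ?w}" by (rule lspan_term) simp
  ultimately have "rconst (a k) * chi (u + ?w) = 0" by (rule lspan_disjoint) simp
  then show ?thesis by simp
qed

text \<open>The values at the fixed points determine the jumps across the rays. After those in
  \<open>I\<close> are subtracted, a suitable constant shift makes the remaining family regular on
  every chart.\<close>

lemma homogeneous_cocycle_family: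
  assumes c: "c \<in> tcocycles \<Sigma> (Suc 0)"
    and hom: "\<And>xs. length xs = 2 \<Longrightarrow> set xs \<subseteq> TV_points \<Sigma> \<Longrightarrow> homogeneous_derivation u (c xs)"
  obtains a where "c - family_cocycle u (family a) \<in> tcoboundaries \<Sigma> (Suc 0)"
proof -
  obtain U n where U: "open_cover \<Sigma> U"
    and cn: "\<And>x y. x \<in> TV_points \<Sigma> \<Longrightarrow> y \<in> TV_points \<Sigma> \<Longrightarrow> c [x, y] = hder u (n y - n x)"
    and nU: "\<And>x y z. x \<in> TV_points \<Sigma> \<Longrightarrow> y \<in> TV_points \<Sigma> \<Longrightarrow> z \<in> U x \<Longrightarrow> z \<in> U y \<Longrightarrow> hder u (n y - n x) \<in> tstalk z"
    using homogeneous_cocycle[OF c hom] by metis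
  define q where "q i = n (fixed_point i)" for i
  have divisor: "divisor_point i \<in> U (fixed_point i)" "divisor_point (Suc i) \<in> U (fixed_point i)" for i
    using divisor_point_mem[OF open_coverD[OF U fixed_point_TV] fixed_point_X] chi_not_mem_fixed_point by blast+
  \<comment> \<open>The fixed points of charts \<open>i\<close> and \<open>Suc i\<close> both lie on
    the divisor of \<open>\<nu> (Suc i)\<close>, whose generic point therefore belongs to both
    neighbourhoods.\<close>
  have jump: "regular (\<nu> (Suc i)) u (q (Suc i) - q i)" for i
    unfolding q_def by (rule tstalk_divisor_point) (rule nU[OF fixed_point_TV fixed_point_TV divisor(2) divisor(1)])
  have "\<exists>a. q k - q (k - 1) = csc a (cpt (\<nu> k))" if k: "k \<in> I" for k
  proof -
    obtain j where j: "k = Suc j" "lpair (\<nu> (Suc j)) u = - 1" using k by (rule I_cases)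
    have "q k - q (k - 1) = 0 \<or> (\<exists>c. q k - q (k - 1) = csc c (cpt (\<nu> k)))"
      using jump[of j] j unfolding regular_alt by simp
    then show ?thesis by (metis csc_0(1))
  qed
  then obtain a where a: "\<And>k. k \<in> I \<Longrightarrow> q k - q (k - 1) = csc (a k) (cpt (\<nu> k))" by metis
  define \<mu> where "\<mu> i = q i - family a i" for i
  have \<mu>_jump: "\<mu> (Suc i) - \<mu> i = (q (Suc i) - q i) - (family a (Suc i) - family a i)" for i
    unfolding \<mu>_def by (simp add: algebra_simps)
  have \<mu>_I: "\<mu> (Suc i) - \<mu> i = 0" if "Suc i \<in> I" for i
    unfolding \<mu>_jump family_jump using a[OF that] that by simp
  have \<mu>_regular: "regular (\<nu> (Suc i)) u (\<mu> (Suc i) - \<mu> i)" for i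
  proof (cases "Suc i \<in> I")
    case True then show ?thesis using \<mu>_I by simp
  next
    case False
    then show ?thesis unfolding \<mu>_jump family_jump using jump by simp
  qed
  \<comment> \<open>With negative neighbours, a ray of value -1 lies in \<open>I\<close> and its
    jump has been removed; for a smaller value, regularity allows no jump.\<close>
  have \<mu>_neg: "\<mu> (Suc i) = \<mu> i"
    if "Suc i < l" "lpair (\<nu> i) u < 0" "lpair (\<nu> (Suc i)) u < 0" "lpair (\<nu> (Suc (Suc i))) u < 0" for i
  proof (cases "lpair (\<nu> (Suc i)) u = - 1")
    case True
    then have "\<mu> (Suc i) - \<mu> i = 0" using \<mu>_I Suc_mem_I that by blast
    then show ?thesis by simp
  next
    case False
    then have "\<mu> (Suc i) - \<mu> i = 0" using \<mu>_regular[of i] that(3) unfolding regular_def by simp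
    then show ?thesis by simp
  qed
  have not_0: "\<nu> (Suc i) \<noteq> \<nu> 0" if "Suc i < l" for i using that by (simp add: periodic)
  \<comment> \<open>Only at ray 0 can u drop below zero, so negativity propagates backwards as far
    as ray 1.\<close>
  have down: "lpair (\<nu> (Suc i)) u < 0" if "Suc i < l" "lpair (\<nu> (Suc (Suc i))) u < 0" for i
    using start(2)[of "Suc i"] not_0[OF that(1)] that(2) by force
  have const: "\<mu> (Suc i) = \<mu> 1" if "Suc i < l" "lpair (\<nu> (Suc i)) u < 0" "lpair (\<nu> (Suc (Suc i))) u < 0" for i
    using that
  proof (induction i)
    case (Suc i)
    have neg: "lpair (\<nu> (Suc i)) u < 0" using down[of i] Suc.prems by simp
    have "\<mu> (Suc i) = \<mu> 1" using Suc neg by simp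
    moreover have "\<mu> (Suc (Suc i)) = \<mu> (Suc i)" using \<mu>_neg[of "Suc i"] neg Suc.prems by simp
    ultimately show ?case by simp
  qed simp
  \<comment> \<open>All charts with two negative rays share the value \<open>\<mu> 1\<close>. A
    chart at either end of the negative stretch differs from it by at most one jump, regular along
    its negative ray; its other ray is nonnegative and imposes nothing.\<close>
  have reg: "regular (\<nu> i) u (\<mu> i - \<mu> 1) \<and> regular (\<nu> (Suc i)) u (\<mu> i - \<mu> 1)" if i: "i < l" for i
  proof (cases "lpair (\<nu> i) u \<ge> 0")
    case True
    show ?thesis
    proof (cases "lpair (\<nu> (Suc i)) u \<ge> 0")
      case T2: True
      then show ?thesis using True by (simp add: regular_def)
    next
      case False
      then have "\<nu> i = \<nu> 0" using start(2) True by simp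
      then have "i = 0" using i by (simp add: periodic)
      then show ?thesis using True regular_uminus[OF \<mu>_regular[of 0]] by (simp add: regular_def)
    qed
  next
    case False
    then obtain j where j: "i = Suc j" using start(1) by (cases i) auto
    show ?thesis
    proof (cases "lpair (\<nu> (Suc i)) u \<ge> 0")
      case True
      have "regular (\<nu> i) u (\<mu> i - \<mu> 1)"
      proof (cases j)
        case 0 then show ?thesis using j by simp
      next
        case (Suc j')
        have "lpair (\<nu> j) u < 0" using down[of j'] Suc False i j by simp
        then have "\<mu> j = \<mu> 1" using const[of j'] Suc False i j by simp
        then show ?thesis using \<mu>_regular[of j] j by simp
      qed
      then show ?thesis using True by (simp add: regular_def)
    next
      case F2: False
      then have "\<mu> i = \<mu> 1" using const[of j] j i False by simp
      then show ?thesis by simp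
    qed
  qed
  \<comment> \<open>Shifting by the constant \<open>\<mu> 1\<close> does not affect the coboundary;
    it is what makes the values regular.\<close>
  define b where "b xs = hder u ((n (hd xs) - family a (chart_index (hd xs))) - \<mu> 1)" for xs
  define W where "W x = U x \<inter> X (chart_index x)" for x
  have W: "open_cover \<Sigma> W" unfolding W_def by (rule open_cover_Int[OF U chart_cover[OF l_pos]])
  \<comment> \<open>The value at \<open>w\<close> is compared with that at the fixed point of its
    chart. Only divisors through \<open>w\<close> matter, and their generic points lie in both
    neighbourhoods.\<close>
  have local: "b [w] \<in> tstalk w" if w: "w \<in> TV_points \<Sigma>" for w
  proof -
    define i where "i = chart_index w"
    have i: "i < l" "w \<in> X i" unfolding i_def by (rule chart_index[OF l_pos w])+
    have sub: "is_subring w" by (rule X_subring[OF i(2)])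
    have "hder u (n w - q i) \<in> tstalk w"
    proof (rule hder_tstalk[OF i(2)])
      show "regular (\<nu> i) u (n w - q i) \<or> chi (- w1 i) \<in> w"
      proof (rule disjCI)
        assume "chi (- w1 i) \<notin> w"
        then have "divisor_point i \<in> U w" using divisor_point_mem(1)[OF open_coverD[OF U w] i(2)] by blast
        then show "regular (\<nu> i) u (n w - q i)"
          unfolding q_def by (intro tstalk_divisor_point nU[OF fixed_point_TV w divisor(1)])
      qed
      show "regular (\<nu> (Suc i)) u (n w - q i) \<or> chi (- w2 i) \<in> w"
      proof (rule disjCI)
        assume "chi (- w2 i) \<notin> w"
        then have "divisor_point (Suc i) \<in> U w" using divisor_point_mem(2)[OF open_coverD[OF U w] i(2)] by blast
        then show "regular (\<nu> (Suc i)) u (n w - q i)"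
          unfolding q_def by (intro tstalk_divisor_point nU[OF fixed_point_TV w divisor(2)])
      qed
    qed
    moreover have "hder u (\<mu> i - \<mu> 1) \<in> tstalk w" using hder_tstalk[OF i(2)] reg[OF i(1)] by blast
    ultimately have "hder u (n w - q i) + hder u (\<mu> i - \<mu> 1) \<in> tstalk w" by (rule tstalk_add[OF sub])
    moreover have "(n w - q i) + (\<mu> i - \<mu> 1) = n w - family a i - \<mu> 1" unfolding \<mu>_def[of i] by simp
    ultimately have "hder u (n w - family a i - \<mu> 1) \<in> tstalk w" by (metis hder_add)
    then show ?thesis unfolding b_def i_def by simp
  qed
  have "b \<in> tcochains \<Sigma> 0"
    unfolding cochains_iff
  proof (intro exI[of _ W] conjI W allI impI)
    fix xs :: "ratfun set list" assume xs: "length xs = Suc 0 \<and> set xs \<subseteq> TV_points \<Sigma>"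
    then obtain x where x: "xs = [x]" using length_Suc_0_E by blast
    then have TV: "x \<in> TV_points \<Sigma>" using xs by simp
    \<comment> \<open>\<open>b [x]\<close> and \<open>b [w]\<close> differ by values of the cocycle
      and of the family cocycle, both regular at \<open>w\<close>, so regularity spreads from
      \<open>local\<close>.\<close>
    have "b [x] \<in> tstalk w" if w: "w \<in> W x" for w
    proof -
      have wX: "w \<in> U x" "w \<in> X (chart_index x)" using w by (simp_all add: W_def)
      have wTV: "w \<in> TV_points \<Sigma>" by (rule X_TV[OF wX(2)])
      have sub: "is_subring w" by (rule X_subring[OF wX(2)])
      have "hder u (n x - n w) \<in> tstalk w" by (rule nU[OF wTV TV open_coverD(2)[OF U wTV] wX(1)])
      moreover have "hder u (family a (chart_index x) - family a (chart_index w)) \<in> tstalk w"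
        by (rule compatible_tstalk[OF family_compatible chart_index(1)[OF l_pos wTV] chart_index(1)[OF l_pos TV]
              chart_index(2)[OF l_pos wTV] wX(2)])
      ultimately have "hder u (n x - n w) - hder u (family a (chart_index x) - family a (chart_index w)) \<in> tstalk w"
        by (rule tstalk_diff[OF sub])
      then have "(hder u (n x - n w) - hder u (family a (chart_index x) - family a (chart_index w))) + b [w] \<in> tstalk w"
        by (rule tstalk_add[OF sub]) (rule local[OF wTV])
      moreover have "((n x - n w) - (family a (chart_index x) - family a (chart_index w))) +
          (n w - family a (chart_index w) - \<mu> 1) = n x - family a (chart_index x) - \<mu> 1" by simp
      ultimately have "hder u (n x - family a (chart_index x) - \<mu> 1) \<in> tstalk w"
        unfolding b_def list.sel by (metis hder_add hder_diff)
      then show ?thesis unfolding b_def by simp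
    qed
    then show "section_on W xs (b xs)" unfolding section_on_def x b_def using derivation_hder by simp
  qed
  moreover have "(c - family_cocycle u (family a)) xs = cech_diff b xs" if xs: "length xs = 2" "set xs \<subseteq> TV_points \<Sigma>" for xs
  proof -
    obtain x y where xy: "xs = [x, y]" using length_2_E[OF xs(1)] by metis
    have eq: "(n y - n x) - (family a (chart_index y) - family a (chart_index x)) =
      ((n y - family a (chart_index y)) - \<mu> 1) - ((n x - family a (chart_index x)) - \<mu> 1)"
      by (simp add: algebra_simps)
    have "(c - family_cocycle u (family a)) [x, y] = c [x, y] - family_cocycle u (family a) [x, y]"
      by (rule minus_apply)
    also have "\<dots> = hder u ((n y - n x) - (family a (chart_index y) - family a (chart_index x)))"
      using cn[of x y] xs(2) xy by (simp add: family_cocycle_def hder_diff)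
    also have "\<dots> = b [y] - b [x]" unfolding eq b_def by (simp only: hder_diff list.sel)
    finally show ?thesis unfolding xy cech_diff_pair .
  qed
  moreover have "c - family_cocycle u (family a) \<in> tcochains \<Sigma> (Suc 0)"
    using cochains_diff c family_cocycle[OF l_pos family_compatible] unfolding cocycles_def by blast
  ultimately have "c - family_cocycle u (family a) \<in> tcoboundaries \<Sigma> (Suc 0)"
    by (auto simp: topspace_TV)
  then show ?thesis by (rule that)
qed

lemma T1_degree_eq: "T1_degree \<Sigma> u = range (\<lambda>a. tclass \<Sigma> 1 (family_cocycle u (family a)))"
proof (intro subset_antisym subsetI)
  fix \<xi> assume "\<xi> \<in> T1_degree \<Sigma> u"
  then obtain c0 c where c0: "c0 \<in> tcocycles \<Sigma> (Suc 0)" "\<xi> = tclass \<Sigma> (Suc 0) c0" and c: "c \<in> \<xi>"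
    and hom: "\<And>xs. length xs = 2 \<Longrightarrow> set xs \<subseteq> TV_points \<Sigma> \<Longrightarrow> homogeneous_derivation u (c xs)"
    unfolding T1_degree_def T1_def cohomology_def topspace_TV by auto
  have cc: "c \<in> tcocycles \<Sigma> (Suc 0)" "c - c0 \<in> tcoboundaries \<Sigma> (Suc 0)"
    using c unfolding c0(2) cohom_class_def by simp_all
  have 1: "\<xi> = tclass \<Sigma> (Suc 0) c" unfolding c0(2) using class_eq_iff[OF cc(1) c0(1)] cc(2) by blast
  obtain a where "c - family_cocycle u (family a) \<in> tcoboundaries \<Sigma> (Suc 0)"
    using homogeneous_cocycle_family[OF cc(1) hom] by metis
  then have "\<xi> = tclass \<Sigma> (Suc 0) (family_cocycle u (family a))"
    unfolding 1 using class_eq_iff[OF cc(1) family_cocycle[OF l_pos family_compatible]] by blast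
  then show "\<xi> \<in> range (\<lambda>a. tclass \<Sigma> 1 (family_cocycle u (family a)))" by simp
next
  fix \<xi> assume "\<xi> \<in> range (\<lambda>a. tclass \<Sigma> 1 (family_cocycle u (family a)))"
  then obtain a where \<xi>: "\<xi> = tclass \<Sigma> (Suc 0) (family_cocycle u (family a))" by auto
  have cyc: "family_cocycle u (family a) \<in> tcocycles \<Sigma> (Suc 0)" by (rule family_cocycle[OF l_pos family_compatible])
  have "family_cocycle u (family a) - family_cocycle u (family a) \<in> tcoboundaries \<Sigma> (Suc 0)"
    unfolding diff_self by (rule coboundaries_0)
  then have "family_cocycle u (family a) \<in> \<xi>" unfolding \<xi> cohom_class_def using cyc by blast
  moreover have "homogeneous_derivation u (family_cocycle u (family a) xs)" for xs
    unfolding family_cocycle_def by (rule homogeneous_hder)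
  moreover have "\<xi> \<in> T1 \<Sigma>" unfolding T1_def cohomology_def \<xi> using cyc by auto
  ultimately show "\<xi> \<in> T1_degree \<Sigma> u" unfolding T1_degree_def by blast
qed

lemma T1_dim: "T1_dim_eq \<Sigma> (T1_degree \<Sigma> u) (card I)"
proof -
  obtain e where e: "bij_betw e {..<card I} I"
    using ex_bij_betw_nat_finite[OF finite_I] by (auto simp: atLeast0LessThan)
  define e' where "e' = inv_into {..<card I} e"
  have e': "e' k < card I" "e (e' k) = k" if "k \<in> I" for k
    using bij_betwE[OF bij_betw_inv_into[OF e]] bij_betw_inv_into_right[OF e] that unfolding e'_def by auto
  have e'e: "e' (e i) = i" "e i \<in> I" if "i < card I" for i
    using bij_betw_inv_into_left[OF e] bij_betwE[OF e] that unfolding e'_def by auto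
  \<comment> \<open>A single unit jump at the ray \<open>e i\<close>; the classes of these families
    are the basis.\<close>
  define \<delta> where "\<delta> i k = (if k = e i then 1 else 0 :: complex)" for i k
  define s where "s i = family_cocycle u (family (\<delta> i))" for i
  have comb: "lin_comb (card I) s a = family_cocycle u (family (\<lambda>k. a (e' k)))" for a
  proof
    fix xs
    have fam: "family (\<lambda>k. a (e' k)) j = (\<Sum>i<card I. csc (a i) (family (\<delta> i) j))" for j
    proof -
      have single: "family (\<delta> i) j = (if e i \<le> j then cpt (\<nu> (e i)) else 0)" if i: "i < card I" for i
      proof -
        have "family (\<delta> i) j = (\<Sum>k\<in>I. if k = e i then (if k \<le> j then cpt (\<nu> k) else 0) else 0)"
          unfolding family_def \<delta>_def by (rule sum.cong) auto
        then show ?thesis using finite_I e'e(2)[OF i] by simp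
      qed
      have "family (\<lambda>k. a (e' k)) j = (\<Sum>i<card I. if e i \<le> j then csc (a (e' (e i))) (cpt (\<nu> (e i))) else 0)"
        unfolding family_def by (rule sum.reindex_bij_betw[OF e, symmetric])
      also have "\<dots> = (\<Sum>i<card I. csc (a i) (family (\<delta> i) j))"
        by (rule sum.cong) (auto simp: single e'e)
      finally show ?thesis .
    qed
    let ?x = "chart_index (xs ! 0)" and ?y = "chart_index (xs ! 1)"
    have "lin_comb (card I) s a xs = (\<Sum>i<card I. fmul (rconst (a i)) (s i xs))"
      unfolding lin_comb_def by (rule ext) (simp add: sum_fun_apply)
    also have "\<dots> = hder u (\<Sum>i<card I. csc (a i) (family (\<delta> i) ?y - family (\<delta> i) ?x))"
      unfolding s_def family_cocycle_def hder_sum hder_csc ..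
    also have "(\<Sum>i<card I. csc (a i) (family (\<delta> i) ?y - family (\<delta> i) ?x)) =
        family (\<lambda>k. a (e' k)) ?y - family (\<lambda>k. a (e' k)) ?x"
      unfolding fam csc_diff_right sum_subtractf ..
    finally show "lin_comb (card I) s a xs = family_cocycle u (family (\<lambda>k. a (e' k))) xs"
      unfolding family_cocycle_def .
  qed
  have "bij_betw (\<lambda>a. tclass \<Sigma> 1 (lin_comb (card I) s a)) ({..<card I} \<rightarrow>\<^sub>E UNIV) (T1_degree \<Sigma> u)"
    unfolding comb bij_betw_def
  proof (intro conjI)
    show "inj_on (\<lambda>a. tclass \<Sigma> 1 (family_cocycle u (family (\<lambda>k. a (e' k))))) ({..<card I} \<rightarrow>\<^sub>E UNIV)"
    proof (rule inj_onI)
      fix a a' :: "nat \<Rightarrow> complex"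
      assume ext: "a \<in> {..<card I} \<rightarrow>\<^sub>E UNIV" "a' \<in> {..<card I} \<rightarrow>\<^sub>E UNIV"
        and "tclass \<Sigma> 1 (family_cocycle u (family (\<lambda>k. a (e' k)))) = tclass \<Sigma> 1 (family_cocycle u (family (\<lambda>k. a' (e' k))))"
      then have "family_cocycle u (family (\<lambda>k. a (e' k))) - family_cocycle u (family (\<lambda>k. a' (e' k))) \<in> tcoboundaries \<Sigma> (Suc 0)"
        using class_eq_iff[OF family_cocycle[OF l_pos family_compatible] family_cocycle[OF l_pos family_compatible]]
        unfolding One_nat_def by blast
      then have "a (e' k) - a' (e' k) = 0" if "k \<in> I" for k
        using family_coboundary_zero[of "\<lambda>k. a (e' k) - a' (e' k)"] that unfolding family_cocycle_diff by blast
      then have "a i = a' i" if "i < card I" for i using e'e[OF that] by (metis eq_iff_diff_eq_0)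
      then show "a = a'" using ext by (intro PiE_ext[of a _ _ a']) auto
    qed
    show "(\<lambda>a. tclass \<Sigma> 1 (family_cocycle u (family (\<lambda>k. a (e' k))))) ` ({..<card I} \<rightarrow>\<^sub>E UNIV) = T1_degree \<Sigma> u"
      unfolding T1_degree_eq
    proof (intro subset_antisym subsetI)
      fix \<xi> assume "\<xi> \<in> range (\<lambda>a. tclass \<Sigma> 1 (family_cocycle u (family a)))"
      then obtain a where \<xi>: "\<xi> = tclass \<Sigma> 1 (family_cocycle u (family a))" by blast
      \<comment> \<open>Only the values on \<open>I\<close> enter \<open>family\<close>, so
        \<open>a\<close> may be replaced by an extensional tuple.\<close>
      define a' where "a' = restrict (\<lambda>i. a (e i)) {..<card I}"
      have "family a j = family (\<lambda>k. a' (e' k)) j" for j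
        unfolding family_def a'_def by (rule sum.cong) (auto simp: e')
      then have "family a = family (\<lambda>k. a' (e' k))" by blast
      moreover have "a' \<in> {..<card I} \<rightarrow>\<^sub>E UNIV" unfolding a'_def by simp
      ultimately show "\<xi> \<in> (\<lambda>a. tclass \<Sigma> 1 (family_cocycle u (family (\<lambda>k. a (e' k))))) ` ({..<card I} \<rightarrow>\<^sub>E UNIV)"
        unfolding \<xi> by (intro image_eqI[of _ _ a']) simp_all
    qed blast
  qed
  moreover have "\<forall>i<card I. s i \<in> tcocycles \<Sigma> 1"
    unfolding s_def One_nat_def using family_cocycle[OF l_pos family_compatible] by blast
  ultimately show ?thesis unfolding T1_dim_eq_def by blast
qed

end

theorem corollary1p5:
  fixes \<Sigma> :: "(rat \<times> rat) set set" and l :: nat and \<rho> :: "nat \<Rightarrow> (rat \<times> rat) set"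
  assumes "complete_fan \<Sigma>" and "smooth_fan \<Sigma>" and "ccw_numbering \<Sigma> l \<rho>"
  shows "(\<forall>u :: latt. T1_dim_eq \<Sigma> (T1_degree \<Sigma> u)
            (card {\<rho> i | i. i < l \<and> lpair (ray_gen (\<rho> i)) u = -1 \<and>
                      lpair (ray_gen (\<rho> ((i + 1) mod l))) u < 0 \<and>
                      lpair (ray_gen (\<rho> ((i + l - 1) mod l))) u < 0}))
         \<and> T2 \<Sigma> = {cohom_class (TV \<Sigma>) (tangent_sheaf \<Sigma>) 2 0}"
proof -
  interpret C: complete_smooth_fan \<Sigma> using assms(1,2) by unfold_locales
  have l: "0 < l" by (rule C.fan_cycle_ray_gen(1)[OF assms(3)])
  define \<nu> where "\<nu> i = ray_gen (\<rho> (i mod l))" for i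
  interpret fan_cycle \<Sigma> l \<nu> unfolding \<nu>_def by (rule C.fan_cycle_ray_gen(2)[OF assms(3)])
  have "T1_dim_eq \<Sigma> (T1_degree \<Sigma> u)
      (card {\<rho> i | i. i < l \<and> lpair (ray_gen (\<rho> i)) u = -1 \<and>
        lpair (ray_gen (\<rho> ((i + 1) mod l))) u < 0 \<and> lpair (ray_gen (\<rho> ((i + l - 1) mod l))) u < 0})"
    (is "T1_dim_eq _ _ (card ?R)") for u
  proof -
    \<comment> \<open>The rotation depends on u, but both the fan and the set of rays counted are
      independent of the starting ray.\<close>
    obtain s where s: "lpair (\<nu> s) u \<ge> 0"
      "\<And>i. lpair (\<nu> i) u \<ge> 0 \<Longrightarrow> lpair (\<nu> (Suc i)) u < 0 \<Longrightarrow> \<nu> i = \<nu> s"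
      using start_index by metis
    interpret sh: fan_cycle \<Sigma> l "\<lambda>i. \<nu> (i + s)" by (rule shift[OF l])
    interpret sh: fan_cycle_degree \<Sigma> l "\<lambda>i. \<nu> (i + s)" u
      by unfold_locales (use l s in auto)
    have "?R = (\<lambda>k. \<rho> ((k + s) mod l)) ` sh.I"
    proof (intro subset_antisym subsetI)
      fix r assume "r \<in> ?R"
      then obtain i where i: "r = \<rho> i" "i < l" "lpair (\<nu> i) u = - 1" "lpair (\<nu> (i + 1)) u < 0" "lpair (\<nu> (i + l - 1)) u < 0"
        by (auto simp: \<nu>_def)
      \<comment> \<open>This is \<open>i - s\<close> modulo \<open>l\<close>; writing
        \<open>l - s mod l\<close> avoids truncated subtraction.\<close>
      define k where "k = (i + (l - s mod l)) mod l"
      have ks: "(k + s) mod l = i"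
      proof -
        have "(k + s) mod l = (i + (l - s mod l) + s mod l) mod l"
          unfolding k_def by (simp add: mod_add_left_eq mod_add_right_eq)
        also have "i + (l - s mod l) + s mod l = i + l" using mod_less_divisor[OF l, of s] by linarith
        finally show ?thesis using i(2) by simp
      qed
      have n0: "\<nu> (k + s) = \<nu> i" unfolding periodic using ks i(2) by simp
      have n1: "\<nu> (Suc k + s) = \<nu> (i + 1)" using n0 periodic_Suc[of "k + s" i] by simp
      have n2: "\<nu> (k + l - 1 + s) = \<nu> (i + l - 1)"
      proof -
        \<comment> \<open>Predecessors are compared through their successors, since
          \<open>periodic_Suc\<close> can be read backwards.\<close>
        have "\<nu> (Suc (k + l - 1 + s)) = \<nu> (Suc (i + l - 1))"
          using n0 l periodic_add_l[of "k + s"] periodic_add_l[of i] by (simp add: add.commute add.left_commute)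
        then show ?thesis using periodic_Suc by blast
      qed
      have "k \<in> sh.I" unfolding sh.I_def using l i n0 n1 n2 by (auto simp: k_def)
      then show "r \<in> (\<lambda>k. \<rho> ((k + s) mod l)) ` sh.I" using i(1) ks by blast
    next
      fix r assume "r \<in> (\<lambda>k. \<rho> ((k + s) mod l)) ` sh.I"
      then obtain k where k: "k \<in> sh.I" "r = \<rho> ((k + s) mod l)" by blast
      define i where "i = (k + s) mod l"
      have i: "i < l" using l by (simp add: i_def)
      have n0: "\<nu> i = \<nu> (k + s)" unfolding i_def by (rule \<nu>_mod)
      have n1: "\<nu> (i + 1) = \<nu> (Suc k + s)" using n0 periodic_Suc[of i "k + s"] by simp
      have n2: "\<nu> (i + l - 1) = \<nu> (k + l - 1 + s)"
      proof -
        have "\<nu> (Suc (i + l - 1)) = \<nu> (Suc (k + l - 1 + s))"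
          using n0 l periodic_add_l[of "k + s"] periodic_add_l[of i] by (simp add: add.commute add.left_commute)
        then show ?thesis using periodic_Suc by blast
      qed
      have "lpair (\<nu> i) u = - 1" "lpair (\<nu> (i + 1)) u < 0" "lpair (\<nu> (i + l - 1)) u < 0"
        using k(1) unfolding sh.I_def n0 n1 n2 by auto
      then show "r \<in> ?R" using i k(2) unfolding i_def[symmetric] by (auto simp: \<nu>_def)
    qed
    moreover have "inj_on (\<lambda>k. \<rho> ((k + s) mod l)) sh.I"
    proof (rule inj_onI)
      fix k k' assume k: "k \<in> sh.I" "k' \<in> sh.I" "\<rho> ((k + s) mod l) = \<rho> ((k' + s) mod l)"
      then have "\<nu> (k + s) = \<nu> (k' + s)" by (simp add: \<nu>_def)
      then show "k = k'" using k sh.periodic[of k k'] by (simp add: sh.I_def)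
    qed
    ultimately have "card ?R = card sh.I" by (simp add: card_image)
    then show ?thesis using sh.T1_dim by simp
  qed
  then show ?thesis using T2_trivial[OF l] by blast
qed

end
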